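(* Let $q$ be a prime power and $t\ge 1$ an integer, both fixed. The limiting proportion as $n\to\infty$ of elements in any coset of $\operatorname{SU}_n(q)$ in $\operatorname{GU}_n(q)$ which have no (irreducible) factors of degree at most $t$ dividing the characteristic polynomial is equal to $$\prod_{j=1}^t\left[ \prod_{i \geq 1} \left( 1 + \frac{1}{(-q)^{ij}} \right)^{\tilde{N}(q;j)} \prod_{i \geq 1} \left( 1 - \frac{1}{q^{2ij}} \right)^{\tilde{M}(q;j)}\right].$$
   Context: $\operatorname{GU}_n(q)\le \operatorname{GL}_n(q^2)$ is the full unitary group and $\operatorname{SU}_n(q)$ its subgroup of elements of determinant $1$; characteristic polynomials and their factors are taken over $\mathbf{F}_{q^2}$. For a polynomial $\phi\in\mathbf{F}_{q^2}[z]$ of degree $n$ with non-zero constant term, the conjugate is $\tilde{\phi}(z) := \phi(0)^{-q}\, z^n \phi^{\sigma}(1/z)$, where $\phi^\sigma$ is obtained from $\phi$ by replacing each coefficient by its $q$th power. $\tilde N(q;j)$ is the number of monic irreducible polynomials $\phi\neq z$ of degree $j$ over $\mathbf{F}_{q^2}$ with $\phi=\tilde\phi$ (this is non-zero only for odd $j$), and $\tilde M(q;j)$ is the number of unordered pairs $\{\phi,\tilde\phi\}$ of monic irreducible polynomials, different from $z$, of degree $j$ over $\mathbf{F}_{q^2}$ with $\phi\ne\tilde\phi$. *)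

theory Defs
  imports
    "HOL-Analysis.Infinite_Products"
    "HOL-Number_Theory.Prime_Powers"
    "HOL-Algebra.Coset"
    "Jordan_Normal_Form.Char_Poly"
begin

text \<open>Throughout, the type \<open>'a\<close> plays the role of the field with \<open>q\<^sup>2\<close> elements, so that
  \<open>x \<mapsto> x ^ q\<close> is its involutory automorphism.\<close>

definition GL :: "nat \<Rightarrow> 'a::field mat monoid" where
  "GL n = units_of (ring_mat TYPE('a) n ())"

text \<open>The isometry group of the standard non-degenerate Hermitian form
  \<open>(x, y) \<mapsto> \<Sum>i<n. x\<^sub>i * y\<^sub>i ^ q\<close>.\<close>

definition GU :: "nat \<Rightarrow> nat \<Rightarrow> 'a::field mat monoid" where
  "GU q n = (GL n)\<lparr>carrier :=
     {A \<in> carrier (GL n). A * transpose_mat (map_mat (\<lambda>x. x ^ q) A) = 1\<^sub>m n}\<rparr>"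

definition SU :: "nat \<Rightarrow> nat \<Rightarrow> 'a::field mat set" where
  "SU q n = {A \<in> carrier (GU q n). det A = 1}"

text \<open>\<open>reflect_poly p\<close> is \<open>z ^ degree p * p (1 / z)\<close>.\<close>

definition conj_poly :: "nat \<Rightarrow> 'a::field poly \<Rightarrow> 'a poly" where
  "conj_poly q \<phi> =
     Polynomial.smult (inverse (poly \<phi> 0 ^ q)) (reflect_poly (map_poly (\<lambda>c. c ^ q) \<phi>))"

definition monic_irreducibles :: "nat \<Rightarrow> 'a::field poly set" where
  "monic_irreducibles j =
     {\<phi>. monic \<phi> \<and> irreducible \<phi> \<and> degree \<phi> = j \<and> \<phi> \<noteq> [:0, 1:]}"

definition N_tilde :: "'a::field itself \<Rightarrow> nat \<Rightarrow> nat \<Rightarrow> nat" where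
  "N_tilde _ q j = card {\<phi> \<in> (monic_irreducibles j :: 'a poly set). \<phi> = conj_poly q \<phi>}"

definition M_tilde :: "'a::field itself \<Rightarrow> nat \<Rightarrow> nat \<Rightarrow> nat" where
  "M_tilde _ q j =
     card {{\<phi>, conj_poly q \<phi>} | \<phi>. \<phi> \<in> (monic_irreducibles j :: 'a poly set) \<and> \<phi> \<noteq> conj_poly q \<phi>}"

definition no_factor_upto :: "nat \<Rightarrow> 'a::field poly \<Rightarrow> bool" where
  "no_factor_upto t p \<longleftrightarrow> (\<forall>\<phi>. irreducible \<phi> \<and> degree \<phi> \<le> t \<longrightarrow> \<not> \<phi> dvd p)"

end

theory Submission
  imports Defs "HOL-Algebra.Algebraic_Closure_Type"
begin

text \<open>An injection \<open>T\<close> of an \<open>F[z]\<close>-module \<open>M\<close> into \<open>n\<close>-space that intertwines \<open>z\<close> with a unitary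
  matrix \<open>A\<close> pulls the Hermitian form back to a \<open>z\<close>-invariant Hermitian form on \<open>M\<close>. For large \<open>n\<close> the
  special unitary group is transitive on the injections with a given pulled-back form, so the average
  number of such \<open>T\<close>, over \<open>A\<close> in any coset, is exactly the number of \<open>z\<close>-invariant Hermitian forms
  on \<open>M\<close>. Take \<open>M\<close> semisimple, with simple constituents given by the polynomials of degree at most
  \<open>t\<close>, using only one polynomial of each pair of distinct conjugates. Then this number is a product of local
  factors, namely \<open>q^(j m\<^sup>2)\<close> for a self-conjugate polynomial of degree \<open>j\<close> and multiplicity \<open>m\<close>, and \<open>1\<close> for
  the others. Since the kernel of \<open>\<phi>(A)\<close> is a vector space over \<open>F[z]/(\<phi>)\<close>, a \<open>q\<close>-analogue
  of inclusion-exclusion recovers the limiting probability that all these kernels vanish from the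
  moments, and Euler's identities turn the resulting series into the infinite products.\<close>

subsection \<open>Fields of square order\<close>

text \<open>The moment of a module of dimension \<open>k\<close> is exact, not asymptotic, once
  \<open>n\<close> exceeds a linear bound in \<open>k\<close>, and it is the same on every coset
  because the stabiliser of a frame contains unitary matrices of every possible determinant. Gram
  matrices of frames may be degenerate, so transitivity is a Witt-type statement; spare dimensions
  allow a proof by explicit involutions, and an element of trace 1 takes the place of 1/2, so that
  characteristic 2 is not special. Only one polynomial of each pair may be used: with both present,
  invariant forms could pair the two isotypic parts and the moments would not factor over the
  polynomials. Nothing is lost, as \<phi>(A) and the conjugate polynomial at A are singular
  together. For self-conjugate \<phi> of degree j the normalised moment has size about q^(-jm),
  since q^(j m^2) is divided by a product of size q^(j m (m+1)). It tends to 0, so cutting the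
  inversion after K terms costs an error that vanishes when first n and then K grows.\<close>

lemma power_card_field_eq_self:
  fixes x :: "'a::{field,finite}"
  shows "x ^ CARD('a) = x"
proof (cases "x = 0")
  case False
  \<comment> \<open>Multiplication by \<open>x\<close> permutes the nonzero elements, so their
    product is unchanged.\<close>
  have "(\<Prod>y\<in>UNIV-{0::'a}. x * y) = \<Prod>(UNIV-{0::'a})"
    by (rule prod.reindex_bij_witness[of _ "\<lambda>y. y / x" "\<lambda>y. x * y"]) (use False in auto)
  moreover have "(\<Prod>y\<in>UNIV-{0::'a}. x * y) = x ^ (CARD('a) - 1) * \<Prod>(UNIV-{0::'a})"
    by (simp add: prod.distrib)
  moreover have "\<Prod>(UNIV-{0::'a}) \<noteq> 0" by simp
  ultimately have "x ^ (CARD('a) - 1) = 1" by simp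
  moreover have "CARD('a) = Suc (CARD('a) - 1)"
    by (simp add: card_gt_0_iff)
  ultimately show ?thesis
    by (metis mult.right_neutral power_Suc)
qed (simp add: card_gt_0_iff)

hide_const (open) Divisibility.prime Divisibility.irreducible up_ring.monom up_ring.coeff Polynomials.lead_coeff
  Polynomials.degree module.smult

unbundle no vec_syntax
no_notation fps_nth (infixl "$" 75)

locale herm =
  fixes q :: nat and F :: "'a::{field,finite} itself"
  assumes primepow_q: "primepow q" and card_q: "CARD('a) = q ^ 2"
begin

lemma q_ge_2: "q \<ge> 2"
  using primepow_gt_Suc_0[OF primepow_q] by simp

text \<open>Translation by 1 permutes the field, so the number of elements is zero in the field and
  the characteristic divides a power of the prime under \<open>q\<close>. This makes
  \<open>x ^ q\<close> additive.\<close>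

lemma q_eq_CHAR_power: "prime CHAR('a)" "\<exists>k>0. q = CHAR('a) ^ k"
proof -
  show 1: "prime CHAR('a)"
    by (simp add: finite_imp_CHAR_pos prime_CHAR_semidom)
  obtain p k where pk: "prime p" "k > 0" "q = p ^ k"
    using primepow_q by (auto simp: primepow_def)
  have "(\<Sum>x\<in>(UNIV::'a set). x + 1) = (\<Sum>x\<in>UNIV. x)"
    by (rule sum.reindex_bij_witness[of _ "\<lambda>x. x - 1" "\<lambda>x. x + 1"]) auto
  hence "of_nat CARD('a) = (0::'a)" by (simp add: sum.distrib)
  hence "CHAR('a) dvd CARD('a)" by (simp add: of_nat_eq_0_iff_char_dvd)
  hence "CHAR('a) dvd p ^ (k * 2)"
    using card_q pk by (simp add: power_mult)
  hence "CHAR('a) dvd p" using 1 prime_dvd_power by blast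
  hence "CHAR('a) = p" using 1 pk(1) by (simp add: primes_dvd_imp_eq)
  with pk show "\<exists>k>0. q = CHAR('a) ^ k" by auto
qed

lemma frob_add: "((x::'a) + y) ^ q = x ^ q + y ^ q"
  using q_eq_CHAR_power freshmans_dream'[where 'a='a] by metis

lemma frob_add_ac: "((x::'a alg_closure) + y) ^ q = x ^ q + y ^ q"
  using q_eq_CHAR_power freshmans_dream'[where 'a="'a alg_closure"] by (metis CHAR_alg_closure)

lemma q_pos [simp]: "q > 0"
  using q_ge_2 by simp

lemma frob_0 [simp]: "(0::'b::semiring_1) ^ q = 0"
  by (simp add: power_0_left)

lemma frob_frob [simp]: "((x::'a) ^ q) ^ q = x"
  using power_card_field_eq_self[of x] by (simp add: card_q power_mult power2_eq_square)

lemma frob_minus: "(- (x::'a)) ^ q = - (x ^ q)"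
  using frob_add[of x "-x"] by (simp add: eq_neg_iff_add_eq_0 add.commute)

lemma frob_diff: "((x::'a) - y) ^ q = x ^ q - y ^ q"
  using frob_add[of x "-y"] by (simp add: frob_minus)

lemma frob_sum: "(\<Sum>i\<in>I. f i :: 'a) ^ q = (\<Sum>i\<in>I. f i ^ q)"
  by (induction I rule: infinite_finite_induct) (auto simp: frob_add)

lemma frob_eq_0_iff [simp]: "(x::'a) ^ q = 0 \<longleftrightarrow> x = 0"
  using q_ge_2 by simp

text \<open>The polynomial X^q + X has at most q < q^2 roots, so some trace is nonzero; it is fixed
  by the involution and can be divided out. Such an element stands in for 1/2 in every
  characteristic.\<close>

lemma ex_trace_1: "\<exists>\<theta>::'a. \<theta> + \<theta> ^ q = 1"
proof -
  let ?p = "monom 1 q + monom 1 1 :: 'a poly"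
  have d: "degree ?p = q"
    using q_ge_2 by (subst degree_add_eq_left) (auto simp: degree_monom_eq)
  hence "?p \<noteq> 0" using q_ge_2 by force
  hence "card {x. poly ?p x = 0} \<le> q" using card_poly_roots_bound[of ?p] d by simp
  also have "q < CARD('a)" using q_ge_2 by (simp add: card_q power2_eq_square)
  finally have "{x. poly ?p x = 0} \<noteq> UNIV" by auto
  then obtain x :: 'a where "x + x ^ q \<noteq> 0" by (auto simp: poly_monom add.commute)
  define c where "c = x + x ^ q"
  have "c ^ q = c" by (simp add: c_def frob_add add.commute)
  hence "x / c + (x / c) ^ q = 1"
    using \<open>x + x ^ q \<noteq> 0\<close> by (simp add: c_def power_divide flip: add_divide_distrib)
  thus ?thesis by blast
qed

text \<open>By counting: each fibre of the norm has at most q + 1 elements, so the q^2 - 1 nonzero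
  elements have at least q - 1 norms, while at most q - 1 nonzero elements are fixed by the
  involution.\<close>

lemma ex_norm:
  assumes "(\<nu>::'a) \<noteq> 0" "\<nu> ^ q = \<nu>"
  shows "\<exists>x. x ^ q * x = \<nu>"
proof -
  let ?f = "\<lambda>x::'a. x ^ Suc q"
  let ?S = "{y::'a. y \<noteq> 0 \<and> y ^ q = y}"
  have fib: "card {x. ?f x = c} \<le> q + 1" for c
  proof -
    let ?p = "monom 1 (Suc q) - [:c:] :: 'a poly"
    have d: "degree ?p = Suc q"
      by (subst diff_conv_add_uminus, subst degree_add_eq_left) (auto simp: degree_monom_eq)
    hence "?p \<noteq> 0" by auto
    hence "card {x. poly ?p x = 0} \<le> Suc q" using card_poly_roots_bound[of ?p] d by simp
    thus ?thesis by (simp add: poly_monom)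
  qed
  have "card ?S \<le> q - 1"
  proof -
    let ?p = "monom 1 (q - 1) - [:1:] :: 'a poly"
    have d: "degree ?p = q - 1"
      using q_ge_2 by (subst diff_conv_add_uminus, subst degree_add_eq_left) (auto simp: degree_monom_eq)
    hence "?p \<noteq> 0" using q_ge_2 by force
    hence "card {x. poly ?p x = 0} \<le> q - 1" using card_poly_roots_bound[of ?p] d by simp
    moreover have "y ^ (q - 1) = 1" if "y \<noteq> 0" "y ^ q = y" for y :: 'a
    proof -
      obtain m where "q = Suc m" using q_pos gr0_implies_Suc by blast
      with that show ?thesis by simp
    qed
    hence "?S \<subseteq> {x. poly ?p x = 0}" by (auto simp: poly_monom)
    hence "card ?S \<le> card {x. poly ?p x = 0}" by (intro card_mono) auto
    ultimately show ?thesis by linarith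
  qed
  moreover have im: "?f ` (UNIV - {0}) \<subseteq> ?S"
    by (auto simp: power_mult_distrib mult.commute)
  moreover have "q - 1 \<le> card (?f ` (UNIV - {0}))"
  proof -
    have "card (UNIV - {0::'a}) \<le> (\<Sum>c\<in>?f ` (UNIV - {0}). card {x \<in> UNIV - {0}. ?f x = c})"
      using sum.image_gen[of "UNIV - {0}" "\<lambda>_. 1::nat" ?f] by simp
    also have "\<dots> \<le> (\<Sum>c\<in>?f ` (UNIV - {0}). q + 1)"
      by (intro sum_mono order_trans[OF card_mono fib]) auto
    finally have "q ^ 2 - 1 \<le> card (?f ` (UNIV - {0})) * (q + 1)"
      by (simp add: card_q)
    moreover obtain m where m: "q = Suc m" using q_pos gr0_implies_Suc by blast
    have "q ^ 2 - 1 = m * (q + 1)" by (simp add: m power2_eq_square)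
    ultimately have "m * (q + 1) \<le> card (?f ` (UNIV - {0})) * (q + 1)" by (simp only:)
    hence "m \<le> card (?f ` (UNIV - {0}))" unfolding mult_le_cancel2 by simp
    thus ?thesis by (simp only: m diff_Suc_1)
  qed
  ultimately have "card ?S \<le> card (?f ` (UNIV - {0}))" by linarith
  hence "?f ` (UNIV - {0}) = ?S" using im by (intro card_seteq) auto
  hence "\<nu> \<in> ?f ` (UNIV - {0})" using assms by blast
  thus ?thesis by (auto simp: mult.commute)
qed

lemma ex_norm_minus_1: "\<exists>\<mu>::'a. \<mu> ^ q * \<mu> = -1"
proof (rule ex_norm)
  show "(-1::'a) ^ q = -1" by (subst frob_minus) (rule arg_cong[OF power_one])
qed simp

lemma ex_frob_neq: "\<exists>c::'a. c ^ q \<noteq> c"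
proof -
  let ?p = "monom 1 q - monom 1 1 :: 'a poly"
  have d: "degree ?p = q"
    using q_ge_2 by (subst diff_conv_add_uminus, subst degree_add_eq_left) (auto simp: degree_monom_eq)
  hence "?p \<noteq> 0" using q_ge_2 by force
  hence "card {x. poly ?p x = 0} \<le> q" using card_poly_roots_bound[of ?p] d by simp
  also have "q < CARD('a)" using q_ge_2 by (simp add: card_q power2_eq_square)
  finally have "{x. poly ?p x = 0} \<noteq> UNIV" by force
  then obtain x where "poly ?p x \<noteq> 0" by blast
  thus ?thesis by (intro exI[of _ x]) (simp add: poly_monom)
qed

end

subsection \<open>Matrices\<close>

lemma carrier_mat_iff: "A \<in> carrier_mat n m \<longleftrightarrow> dim_row A = n \<and> dim_col A = m"
  by (metis carrier_matI carrier_matD)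

lemma massoc: "dim_col A = dim_row B \<Longrightarrow> dim_col B = dim_row C \<Longrightarrow>
    (A * B) * C = (A :: 'a::semiring_0 mat) * (B * C)"
  by (rule assoc_mult_mat[of _ "dim_row A" "dim_col A" _ "dim_col B" _ "dim_col C"]) auto

lemma massoc_vec: "dim_col A = dim_row B \<Longrightarrow> dim_col B = dim_vec v \<Longrightarrow>
    (A * B) *\<^sub>v v = (A :: 'a::semiring_0 mat) *\<^sub>v (B *\<^sub>v v)"
  by (rule assoc_mult_mat_vec[of _ "dim_row A" "dim_col A" _ "dim_col B"]) auto

lemma madd_distr: "dim_row A = dim_row B \<Longrightarrow> dim_col A = dim_col B \<Longrightarrow> dim_col B = dim_row C \<Longrightarrow>
    (A + B) * C = A * C + (B :: 'a::semiring_0 mat) * C"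
  by (rule add_mult_distrib_mat[of _ "dim_row A" "dim_col A"]) auto

lemma madd_distl: "dim_row A = dim_row B \<Longrightarrow> dim_col A = dim_col B \<Longrightarrow> dim_col C = dim_row B \<Longrightarrow>
    C * (A + B) = C * A + (C :: 'a::semiring_0 mat) * B"
  by (rule mult_add_distrib_mat[of _ "dim_row C" "dim_col C" _ "dim_col A"]) auto

lemma mminus_distr: "dim_row A = dim_row B \<Longrightarrow> dim_col A = dim_col B \<Longrightarrow> dim_col B = dim_row C \<Longrightarrow>
    (A - B) * C = A * C - (B :: 'a::ring mat) * C"
  by (rule minus_mult_distrib_mat[of _ "dim_row A" "dim_col A"]) auto

lemma mminus_distl: "dim_row A = dim_row B \<Longrightarrow> dim_col A = dim_col B \<Longrightarrow> dim_col C = dim_row B \<Longrightarrow>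
    C * (A - B) = C * A - (C :: 'a::ring mat) * B"
  by (rule mult_minus_distrib_mat[of _ "dim_row C" "dim_col C" _ "dim_col A"]) auto

lemma msmult_l: "dim_col A = dim_row B \<Longrightarrow> (k \<cdot>\<^sub>m A) * B = (k :: 'a :: comm_semiring_0) \<cdot>\<^sub>m (A * B)"
  by (rule mult_smult_assoc_mat[of _ "dim_row A" "dim_col A"]) auto

lemma msmult_r: "dim_col A = dim_row B \<Longrightarrow> A * (k \<cdot>\<^sub>m B) = (k :: 'a :: comm_semiring_0) \<cdot>\<^sub>m (A * B)"
  by (rule mult_smult_distrib[of _ "dim_row A" "dim_col A" _ "dim_col B"]) auto

lemma mone_l: "dim_row A = n \<Longrightarrow> 1\<^sub>m n * A = (A :: 'a::semiring_1 mat)"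
  by (rule left_mult_one_mat) auto

lemma mone_r: "dim_col A = n \<Longrightarrow> A * 1\<^sub>m n = (A :: 'a::semiring_1 mat)"
  by (rule right_mult_one_mat) auto

lemma mzero_l: "dim_row A = k \<Longrightarrow> 0\<^sub>m n k * A = (0\<^sub>m n (dim_col A) :: 'a::semiring_0 mat)"
  by (rule left_mult_zero_mat) auto

lemma mzero_r: "dim_col A = k \<Longrightarrow> A * 0\<^sub>m k n = (0\<^sub>m (dim_row A) n :: 'a::semiring_0 mat)"
  by (rule right_mult_zero_mat) auto

lemma madd_zero_l: "dim_row A = n \<Longrightarrow> dim_col A = m \<Longrightarrow> 0\<^sub>m n m + A = (A :: 'a::monoid_add mat)"
  by (rule left_add_zero_mat) (rule carrier_matI)

lemma madd_zero_r: "dim_row A = n \<Longrightarrow> dim_col A = m \<Longrightarrow> A + 0\<^sub>m n m = (A :: 'a::monoid_add mat)"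
  by (rule right_add_zero_mat) (rule carrier_matI)

lemma mat_zero_vecI:
  assumes "\<And>v. v \<in> carrier_vec (dim_col M) \<Longrightarrow> M *\<^sub>v v = 0\<^sub>v (dim_row M)"
  shows "M = (0\<^sub>m (dim_row M) (dim_col M) :: 'a::semiring_1 mat)"
proof (rule eq_matI)
  fix i j assume "i < dim_row (0\<^sub>m (dim_row M) (dim_col M) :: 'a mat)" "j < dim_col (0\<^sub>m (dim_row M) (dim_col M) :: 'a mat)"
  hence ij: "i < dim_row M" "j < dim_col M" by simp_all
  have "(M *\<^sub>v unit_vec (dim_col M) j) $ i = 0" using assms[of "unit_vec (dim_col M) j"] ij by simp
  thus "M $$ (i, j) = 0\<^sub>m (dim_row M) (dim_col M) $$ (i, j)"
    using ij by (simp add: scalar_prod_right_unit[of j "dim_col M"])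
qed simp_all

lemma card_carrier_vec: "card (carrier_vec n :: 'a::finite vec set) = CARD('a) ^ n"
  and finite_carrier_vec: "finite (carrier_vec n :: 'a::finite vec set)"
proof -
  have bij: "bij_betw (\<lambda>f. vec n f) (PiE {..<n} (\<lambda>_. UNIV)) (carrier_vec n :: 'a vec set)"
  proof (rule bij_betwI[where g = "\<lambda>v. \<lambda>i\<in>{..<n}. v $ i"])
    fix f :: "nat \<Rightarrow> 'a" assume "f \<in> PiE {..<n} (\<lambda>_. UNIV)"
    thus "(\<lambda>i\<in>{..<n}. vec n f $ i) = f" by (auto simp: PiE_def extensional_def fun_eq_iff)
  qed auto
  show "card (carrier_vec n :: 'a vec set) = CARD('a) ^ n"
    using bij_betw_same_card[OF bij] by (simp add: card_PiE)
  show "finite (carrier_vec n :: 'a vec set)"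
    using bij_betw_finite[OF bij] by (simp add: finite_PiE)
qed

lemma finite_carrier_mat: "finite (carrier_mat n k :: 'a::finite mat set)"
proof -
  have "finite ((\<lambda>f. mat n k f) ` (PiE ({..<n} \<times> {..<k}) (\<lambda>_. UNIV :: 'a set)))"
    by (intro finite_imageI finite_PiE) auto
  moreover have "carrier_mat n k \<subseteq> (\<lambda>f. mat n k f) ` (PiE ({..<n} \<times> {..<k}) (\<lambda>_. UNIV :: 'a set))"
  proof
    fix A :: "'a mat" assume "A \<in> carrier_mat n k"
    hence "A = mat n k (restrict (($$) A) ({..<n} \<times> {..<k}))" by (intro eq_matI) auto
    thus "A \<in> (\<lambda>f. mat n k f) ` (PiE ({..<n} \<times> {..<k}) (\<lambda>_. UNIV :: 'a set))" by auto
  qed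
  ultimately show ?thesis by (rule finite_subset[rotated])
qed

text \<open>Polynomials serve as one vector space in which coordinate vectors of any length are
  coefficient sequences. There \<open>B\<close> becomes a linear map \<open>f\<close>, and a linear
  right inverse \<open>g\<close> of \<open>f\<close> on its range gives the matrix
  \<open>G\<close>.\<close>

lemma ex_generalized_inverse:
  fixes B :: "'a::field mat"
  assumes B: "B \<in> carrier_mat m n"
  shows "\<exists>G\<in>carrier_mat n m. B * G * B = B"
proof -
  interpret V: vector_space "smult :: 'a \<Rightarrow> 'a poly \<Rightarrow> 'a poly"
    by unfold_locales (auto simp: smult_add_left smult_add_right)
  interpret P: vector_space_pair "smult :: 'a \<Rightarrow> 'a poly \<Rightarrow> 'a poly" "smult :: 'a \<Rightarrow> 'a poly \<Rightarrow> 'a poly" ..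
  define f where "f = (\<lambda>x::'a poly. \<Sum>i<m. monom (\<Sum>j<n. B $$ (i, j) * poly.coeff x j) i)"
  have cf: "poly.coeff (f x) i = (if i < m then (\<Sum>j<n. B $$ (i, j) * poly.coeff x j) else 0)" for x i
    by (simp add: f_def coeff_sum)
  have lf: "Vector_Spaces.linear smult smult f"
    by (intro Vector_Spaces.linear_iff[THEN iffD2] conjI allI V.vector_space_axioms)
       (auto simp: poly_eq_iff cf sum.distrib algebra_simps sum_distrib_left)
  obtain g where lg: "Vector_Spaces.linear smult smult g" and g: "\<And>v. f (g (f v)) = f v"
    using P.linear_exists_right_inverse_on[OF lf V.subspace_UNIV] by blast
  define G where "G = mat n m (\<lambda>(i, j). poly.coeff (g (monom 1 j)) i)"
  \<comment> \<open>By linearity \<open>g\<close> is determined on polynomials of degree below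
    \<open>m\<close> by its values on monomials; all values of \<open>f\<close> are of this
    kind.\<close>
  have gsum: "poly.coeff (g y) i = (\<Sum>k<m. poly.coeff y k * poly.coeff (g (monom 1 k)) i)"
    if "\<And>k. k \<ge> m \<Longrightarrow> poly.coeff y k = 0" for y i
  proof -
    have "y = (\<Sum>k<m. smult (poly.coeff y k) (monom 1 k))"
    proof (rule poly_eqI)
      fix i
      have "poly.coeff (\<Sum>k<m. smult (poly.coeff y k) (monom 1 k)) i = (\<Sum>k<m. if k = i then poly.coeff y k else 0)"
        unfolding coeff_sum by (intro sum.cong) auto
      thus "poly.coeff y i = poly.coeff (\<Sum>k<m. smult (poly.coeff y k) (monom 1 k)) i"
        using that[of i] by (simp add: not_less)
    qed
    hence "g y = g (\<Sum>k<m. smult (poly.coeff y k) (monom 1 k))" by simp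
    also have "\<dots> = (\<Sum>k<m. smult (poly.coeff y k) (g (monom 1 k)))"
      by (simp only: P.linear_sum[OF lg] P.linear_scale[OF lg])
    finally show ?thesis by (simp add: coeff_sum)
  qed
  have "B * G * B = B"
  proof (rule eq_matI)
    fix i j assume "i < dim_row B" "j < dim_col B"
    hence ij: "i < m" "j < n" using B by auto
    have fe: "poly.coeff (f (monom 1 j)) i = (if i < m then B $$ (i, j) else 0)" for i
    proof -
      have "(\<Sum>l<n. B $$ (i, l) * poly.coeff (monom 1 j) l) = (\<Sum>l<n. if l = j then B $$ (i, l) else 0)"
        by (intro sum.cong) auto
      thus ?thesis using ij by (simp add: cf)
    qed
    have "(B * G * B) $$ (i, j) = (\<Sum>l<n. B $$ (i, l) * (\<Sum>k<m. poly.coeff (g (monom 1 k)) l * B $$ (k, j)))"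
    proof -
      have G: "G \<in> carrier_mat n m" by (simp add: G_def)
      have GB: "(G * B) $$ (l, j) = (\<Sum>k<m. poly.coeff (g (monom 1 k)) l * B $$ (k, j))" if "l < n" for l
        using G B ij that by (simp add: scalar_prod_def G_def atLeast0LessThan)
      have "(B * G * B) $$ (i, j) = (B * (G * B)) $$ (i, j)"
        by (simp only: assoc_mult_mat[OF B G B])
      also have "\<dots> = (\<Sum>l<n. B $$ (i, l) * (G * B) $$ (l, j))"
        using G B ij by (simp add: scalar_prod_def[of "row B i"] atLeast0LessThan)
      finally show ?thesis by (simp add: GB)
    qed
    also have "\<dots> = (\<Sum>l<n. B $$ (i, l) * poly.coeff (g (f (monom 1 j))) l)"
      by (subst gsum) (simp_all add: fe mult.commute)
    also have "\<dots> = poly.coeff (f (g (f (monom 1 j)))) i" using ij by (simp only: cf if_True)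
    also have "\<dots> = B $$ (i, j)" unfolding g using ij by (simp add: fe)
    finally show "(B * G * B) $$ (i, j) = B $$ (i, j)" .
  qed (use B in \<open>auto simp: G_def\<close>)
  thus ?thesis by (intro bexI[of _ G]) (auto simp: G_def)
qed

section \<open>Injective matrices and concatenation of columns\<close>

definition inj_mat :: "nat \<Rightarrow> nat \<Rightarrow> 'a::field mat set" where
  "inj_mat n k = {T \<in> carrier_mat n k. \<forall>v\<in>carrier_vec k. T *\<^sub>v v = 0\<^sub>v n \<longrightarrow> v = 0\<^sub>v k}"

lemma inj_mat_carrier: "T \<in> inj_mat n k \<Longrightarrow> T \<in> carrier_mat n k"
  by (simp add: inj_mat_def)

lemma inj_mat_dim: "T \<in> inj_mat n k \<Longrightarrow> dim_row T = n" "T \<in> inj_mat n k \<Longrightarrow> dim_col T = k"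
  using carrier_matD[OF inj_mat_carrier[of T n k]] by simp_all

text \<open>A generalized inverse \<open>G\<close> satisfies
  \<open>T * (G * T - 1\<^sub>m k) = 0\<^sub>m n k\<close>, and injectivity cancels
  \<open>T\<close>.\<close>

lemma inj_mat_left_inverse:
  assumes "T \<in> inj_mat n k"
  shows "\<exists>S\<in>carrier_mat k n. S * T = 1\<^sub>m k"
proof -
  have T[simp]: "T \<in> carrier_mat n k" using assms by (simp add: inj_mat_def)
  note [simp] = carrier_matD[OF T]
  obtain G where G: "G \<in> carrier_mat k n" "T * G * T = T"
    using ex_generalized_inverse[OF T] by (rule bexE)
  note [simp] = carrier_matD[OF G(1)]
  have "G * T = 1\<^sub>m k"
  proof -
    have 0: "(G * T - 1\<^sub>m k) *\<^sub>v v = 0\<^sub>v k" if v: "v \<in> carrier_vec k" for v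
    proof -
      have GT: "G * T - 1\<^sub>m k \<in> carrier_mat k k" by (rule carrier_matI) simp_all
      have "T * (G * T - 1\<^sub>m k) = T * (G * T) - T * 1\<^sub>m k"
        by (rule mminus_distl) simp_all
      also have "\<dots> = T - T"
        using G(2) by (simp only: assoc_mult_mat[OF T G(1) T] right_mult_one_mat[OF T])
      also have "\<dots> = 0\<^sub>m n k" by (rule minus_r_inv_mat[OF T])
      finally have "(T * (G * T - 1\<^sub>m k)) *\<^sub>v v = 0\<^sub>m n k *\<^sub>v v" by (simp only:)
      also have "\<dots> = 0\<^sub>v n" using v by (intro eq_vecI) simp_all
      finally have "T *\<^sub>v ((G * T - 1\<^sub>m k) *\<^sub>v v) = 0\<^sub>v n"
        by (simp only: assoc_mult_mat_vec[OF T GT v])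
      moreover have "(G * T - 1\<^sub>m k) *\<^sub>v v \<in> carrier_vec k"
        using GT v by (rule mult_mat_vec_carrier)
      ultimately show ?thesis using assms unfolding inj_mat_def mem_Collect_eq by simp
    qed
    show ?thesis
    proof (rule eq_matI)
      fix i j assume ij: "i < dim_row (1\<^sub>m k :: 'a mat)" "j < dim_col (1\<^sub>m k :: 'a mat)"
      have "((G * T - 1\<^sub>m k) *\<^sub>v unit_vec k j) $ i = 0"
        using 0[of "unit_vec k j"] ij by simp
      moreover have "((G * T - 1\<^sub>m k) *\<^sub>v unit_vec k j) $ i = (G * T - 1\<^sub>m k) $$ (i, j)"
        using ij by (simp add: scalar_prod_right_unit[of j k])
      ultimately show "(G * T) $$ (i, j) = 1\<^sub>m k $$ (i, j)" using ij by simp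
    qed auto
  qed
  thus ?thesis using G(1) by (rule bexI[of _ G])
qed

lemma inj_matI:
  assumes T: "T \<in> carrier_mat n k" and S: "S \<in> carrier_mat k n" and "S * T = 1\<^sub>m k"
  shows "T \<in> inj_mat n k"
proof -
  note [simp] = carrier_matD[OF T] carrier_matD[OF S]
  have "v = 0\<^sub>v k" if "v \<in> carrier_vec k" "T *\<^sub>v v = 0\<^sub>v n" for v
  proof -
    have "v = (S * T) *\<^sub>v v" using assms that by simp
    also have "\<dots> = S *\<^sub>v 0\<^sub>v n" using that by (subst massoc_vec) auto
    also have "\<dots> = 0\<^sub>v k" using S by auto
    finally show ?thesis .
  qed
  thus ?thesis using T by (auto simp: inj_mat_def)
qed

definition hcat :: "'a::zero mat \<Rightarrow> 'a mat \<Rightarrow> 'a mat" where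
  "hcat A B = mat (dim_row A) (dim_col A + dim_col B)
     (\<lambda>(i, j). if j < dim_col A then A $$ (i, j) else B $$ (i, j - dim_col A))"

lemma dim_hcat [simp]: "dim_row (hcat A B) = dim_row A" "dim_col (hcat A B) = dim_col A + dim_col B"
  by (simp_all add: hcat_def)

lemma hcat_carrier [intro]: "A \<in> carrier_mat n a \<Longrightarrow> B \<in> carrier_mat n b \<Longrightarrow> hcat A B \<in> carrier_mat n (a + b)"
  by (rule carrier_matI) simp_all

lemma hcat_index: "i < dim_row A \<Longrightarrow> j < dim_col A + dim_col B \<Longrightarrow>
    hcat A B $$ (i, j) = (if j < dim_col A then A $$ (i, j) else B $$ (i, j - dim_col A))"
  by (simp add: hcat_def)

lemma hcat_eq_iff:
  assumes "A \<in> carrier_mat n a" "A' \<in> carrier_mat n a" "B \<in> carrier_mat n b" "B' \<in> carrier_mat n b"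
  shows "hcat A B = hcat A' B' \<longleftrightarrow> A = A' \<and> B = B'"
proof
  assume eq: "hcat A B = hcat A' B'"
  have "A $$ (i, j) = A' $$ (i, j)" if "i < n" "j < a" for i j
    using arg_cong[OF eq, of "\<lambda>M. M $$ (i, j)"] that assms by (auto simp: hcat_index)
  moreover have "B $$ (i, j) = B' $$ (i, j)" if "i < n" "j < b" for i j
    using arg_cong[OF eq, of "\<lambda>M. M $$ (i, a + j)"] that assms by (auto simp: hcat_index)
  ultimately have "A = A'" "B = B'" using assms by (intro eq_matI; simp)+
  thus "A = A' \<and> B = B'" ..
qed simp

lemma hcat_surj:
  assumes "T \<in> carrier_mat n (a + b)"
  shows "\<exists>A\<in>carrier_mat n a. \<exists>B\<in>carrier_mat n b. T = hcat A B"
proof -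
  have "T = hcat (mat n a (($$) T)) (mat n b (\<lambda>(i, j). T $$ (i, a + j)))"
    using assms by (intro eq_matI) (auto simp: hcat_index)
  thus ?thesis by (meson mat_carrier)
qed

lemma mult_hcat:
  assumes "dim_col C = dim_row A" "dim_row A = dim_row B"
  shows "C * hcat A B = hcat (C * A) (C * (B :: 'a::semiring_0 mat))"
proof (rule eq_matI)
  fix i j assume ij: "i < dim_row (hcat (C * A) (C * B))" "j < dim_col (hcat (C * A) (C * B))"
  hence "col (hcat A B) j = (if j < dim_col A then col A j else col B (j - dim_col A))"
    using assms by (intro eq_vecI) (auto simp: hcat_index)
  thus "(C * hcat A B) $$ (i, j) = hcat (C * A) (C * B) $$ (i, j)"
    using ij assms by (auto simp: hcat_index)
qed auto

lemma hcat_mult_vec: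
  assumes "A \<in> carrier_mat n a" "B \<in> carrier_mat n b" "v \<in> carrier_vec a" "w \<in> carrier_vec b"
  shows "hcat A B *\<^sub>v (v @\<^sub>v w) = A *\<^sub>v v + (B :: 'a::semiring_0 mat) *\<^sub>v w"
proof (rule eq_vecI)
  fix i assume i: "i < dim_vec (A *\<^sub>v v + B *\<^sub>v w)"
  have i': "i < n" using i assms by simp
  have "row (hcat A B) i = row A i @\<^sub>v row B i"
  proof (rule eq_vecI)
    fix j assume "j < dim_vec (row A i @\<^sub>v row B i)"
    thus "row (hcat A B) i $ j = (row A i @\<^sub>v row B i) $ j"
      using i' assms by (simp add: hcat_index)
  qed (use assms in simp)
  moreover have "(row A i @\<^sub>v row B i) \<bullet> (v @\<^sub>v w) = row A i \<bullet> v + row B i \<bullet> w"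
    by (rule scalar_prod_append[of _ a _ b]) (use assms i' in simp_all)
  ultimately show "(hcat A B *\<^sub>v (v @\<^sub>v w)) $ i = (A *\<^sub>v v + B *\<^sub>v w) $ i"
    using i' assms by simp
qed (use assms in simp)

lemma hcat_mult_four_block_diag:
  assumes "A \<in> carrier_mat n a" "B \<in> carrier_mat n b" "C \<in> carrier_mat a a" "D \<in> carrier_mat b b"
  shows "hcat A B * four_block_mat C (0\<^sub>m a b) (0\<^sub>m b a) D = hcat (A * C) (B * (D :: 'a::semiring_0 mat))"
proof -
  \<comment> \<open>With lower blocks of zero rows, \<open>hcat\<close> becomes a block matrix and
    the block product rule applies.\<close>
  have h: "hcat M N = four_block_mat M N (0\<^sub>m 0 a) (0\<^sub>m 0 b)"
    if "M \<in> carrier_mat n a" "N \<in> carrier_mat n b" for M N :: "'a mat"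
    using that by (intro eq_matI) (auto simp: hcat_index)
  have "A * C \<in> carrier_mat n a" "B * D \<in> carrier_mat n b" using assms by auto
  note h[OF this]
  moreover note h[OF assms(1,2)]
  moreover have "four_block_mat A B (0\<^sub>m 0 a) (0\<^sub>m 0 b) * four_block_mat C (0\<^sub>m a b) (0\<^sub>m b a) D
     = four_block_mat (A * C) (B * D) (0\<^sub>m 0 a) (0\<^sub>m 0 b)"
    using assms by (subst mult_four_block_mat[of _ n a _ b _ 0 _ _ a _ b]) auto
  ultimately show ?thesis by simp
qed

subsection \<open>Hermitian geometry\<close>

context herm
begin

section \<open>Adjoints and unitary matrices\<close>

definition dag :: "'a mat \<Rightarrow> 'a mat" where
  "dag A = transpose_mat (map_mat (\<lambda>x. x ^ q) A)"

lemma dag_dim [simp]: "dim_row (dag A) = dim_col A" "dim_col (dag A) = dim_row A"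
  by (simp_all add: dag_def)

lemma dag_carrier: "A \<in> carrier_mat n m \<Longrightarrow> dag A \<in> carrier_mat m n"
  by (simp only: carrier_mat_iff dag_dim)

lemma dag_index [simp]: "i < dim_col A \<Longrightarrow> j < dim_row A \<Longrightarrow> dag A $$ (i, j) = (A $$ (j, i)) ^ q"
  by (simp add: dag_def)

lemma dag_dag [simp]: "dag (dag A) = A"
  by (rule eq_matI) simp_all

lemma dag_add: "dim_row A = dim_row B \<Longrightarrow> dim_col A = dim_col B \<Longrightarrow> dag (A + B) = dag A + dag B"
  by (rule eq_matI) (simp_all add: frob_add)

lemma dag_minus: "dim_row A = dim_row B \<Longrightarrow> dim_col A = dim_col B \<Longrightarrow> dag (A - B) = dag A - dag B"
  by (rule eq_matI) (simp_all add: frob_diff)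

lemma dag_smult: "dag (c \<cdot>\<^sub>m A) = c ^ q \<cdot>\<^sub>m dag A"
  by (rule eq_matI) (simp_all add: power_mult_distrib)

lemma dag_one [simp]: "dag (1\<^sub>m n) = 1\<^sub>m n"
  by (rule eq_matI) simp_all

lemma dag_zero [simp]: "dag (0\<^sub>m n m) = 0\<^sub>m m n"
  by (rule eq_matI) simp_all

lemma dag_mult: "dim_col A = dim_row B \<Longrightarrow> dag (A * B) = dag B * dag A"
  by (rule eq_matI) (simp_all add: scalar_prod_def frob_sum power_mult_distrib mult.commute)

lemma dag_inject [simp]: "dag A = dag B \<longleftrightarrow> A = B"
  by (metis dag_dag)

lemma det_dag: "A \<in> carrier_mat n n \<Longrightarrow> det (dag A) = det A ^ q"
proof -
  assume A: "A \<in> carrier_mat n n"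
  interpret comm_ring_hom "\<lambda>x::'a. x ^ q"
    by unfold_locales (simp_all add: frob_add power_mult_distrib)
  have "det (dag A) = det (map_mat (\<lambda>x. x ^ q) A)"
    using A by (simp add: dag_def det_transpose[of _ n])
  also have "\<dots> = det A ^ q" by (rule hom_det)
  finally show ?thesis .
qed

lemmas dag_simps = dag_add dag_minus dag_smult dag_mult

definition unitary :: "nat \<Rightarrow> 'a mat set" where
  "unitary n = {A \<in> carrier_mat n n. A * dag A = 1\<^sub>m n}"

lemma unitary_carrier: "A \<in> unitary n \<Longrightarrow> A \<in> carrier_mat n n"
  by (simp add: unitary_def)

lemma unitary_dim: "A \<in> unitary n \<Longrightarrow> dim_row A = n" "A \<in> unitary n \<Longrightarrow> dim_col A = n"
  unfolding unitary_def by (simp_all only: mem_Collect_eq carrier_mat_iff)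

lemma unitary_mult_dag: "A \<in> unitary n \<Longrightarrow> A * dag A = 1\<^sub>m n"
  by (simp add: unitary_def)

lemma unitary_dag_mult: "A \<in> unitary n \<Longrightarrow> dag A * A = 1\<^sub>m n"
  by (rule mat_mult_left_right_inverse[of A n "dag A"]) (simp_all add: unitary_def dag_carrier)

lemma unitary_dag: "A \<in> unitary n \<Longrightarrow> dag A \<in> unitary n"
  using unitary_dag_mult[of A n] by (simp add: unitary_def dag_carrier)

lemma unitary_mult:
  assumes "A \<in> unitary n" "B \<in> unitary n" shows "A * B \<in> unitary n"
proof -
  note [simp] = assms[THEN unitary_dim(1)] assms[THEN unitary_dim(2)]
  have AB: "A * B \<in> carrier_mat n n" by (rule carrier_matI) simp_all
  have "A * B * dag (A * B) = A * ((B * dag B) * dag A)"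
    by (simp add: dag_mult massoc)
  also have "\<dots> = 1\<^sub>m n" using assms by (simp add: unitary_mult_dag mone_l)
  finally show ?thesis by (simp add: unitary_def AB)
qed

lemma one_unitary [simp]: "1\<^sub>m n \<in> unitary n"
  by (simp add: unitary_def)

lemma unitary_cancel:
  assumes "A \<in> unitary n" "dim_row M = n"
  shows "dag A * (A * M) = M" "A * (dag A * M) = M"
  using assms unitary_dim[OF assms(1)] unitary_dag_mult[OF assms(1)] unitary_mult_dag[OF assms(1)]
  by (simp_all add: massoc[symmetric] mone_l)

lemma unitary_gram:
  assumes "A \<in> unitary n" "dim_row T = n" "dim_row U = n"
  shows "dag (A * T) * (A * U) = dag T * U"
  using assms unitary_dim[OF assms(1)] unitary_cancel[OF assms(1,3)]
  by (simp add: dag_mult massoc)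

lemma det_unitary:
  assumes "A \<in> unitary n" shows "det A * det A ^ q = 1"
proof -
  note A = unitary_carrier[OF assms]
  have "det A * det (dag A) = det (1\<^sub>m n :: 'a mat)"
    using det_mult[OF A dag_carrier[OF A]] unitary_mult_dag[OF assms] by simp
  thus ?thesis by (simp add: det_dag[OF A])
qed

lemma unitary_inj_mat:
  assumes "A \<in> unitary n" "T \<in> inj_mat n k"
  shows "A * T \<in> inj_mat n k"
proof -
  have T: "T \<in> carrier_mat n k" using assms by (simp add: inj_mat_carrier)
  obtain S where S: "S \<in> carrier_mat k n" "S * T = 1\<^sub>m k"
    using inj_mat_left_inverse[OF assms(2)] by (rule bexE)
  note [simp] = carrier_matD[OF T] carrier_matD[OF S(1)] unitary_dim[OF assms(1)]
  have "(S * dag A) * (A * T) = 1\<^sub>m k"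
    using S(2) unitary_cancel[OF assms(1), of T] by (simp add: massoc)
  thus ?thesis
    by (intro inj_matI[of _ _ _ "S * dag A"]) (simp_all add: carrier_mat_iff)
qed

text \<open>The map is \<open>1 - D * dag D\<close> for \<open>D = T - Y\<close>; the hypothesis on \<open>dag Y * T\<close> says that
  \<open>dag D * T = 1\<close>.\<close>

lemma reflection:
  assumes T: "T \<in> carrier_mat n k" and Y: "Y \<in> carrier_mat n k"
    and TT: "dag T * T = G" and YY: "dag Y * Y = G" and YT: "dag Y * T = G - 1\<^sub>m k"
  shows "\<exists>A\<in>unitary n. A * T = Y"
proof -
  note [simp] = carrier_matD[OF T] carrier_matD[OF Y]
  have Gd[simp]: "dim_row G = k" "dim_col G = k" using TT by auto
  have "dag G = G" unfolding TT[symmetric] by (simp add: dag_mult)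
  hence TY: "dag T * Y = G - 1\<^sub>m k"
    using arg_cong[OF YT, of dag] by (simp add: dag_simps)
  define D where "D = T - Y"
  have D[simp]: "dim_row D = n" "dim_col D = k" by (simp_all add: D_def)
  have DT: "dag D * T = 1\<^sub>m k"
    unfolding D_def by (simp add: dag_minus mminus_distr TT YT) (rule eq_matI, simp_all)
  have "dag D * Y = - 1\<^sub>m k"
    unfolding D_def by (simp add: dag_minus mminus_distr YY TY) (rule eq_matI, simp_all)
  \<comment> \<open>\<open>A\<close> will be an involution because \<open>dag D * D\<close> is twice
    the identity: the square of \<open>D * dag D\<close> cancels the two cross terms in
    \<open>A * A\<close>. No division by 2 is involved.\<close>
  hence DD: "dag D * D = 1\<^sub>m k + 1\<^sub>m k"
    by (subst (2) D_def) (simp add: mminus_distl DT, rule eq_matI, simp_all)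
  define A where "A = 1\<^sub>m n - D * dag D"
  have A[simp]: "dim_row A = n" "dim_col A = n" by (simp_all add: A_def)
  have "A * T = T - D"
    unfolding A_def by (simp add: mminus_distr mone_l massoc DT mone_r)
  also have "\<dots> = Y" unfolding D_def by (rule eq_matI) simp_all
  finally have AT: "A * T = Y" .
  have dA: "dag A = A" unfolding A_def by (simp add: dag_simps)
  have "(D * dag D) * (D * dag D) = D * ((dag D * D) * dag D)"
    by (simp add: massoc)
  also have "\<dots> = D * dag D + D * dag D"
    unfolding DD by (simp add: madd_distr madd_distl mone_l)
  finally have sq: "(D * dag D) * (D * dag D) = D * dag D + D * dag D" .
  have "A * A = 1\<^sub>m n - D * dag D - (D * dag D - (D * dag D) * (D * dag D))"
    unfolding A_def by (simp add: mminus_distr mminus_distl mone_l mone_r)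
  also have "\<dots> = 1\<^sub>m n"
    unfolding sq by (rule eq_matI) (simp_all del: index_mult_mat(1))
  finally have "A * A = 1\<^sub>m n" .
  moreover have "A \<in> carrier_mat n n" by (rule carrier_matI) simp_all
  ultimately have "A \<in> unitary n" by (simp add: unitary_def dA)
  with AT show ?thesis by (rule bexI)
qed

text \<open>If all diagonal entries vanish but some \<open>H $$ (i, j)\<close> does not, the value
  of the form at \<open>e j + c \<cdot>\<^sub>m e i\<close> is the trace of
  \<open>c ^ q * H $$ (i, j)\<close>, and a suitable \<open>c\<close> makes it 1.\<close>

lemma ex_nonisotropic:
  assumes H: "H \<in> carrier_mat n n" and herm: "dag H = H" and nz: "H \<noteq> 0\<^sub>m n n"
  shows "\<exists>v\<in>carrier_mat n 1. (dag v * (H * v)) $$ (0, 0) \<noteq> 0"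
proof (rule ccontr)
  assume "\<not> ?thesis"
  hence 0: "(dag v * (H * v)) $$ (0, 0) = 0" if "v \<in> carrier_mat n 1" for v using that by simp
  note [simp] = carrier_matD[OF H]
  define e where "e = (\<lambda>i. mat n 1 (\<lambda>(l, _). if l = i then 1 else 0 :: 'a))"
  have ed[simp]: "dim_row (e i) = n" "dim_col (e i) = 1" for i by (simp_all add: e_def)
  have e: "(dag (e i) * (H * e j)) $$ (0, 0) = H $$ (i, j)" if "i < n" "j < n" for i j
  proof -
    have "(H * e j) $$ (l, 0) = H $$ (l, j)" if "l < n" for l
    proof -
      have "(H * e j) $$ (l, 0) = (\<Sum>r<n. H $$ (l, r) * e j $$ (r, 0))"
        using that by (simp add: scalar_prod_def atLeast0LessThan)
      also have "\<dots> = (\<Sum>r<n. if r = j then H $$ (l, r) else 0)"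
        by (intro sum.cong) (simp_all add: e_def)
      finally show ?thesis using \<open>j < n\<close> by simp
    qed
    hence "(dag (e i) * (H * e j)) $$ (0, 0) = (\<Sum>l<n. e i $$ (l, 0) ^ q * H $$ (l, j))"
      by (simp add: scalar_prod_def[of "row (dag (e i)) 0"] atLeast0LessThan)
    also have "\<dots> = (\<Sum>l<n. if l = i then H $$ (l, j) else 0)"
      by (intro sum.cong) (simp_all add: e_def)
    finally show ?thesis using \<open>i < n\<close> by simp
  qed
  have diag: "H $$ (i, i) = 0" if "i < n" for i
    using e[OF that that] 0[of "e i"] by (simp add: carrier_mat_iff)
  have "H $$ (i, j) = 0" if ij: "i < n" "j < n" for i j
  proof (rule ccontr)
    assume nz: "H $$ (i, j) \<noteq> 0"
    obtain \<theta> :: 'a where \<theta>: "\<theta> + \<theta> ^ q = 1" using ex_trace_1 by blast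
    define c where "c = (\<theta> / H $$ (i, j)) ^ q"
    have cq: "c ^ q * H $$ (i, j) = \<theta>" using nz by (simp add: c_def)
    have "H $$ (j, i) = dag H $$ (j, i)" by (simp add: herm)
    hence ji: "H $$ (j, i) = H $$ (i, j) ^ q" using ij by simp
    let ?v = "e j + c \<cdot>\<^sub>m e i"
    have "(dag ?v * (H * ?v)) $$ (0, 0) =
        (dag (e j) * (H * e j)) $$ (0, 0) + c * (dag (e j) * (H * e i)) $$ (0, 0)
         + c ^ q * (dag (e i) * (H * e j)) $$ (0, 0) + c ^ q * (c * (dag (e i) * (H * e i)) $$ (0, 0))"
      by (simp add: dag_simps madd_distr madd_distl msmult_l msmult_r algebra_simps del: index_mult_mat(1))
    also have "\<dots> = c * H $$ (j, i) + c ^ q * H $$ (i, j)"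
      by (simp only: e[OF ij] e[OF ij(2) ij(1)] e[OF ij(1) ij(1)] e[OF ij(2) ij(2)] diag[OF ij(1)] diag[OF ij(2)]) simp
    also have "c * H $$ (j, i) = (c ^ q * H $$ (i, j)) ^ q"
      by (simp add: ji power_mult_distrib)
    also have "(c ^ q * H $$ (i, j)) ^ q + c ^ q * H $$ (i, j) = 1"
      using \<theta> by (simp add: cq add.commute)
    finally show False using 0[of ?v] by (simp add: carrier_mat_iff)
  qed
  hence "H = 0\<^sub>m n n" by (intro eq_matI) simp_all
  with nz show False by contradiction
qed

text \<open>Otherwise \<open>1 - G B\<close>, for a generalized inverse \<open>G\<close> of \<open>B = dag W\<close>, has a totally isotropic
  image, and the identity of \<open>n\<close>-space factors through dimension \<open>2 m\<close>.\<close>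

lemma ex_unit_vector_in_perp:
  assumes W: "W \<in> carrier_mat n m" and n: "n > 2 * m"
  shows "\<exists>e\<in>carrier_mat n 1. dag W * e = 0\<^sub>m m 1 \<and> dag e * e = 1\<^sub>m 1"
proof -
  define B where "B = dag W"
  have B: "B \<in> carrier_mat m n" using W by (simp add: B_def dag_carrier)
  obtain G where G: "G \<in> carrier_mat n m" "B * G * B = B"
    using ex_generalized_inverse[OF B] by (rule bexE)
  note [simp] = carrier_matD[OF W] carrier_matD[OF B] carrier_matD[OF G(1)]
  define N where "N = 1\<^sub>m n - G * B"
  have [simp]: "dim_row N = n" "dim_col N = n" by (simp_all add: N_def)
  have "B * N = B - B * G * B"
    unfolding N_def by (simp add: mminus_distl mone_r massoc)
  hence BN: "B * N = 0\<^sub>m m n" unfolding G(2) using minus_r_inv_mat[OF B] by simp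
  \<comment> \<open>\<open>N\<close> projects onto the kernel of \<open>B\<close>, and
    \<open>dag N * N\<close> is the restriction of the Hermitian form to that kernel, pulled back to
    \<open>n\<close>-space.\<close>
  have "dag N * N \<noteq> 0\<^sub>m n n"
  proof
    assume z: "dag N * N = 0\<^sub>m n n"
    have "1\<^sub>m n = dag N + dag (G * B)"
      unfolding N_def by (simp add: dag_minus) (rule eq_matI, simp_all)
    hence "1\<^sub>m n * N = dag N * N + dag (G * B) * N" by (simp add: madd_distr)
    hence "N = 0\<^sub>m n n + dag B * (dag G * N)"
      unfolding z by (simp add: mone_l dag_mult massoc)
    also have "\<dots> = dag B * (dag G * N)" by (rule eq_matI) (simp_all del: index_mult_mat(1))
    finally have "N = dag B * (dag G * N)" .
    moreover have "1\<^sub>m n = N + G * B" unfolding N_def by (rule eq_matI) simp_all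
    ultimately have one: "1\<^sub>m n = dag B * (dag G * N) + G * B" by simp
    have inj: "inj_on (\<lambda>v. (B *\<^sub>v v, (dag G * N) *\<^sub>v v)) (carrier_vec n)"
    proof (rule inj_on_inverseI[of _ "\<lambda>(x, y). dag B *\<^sub>v y + G *\<^sub>v x"])
      fix v :: "'a vec" assume v: "v \<in> carrier_vec n"
      have "v = (dag B * (dag G * N) + G * B) *\<^sub>v v"
        using v unfolding one[symmetric] by simp
      also have "\<dots> = (dag B * (dag G * N)) *\<^sub>v v + (G * B) *\<^sub>v v"
        using v by (intro add_mult_distrib_mat_vec[of _ n n]) (simp_all only: carrier_mat_iff, simp_all)
      also have "\<dots> = dag B *\<^sub>v ((dag G * N) *\<^sub>v v) + G *\<^sub>v (B *\<^sub>v v)"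
        using v by (simp only: massoc_vec dag_dim carrier_vecD carrier_matD[OF B] carrier_matD[OF G(1)] \<open>dim_col N = n\<close> index_mult_mat(2,3))
      finally show "(case (B *\<^sub>v v, (dag G * N) *\<^sub>v v) of (x, y) \<Rightarrow> dag B *\<^sub>v y + G *\<^sub>v x) = v"
        by simp
    qed
    have "card (carrier_vec n :: 'a vec set) \<le> card (carrier_vec m \<times> carrier_vec m :: ('a vec \<times> 'a vec) set)"
      by (rule card_inj_on_le[OF inj]) (auto simp: finite_carrier_vec intro: carrier_vecI)
    hence "CARD('a) ^ n \<le> CARD('a) ^ (2 * m)"
      by (simp add: card_carrier_vec card_cartesian_product power_add mult_2)
    hence "n \<le> 2 * m"
      using q_ge_2 one_less_power[of q 2] by (subst (asm) power_increasing_iff) (simp_all add: card_q)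
    with n show False by simp
  qed
  moreover have "dag (dag N * N) = dag N * N" by (simp add: dag_mult)
  moreover have "dag N * N \<in> carrier_mat n n" by (simp add: carrier_mat_iff)
  ultimately obtain v where v: "v \<in> carrier_mat n 1" "(dag v * ((dag N * N) * v)) $$ (0, 0) \<noteq> 0"
    using ex_nonisotropic[of "dag N * N" n] by blast
  note [simp] = carrier_matD[OF v(1)]
  define u where "u = N * v"
  have ud[simp]: "dim_row u = n" "dim_col u = 1" by (simp_all add: u_def)
  define \<nu> where "\<nu> = (dag u * u) $$ (0, 0)"
  have uu: "dag u * u = \<nu> \<cdot>\<^sub>m 1\<^sub>m 1" unfolding \<nu>_def by (rule eq_matI) simp_all
  have "\<nu> \<noteq> 0" using v(2) by (simp add: \<nu>_def u_def dag_mult massoc del: index_mult_mat(1))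
  moreover have "\<nu> ^ q = \<nu>"
  proof -
    have "\<nu> ^ q = dag (dag u * u) $$ (0, 0)" unfolding \<nu>_def by (subst dag_index) simp_all
    also have "dag (dag u * u) = dag u * u" by (simp add: dag_mult)
    finally show ?thesis by (simp only: \<nu>_def)
  qed
  \<comment> \<open>\<open>\<nu>\<close> lies in the fixed field, so its inverse is a norm and
    \<open>u\<close> can be rescaled to length 1.\<close>
  ultimately obtain x where x: "x ^ q * x = inverse \<nu>"
    using ex_norm[of "inverse \<nu>"] by (auto simp: power_inverse)
  show ?thesis
  proof (intro bexI[of _ "x \<cdot>\<^sub>m u"] conjI)
    have "dag (x \<cdot>\<^sub>m u) * (x \<cdot>\<^sub>m u) = (x ^ q * x) \<cdot>\<^sub>m (dag u * u)"
      by (simp add: dag_smult msmult_l msmult_r) (rule eq_matI, simp_all)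
    also have "\<dots> = 1\<^sub>m 1" unfolding x uu by (rule eq_matI) (simp_all add: \<open>\<nu> \<noteq> 0\<close>)
    finally show "dag (x \<cdot>\<^sub>m u) * (x \<cdot>\<^sub>m u) = 1\<^sub>m 1" .
    have "dag W * (x \<cdot>\<^sub>m u) = x \<cdot>\<^sub>m ((B * N) * v)"
      by (simp add: msmult_r u_def massoc B_def)
    also have "\<dots> = 0\<^sub>m m 1" unfolding BN by (simp add: mzero_l)
    finally show "dag W * (x \<cdot>\<^sub>m u) = 0\<^sub>m m 1" .
  qed (simp add: carrier_mat_iff)
qed

text \<open>Adjoints turn the stacked rows of \<open>dag (hcat A B)\<close> back into columns, where
  \<open>hcat\<close> can be compared blockwise.\<close>

lemma perp_hcat:
  assumes "A \<in> carrier_mat n a" "B \<in> carrier_mat n b" "M \<in> carrier_mat n k"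
  shows "dag (hcat A B) * M = 0\<^sub>m (a + b) k \<longleftrightarrow> dag A * M = 0\<^sub>m a k \<and> dag B * M = 0\<^sub>m b k"
proof -
  note [simp] = assms[THEN carrier_matD(1)] assms[THEN carrier_matD(2)]
  have "dag (hcat A B) * M = 0\<^sub>m (a + b) k \<longleftrightarrow> dag (dag (hcat A B) * M) = dag (0\<^sub>m (a + b) k)"
    by (simp only: dag_inject)
  also have "\<dots> \<longleftrightarrow> hcat (dag M * A) (dag M * B) = hcat (0\<^sub>m k a) (0\<^sub>m k b)"
  proof -
    have "hcat (0\<^sub>m k a) (0\<^sub>m k b) = (0\<^sub>m k (a + b) :: 'a mat)"
      by (rule eq_matI) (simp_all add: hcat_index)
    thus ?thesis by (simp add: dag_mult mult_hcat)
  qed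
  also have "\<dots> \<longleftrightarrow> dag M * A = dag (0\<^sub>m a k) \<and> dag M * B = dag (0\<^sub>m b k)"
    by (subst hcat_eq_iff[of _ k a _ _ b]) (simp_all add: carrier_mat_iff)
  also have "\<dots> \<longleftrightarrow> dag (dag A * M) = dag (0\<^sub>m a k) \<and> dag (dag B * M) = dag (0\<^sub>m b k)"
    by (simp add: dag_mult)
  finally show ?thesis by (simp only: dag_inject)
qed

lemma perp_sym:
  assumes "dag A * M = 0\<^sub>m a k" "dim_row A = dim_row M"
  shows "dag M * A = 0\<^sub>m k a"
  using arg_cong[OF assms(1), of dag] assms(2) by (simp add: dag_mult)

lemma gram_hcat:
  assumes "A \<in> carrier_mat n a" "B \<in> carrier_mat n b" "C \<in> carrier_mat n c" "D \<in> carrier_mat n d"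
  shows "dag (hcat A B) * hcat C D
    = four_block_mat (dag A * C) (dag A * D) (dag B * C) (dag B * D)"
proof -
  note [simp] = assms[THEN carrier_matD(1)] assms[THEN carrier_matD(2)]
  show ?thesis
  proof (rule eq_matI)
    fix i j assume "i < dim_row (four_block_mat (dag A * C) (dag A * D) (dag B * C) (dag B * D))"
      "j < dim_col (four_block_mat (dag A * C) (dag A * D) (dag B * C) (dag B * D))"
    hence ij: "i < a + b" "j < c + d" by simp_all
    have "row (dag (hcat A B)) i = (if i < a then row (dag A) i else row (dag B) (i - a))"
      using ij by (cases "i < a"; intro eq_vecI; simp add: hcat_index)
    moreover have "col (hcat C D) j = (if j < c then col C j else col D (j - c))"
      using ij by (cases "j < c"; intro eq_vecI; simp add: hcat_index)
    ultimately show "(dag (hcat A B) * hcat C D) $$ (i, j) =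
        four_block_mat (dag A * C) (dag A * D) (dag B * C) (dag B * D) $$ (i, j)"
      using ij by simp
  qed simp_all
qed

text \<open>The vectors are chosen one at a time, each orthogonal to \<open>W\<close> and to all its
  predecessors; the last choice has \<open>m + k - 1\<close> columns to avoid.\<close>

lemma ex_orthonormal_frame:
  assumes W: "W \<in> carrier_mat n m" and n: "n > 2 * (m + k)"
  shows "\<exists>E\<in>carrier_mat n k. dag W * E = 0\<^sub>m m k \<and> dag E * E = 1\<^sub>m k"
  using n
proof (induction k)
  case 0
  have "dag W * 0\<^sub>m n 0 = 0\<^sub>m m 0" using W by (intro eq_matI) simp_all
  moreover have "dag (0\<^sub>m n 0) * 0\<^sub>m n 0 = (1\<^sub>m 0 :: 'a mat)" by (intro eq_matI) simp_all
  ultimately show ?case by (intro bexI[of _ "0\<^sub>m n 0"]) simp_all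
next
  case (Suc k)
  then obtain E where E: "E \<in> carrier_mat n k" "dag W * E = 0\<^sub>m m k" "dag E * E = 1\<^sub>m k"
    by (auto simp del: carrier_matD)
  obtain e where e: "e \<in> carrier_mat n 1" "dag (hcat W E) * e = 0\<^sub>m (m + k) 1" "dag e * e = 1\<^sub>m 1"
    using ex_unit_vector_in_perp[OF hcat_carrier[OF W E(1)]] Suc.prems by auto
  note [simp] = carrier_matD[OF W] carrier_matD[OF E(1)] carrier_matD[OF e(1)]
  have We: "dag W * e = 0\<^sub>m m 1" and Ee: "dag E * e = 0\<^sub>m k 1"
    using e(2) perp_hcat[OF W E(1) e(1)] by simp_all
  have eE: "dag e * E = 0\<^sub>m 1 k" by (rule perp_sym[OF Ee]) simp
  have "dag W * hcat E e = hcat (0\<^sub>m m k) (0\<^sub>m m 1)"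
    by (simp add: mult_hcat E(2) We)
  also have "\<dots> = 0\<^sub>m m (Suc k)" by (rule eq_matI) (simp_all add: hcat_index)
  finally have 1: "dag W * hcat E e = 0\<^sub>m m (Suc k)" .
  have "dag (hcat E e) * hcat E e = 1\<^sub>m (k + 1)"
    unfolding gram_hcat[OF E(1) e(1) E(1) e(1)] E(3) e(3) eE Ee by (rule four_block_one_mat)
  with 1 show ?case by (intro bexI[of _ "hcat E e"]) (simp_all add: carrier_mat_iff)
qed

text \<open>If \<open>G = H + dag H\<close> then \<open>G = dag (H + 1) * (H + 1) - dag H * H - 1\<close>, and \<open>-1\<close> is a norm; the
  summand for \<open>-1\<close> also provides a left inverse \<open>Z\<close> of \<open>Y\<close>.\<close>

lemma ex_gram:
  assumes W: "W \<in> carrier_mat n m" and n: "n > 2 * (m + 3 * k)"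
    and G: "G \<in> carrier_mat k k" and herm: "dag G = G"
  shows "\<exists>Y\<in>carrier_mat n k. \<exists>Z\<in>carrier_mat k n.
    dag W * Y = 0\<^sub>m m k \<and> dag Y * Y = G \<and> Z * Y = 1\<^sub>m k \<and> Z * W = 0\<^sub>m k m"
proof -
  obtain \<theta> :: 'a where \<theta>: "\<theta> + \<theta> ^ q = 1" using ex_trace_1 by blast
  obtain \<mu> :: 'a where \<mu>: "\<mu> ^ q * \<mu> = -1" using ex_norm_minus_1 by blast
  \<comment> \<open>Three mutually orthogonal frames of \<open>k\<close> vectors, all orthogonal to
    \<open>W\<close>; hence the \<open>3 * k\<close> in the bound.\<close>
  obtain E1 where E1: "E1 \<in> carrier_mat n k" "dag W * E1 = 0\<^sub>m m k" "dag E1 * E1 = 1\<^sub>m k"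
    using ex_orthonormal_frame[OF W, of k] n by auto
  note W1 = hcat_carrier[OF W E1(1)]
  obtain E2 where E2: "E2 \<in> carrier_mat n k" "dag (hcat W E1) * E2 = 0\<^sub>m (m + k) k" "dag E2 * E2 = 1\<^sub>m k"
    using ex_orthonormal_frame[OF W1, of k] n by auto
  note W2 = hcat_carrier[OF W1 E2(1)]
  obtain E3 where E3: "E3 \<in> carrier_mat n k" "dag (hcat (hcat W E1) E2) * E3 = 0\<^sub>m (m + k + k) k"
      "dag E3 * E3 = 1\<^sub>m k"
    using ex_orthonormal_frame[OF W2, of k] n by auto
  note [simp] = carrier_matD[OF W] carrier_matD[OF G]
    carrier_matD[OF E1(1)] carrier_matD[OF E2(1)] carrier_matD[OF E3(1)]
  have WE: "dag W * E2 = 0\<^sub>m m k" "dag W * E3 = 0\<^sub>m m k" and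
    E12: "dag E1 * E2 = 0\<^sub>m k k" and E13: "dag E1 * E3 = 0\<^sub>m k k" and E23: "dag E2 * E3 = 0\<^sub>m k k"
    using E2(2) E3(2) perp_hcat[OF W E1(1) E2(1)] perp_hcat[OF W1 E2(1) E3(1)] perp_hcat[OF W E1(1) E3(1)]
    by simp_all
  have E21: "dag E2 * E1 = 0\<^sub>m k k" by (rule perp_sym[OF E12]) simp
  have E31: "dag E3 * E1 = 0\<^sub>m k k" by (rule perp_sym[OF E13]) simp
  have E32: "dag E3 * E2 = 0\<^sub>m k k" by (rule perp_sym[OF E23]) simp
  have E3W: "dag E3 * W = 0\<^sub>m k m" by (rule perp_sym[OF WE(2)]) simp
  \<comment> \<open>\<open>\<theta>\<close> has trace 1, so this splits \<open>G\<close> as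
    \<open>H + dag H\<close> without halving.\<close>
  define H where "H = \<theta> \<cdot>\<^sub>m G"
  have [simp]: "dim_row H = k" "dim_col H = k" by (simp_all add: H_def)
  have HG: "H + dag H = G"
  proof (rule eq_matI)
    fix i j assume "i < dim_row G" "j < dim_col G"
    moreover from this have "G $$ (j, i) ^ q = G $$ (i, j)"
      by (metis herm dag_index carrier_matD[OF G])
    ultimately have "(H + dag H) $$ (i, j) = (\<theta> + \<theta> ^ q) * G $$ (i, j)"
      by (simp add: H_def power_mult_distrib algebra_simps)
    thus "(H + dag H) $$ (i, j) = G $$ (i, j)" by (simp only: \<theta> mult_1)
  qed (simp_all add: H_def)
  define Y where "Y = E1 * (H + 1\<^sub>m k) + \<mu> \<cdot>\<^sub>m (E2 * H) + \<mu> \<cdot>\<^sub>m E3"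
  have Yd[simp]: "dim_row Y = n" "dim_col Y = k" by (simp_all add: Y_def)
  have 1: "dag E1 * Y = H + 1\<^sub>m k"
  proof -
    have "dag E1 * Y = (dag E1 * E1) * (H + 1\<^sub>m k) + \<mu> \<cdot>\<^sub>m ((dag E1 * E2) * H) + \<mu> \<cdot>\<^sub>m (dag E1 * E3)"
      unfolding Y_def by (simp add: madd_distl msmult_r massoc)
    also have "\<dots> = H + 1\<^sub>m k"
      unfolding E1(3) E12 E13 by (rule eq_matI) (simp_all add: mone_l mzero_l del: index_mult_mat(1))
    finally show ?thesis .
  qed
  have 2: "dag E2 * Y = \<mu> \<cdot>\<^sub>m H"
  proof -
    have "dag E2 * Y = (dag E2 * E1) * (H + 1\<^sub>m k) + \<mu> \<cdot>\<^sub>m ((dag E2 * E2) * H) + \<mu> \<cdot>\<^sub>m (dag E2 * E3)"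
      unfolding Y_def by (simp add: madd_distl msmult_r massoc)
    also have "\<dots> = \<mu> \<cdot>\<^sub>m H"
      unfolding E21 E2(3) E23 by (rule eq_matI) (simp_all add: mone_l mzero_l del: index_mult_mat(1))
    finally show ?thesis .
  qed
  have 3: "dag E3 * Y = \<mu> \<cdot>\<^sub>m 1\<^sub>m k"
  proof -
    have "dag E3 * Y = (dag E3 * E1) * (H + 1\<^sub>m k) + \<mu> \<cdot>\<^sub>m ((dag E3 * E2) * H) + \<mu> \<cdot>\<^sub>m (dag E3 * E3)"
      unfolding Y_def by (simp add: madd_distl msmult_r massoc)
    also have "\<dots> = \<mu> \<cdot>\<^sub>m 1\<^sub>m k"
      unfolding E31 E32 E3(3) by (rule eq_matI) (simp_all add: mone_l mzero_l del: index_mult_mat(1))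
    finally show ?thesis .
  qed
  have "dag Y * Y = dag (H + 1\<^sub>m k) * (dag E1 * Y) + \<mu> ^ q \<cdot>\<^sub>m (dag H * (dag E2 * Y)) + \<mu> ^ q \<cdot>\<^sub>m (dag E3 * Y)"
    by (subst Y_def) (simp add: dag_simps madd_distr msmult_l massoc)
  also have "\<dots> = (dag H + 1\<^sub>m k) * (H + 1\<^sub>m k) + (\<mu> ^ q * \<mu>) \<cdot>\<^sub>m (dag H * H) + (\<mu> ^ q * \<mu>) \<cdot>\<^sub>m 1\<^sub>m k"
    unfolding 1 2 3 by (simp add: dag_add msmult_r) (rule eq_matI, simp_all)
  also have "\<dots> = H + dag H"
    unfolding \<mu> by (simp add: madd_distr madd_distl mone_l mone_r)
      (rule eq_matI, simp_all del: index_mult_mat(1))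
  finally have YY: "dag Y * Y = G" by (simp only: HG)
  have "dag W * Y = (dag W * E1) * (H + 1\<^sub>m k) + \<mu> \<cdot>\<^sub>m ((dag W * E2) * H) + \<mu> \<cdot>\<^sub>m (dag W * E3)"
    unfolding Y_def by (simp add: madd_distl msmult_r massoc)
  also have "\<dots> = 0\<^sub>m m k"
    unfolding E1(2) WE by (rule eq_matI) (simp_all add: mzero_l)
  finally have WY: "dag W * Y = 0\<^sub>m m k" .
  have "\<mu> \<noteq> 0" using \<mu> by auto
  hence "(inverse \<mu> \<cdot>\<^sub>m dag E3) * Y = 1\<^sub>m k"
    by (simp add: msmult_l 3) (rule eq_matI, simp_all)
  moreover have "(inverse \<mu> \<cdot>\<^sub>m dag E3) * W = 0\<^sub>m k m"
    by (simp add: msmult_l E3W)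
  moreover have "Y \<in> carrier_mat n k" by (rule carrier_matI) simp_all
  moreover have "inverse \<mu> \<cdot>\<^sub>m dag E3 \<in> carrier_mat k n" by (rule carrier_matI) simp_all
  ultimately show ?thesis using YY WY
    by (intro bexI[of _ Y] bexI[of _ "inverse \<mu> \<cdot>\<^sub>m dag E3"] conjI)
qed

text \<open>If some \<open>R\<close> has the prescribed inner products \<open>G - 1\<close> with both \<open>T\<close> and \<open>U\<close>, correcting it
  orthogonally to \<open>T\<close> and \<open>U\<close> gives a common partner for two reflections.\<close>

lemma transitive_aux:
  assumes T: "T \<in> carrier_mat n k" and U: "U \<in> carrier_mat n k" and R: "R \<in> carrier_mat n k"
    and TT: "dag T * T = G" and UU: "dag U * U = G"
    and RT: "dag R * T = G - 1\<^sub>m k" and RU: "dag R * U = G - 1\<^sub>m k" and n: "n > 12 * k"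
  shows "\<exists>A\<in>unitary n. A * T = U"
proof -
  note [simp] = carrier_matD[OF T] carrier_matD[OF U] carrier_matD[OF R]
  have Gd[simp]: "dim_row G = k" "dim_col G = k" using TT by auto
  have G: "G \<in> carrier_mat k k" by (rule carrier_matI) simp_all
  have Gh: "dag G = G" unfolding TT[symmetric] by (simp add: dag_mult)
  note UR = hcat_carrier[OF U R] and TUR = hcat_carrier[OF T hcat_carrier[OF U R]]
  have G': "G - dag R * R \<in> carrier_mat k k" by (rule carrier_matI) simp_all
  have G'h: "dag (G - dag R * R) = G - dag R * R" by (simp add: dag_simps Gh)
  \<comment> \<open>\<open>ex_gram\<close> has \<open>3 * k\<close> columns to avoid and needs room
    for \<open>3 * k\<close> more, which gives the bound \<open>2 * (3 * k + 3 * k)\<close>. The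
    Gram matrix of \<open>Y\<close> is what \<open>R\<close> lacks for \<open>R + Y\<close> to have
    Gram matrix \<open>G\<close>.\<close>
  obtain Y where Y: "Y \<in> carrier_mat n k" "dag (hcat T (hcat U R)) * Y = 0\<^sub>m (k + (k + k)) k"
      "dag Y * Y = G - dag R * R"
    using ex_gram[OF TUR _ G' G'h] n by auto
  note [simp] = carrier_matD[OF Y(1)]
  have "dag T * Y = 0\<^sub>m k k" "dag U * Y = 0\<^sub>m k k" and RY: "dag R * Y = 0\<^sub>m k k"
    using Y(2) perp_hcat[OF T UR Y(1)] perp_hcat[OF U R Y(1)] by simp_all
  hence YT: "dag Y * T = 0\<^sub>m k k" and YU: "dag Y * U = 0\<^sub>m k k" and YR: "dag Y * R = 0\<^sub>m k k"
    by (auto intro: perp_sym)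
  define M where "M = R + Y"
  have [simp]: "dim_row M = n" "dim_col M = k" by (simp_all add: M_def)
  have M: "M \<in> carrier_mat n k" by (rule carrier_matI) simp_all
  have "dag M * T = G - 1\<^sub>m k" "dag M * U = G - 1\<^sub>m k"
    unfolding M_def by (simp_all add: dag_add madd_distr RT RU YT YU) (rule eq_matI; simp)+
  moreover have "dag M * M = G"
    unfolding M_def by (simp add: dag_add madd_distr madd_distl RY YR Y(3))
      (rule eq_matI, simp_all del: index_mult_mat(1))
  ultimately obtain A B where A: "A \<in> unitary n" "A * T = M" and B: "B \<in> unitary n" "B * U = M"
    using reflection[OF T M TT] reflection[OF U M UU] by blast
  have "(dag B * A) * T = U"
    using A B unitary_cancel(1)[OF B(1), of U] unitary_dim[OF A(1)] unitary_dim[OF B(1)]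
    by (simp add: massoc)
  moreover have "dag B * A \<in> unitary n" by (intro unitary_mult unitary_dag A B)
  ultimately show ?thesis by (rule bexI)
qed

text \<open>A Witt-type theorem. \<open>T\<close> and \<open>U\<close> may be linearly dependent in
  a way that excludes a common \<open>R\<close> for \<open>transitive_aux\<close>. So both are
  carried to a third frame \<open>Y\<close> with the same Gram matrix that is independent of each of
  them; the left inverse \<open>Z\<close> of \<open>Y\<close> annihilating \<open>T\<close> and
  \<open>U\<close> expresses this independence.\<close>

theorem unitary_transitive:
  assumes T: "T \<in> inj_mat n k" and U: "U \<in> inj_mat n k"
    and gram: "dag T * T = dag U * U" and n: "n > 12 * k"
  shows "\<exists>A\<in>unitary n. A * T = U"
proof -
  define G where "G = dag T * T"
  have Tc: "T \<in> carrier_mat n k" and Uc: "U \<in> carrier_mat n k"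
    using T U by (simp_all add: inj_mat_carrier)
  note [simp] = carrier_matD[OF Tc] carrier_matD[OF Uc]
  have Gd[simp]: "dim_row G = k" "dim_col G = k" by (simp_all add: G_def)
  have G: "G \<in> carrier_mat k k" by (rule carrier_matI) simp_all
  have Gh: "dag G = G" unfolding G_def by (simp add: dag_mult)
  obtain Y Z where Y: "Y \<in> carrier_mat n k" and Z: "Z \<in> carrier_mat k n" and YY: "dag Y * Y = G"
    and ZY: "Z * Y = 1\<^sub>m k" and ZTU: "Z * hcat T U = 0\<^sub>m k (k + k)"
    using ex_gram[OF hcat_carrier[OF Tc Uc] _ G Gh] n by auto
  note [simp] = carrier_matD[OF Y] carrier_matD[OF Z]
  have "hcat (Z * T) (Z * U) = hcat (0\<^sub>m k k) (0\<^sub>m k k)"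
    using ZTU by (simp add: mult_hcat) (rule eq_matI; simp add: hcat_index)
  hence ZT: "Z * T = 0\<^sub>m k k" and ZU: "Z * U = 0\<^sub>m k k"
    by (subst (asm) hcat_eq_iff[of _ k k _ _ k]; simp add: carrier_mat_iff)+
  have step: "\<exists>A\<in>unitary n. A * V = Y"
    if V: "V \<in> inj_mat n k" and VV: "dag V * V = G" and ZV: "Z * V = 0\<^sub>m k k" for V
  proof -
    have Vc: "V \<in> carrier_mat n k" using V by (rule inj_mat_carrier)
    obtain S where S: "S \<in> carrier_mat k n" and SV: "S * V = 1\<^sub>m k"
      using inj_mat_left_inverse[OF V] by (rule bexE)
    note [simp] = carrier_matD[OF Vc] carrier_matD[OF S]
    \<comment> \<open>On \<open>V\<close> the first summand gives \<open>G - 1\<^sub>m k\<close> and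
      the second vanishes by \<open>ZV\<close>; on \<open>Y\<close>, where \<open>Z\<close> acts as
      the identity, the second corrects the first. \<open>dag Q\<close> then serves as
      \<open>R\<close>.\<close>
    define Q where "Q = (G - 1\<^sub>m k) * S + ((G - 1\<^sub>m k) - (G - 1\<^sub>m k) * (S * Y)) * Z"
    have [simp]: "dim_row Q = k" "dim_col Q = n" by (simp_all add: Q_def)
    have "Q * V = (G - 1\<^sub>m k) * (S * V) + ((G - 1\<^sub>m k) - (G - 1\<^sub>m k) * (S * Y)) * (Z * V)"
      unfolding Q_def by (simp only: madd_distr massoc dag_dim index_mult_mat(2,3) index_minus_mat(2,3)
          index_add_mat(2,3) index_one_mat(2,3) Gd carrier_matD[OF Vc] carrier_matD[OF S] carrier_matD[OF Y] carrier_matD[OF Z])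
    also have "\<dots> = G - 1\<^sub>m k"
      unfolding SV ZV by (simp add: mone_r mzero_r) (rule eq_matI; simp)
    finally have QV: "Q * V = G - 1\<^sub>m k" .
    have "Q * Y = (G - 1\<^sub>m k) * (S * Y) + ((G - 1\<^sub>m k) - (G - 1\<^sub>m k) * (S * Y)) * (Z * Y)"
      unfolding Q_def by (simp only: madd_distr massoc dag_dim index_mult_mat(2,3) index_minus_mat(2,3)
          index_add_mat(2,3) index_one_mat(2,3) Gd carrier_matD[OF Vc] carrier_matD[OF S] carrier_matD[OF Y] carrier_matD[OF Z])
    also have "\<dots> = G - 1\<^sub>m k"
      unfolding ZY by (subst mone_r, simp, rule eq_matI) (simp_all del: index_mult_mat(1))
    finally have QY: "Q * Y = G - 1\<^sub>m k" .
    have "dag Q \<in> carrier_mat n k" by (rule carrier_matI) simp_all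
    from transitive_aux[OF Vc Y this VV YY _ _ n] QV QY show ?thesis by simp
  qed
  obtain A where A: "A \<in> unitary n" "A * T = Y" using step[OF T _ ZT] G_def by blast
  obtain B where B: "B \<in> unitary n" "B * U = Y" using step[OF U _ ZU] G_def gram by auto
  have "(dag B * A) * T = U"
    using A B unitary_cancel(1)[OF B(1), of U] unitary_dim[OF A(1)] unitary_dim[OF B(1)]
    by (simp add: massoc)
  moreover have "dag B * A \<in> unitary n" by (intro unitary_mult unitary_dag A B)
  ultimately show ?thesis by (rule bexI)
qed

end

subsection \<open>Averaging over a coset\<close>

context herm
begin

definition special :: "nat \<Rightarrow> 'a mat set" where
  "special n = {A \<in> unitary n. det A = 1}"

lemma special_unitary: "A \<in> special n \<Longrightarrow> A \<in> unitary n"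
  by (simp add: special_def)

lemma special_mult: "A \<in> special n \<Longrightarrow> B \<in> special n \<Longrightarrow> A * B \<in> special n"
  using det_mult[OF unitary_carrier unitary_carrier, of A n B] by (simp add: special_def unitary_mult)

lemma finite_special: "finite (special n)"
  by (rule finite_subset[OF _ finite_carrier_mat[of n n]]) (auto simp: special_def unitary_def)

lemma one_special: "1\<^sub>m n \<in> special n"
  by (simp add: special_def)

text \<open>A unit vector \<open>e\<close> orthogonal to \<open>U\<close> is moved to the first
  basis vector; scaling that coordinate by \<open>\<delta>\<close> and moving back fixes everything
  orthogonal to \<open>e\<close>. \<open>n > 12\<close> is the transitivity bound for single
  vectors.\<close>

lemma ex_unitary_det:
  assumes U: "U \<in> carrier_mat n k" and n: "n > 12 * k" "n > 12" and \<delta>: "\<delta> * \<delta> ^ q = 1"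
  shows "\<exists>P\<in>unitary n. P * U = U \<and> det P = \<delta>"
proof -
  obtain e where e: "e \<in> carrier_mat n 1" "dag U * e = 0\<^sub>m k 1" "dag e * e = 1\<^sub>m 1"
    using ex_unit_vector_in_perp[OF U] n by auto
  define e0 where "e0 = mat n 1 (\<lambda>(l, _). if l = 0 then 1 else 0 :: 'a)"
  have e0: "e0 \<in> carrier_mat n 1" by (simp add: e0_def)
  note [simp] = carrier_matD[OF U] carrier_matD[OF e(1)] carrier_matD[OF e0]
  have row0: "(dag e0 * M) $$ (0, j) = M $$ (0, j)" if "dim_row M = n" "j < dim_col M" for M j
  proof -
    have "(dag e0 * M) $$ (0, j) = (\<Sum>l<n. (e0 $$ (l, 0)) ^ q * M $$ (l, j))"
      using that by (simp add: scalar_prod_def atLeast0LessThan)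
    also have "\<dots> = (\<Sum>l<n. if l = 0 then M $$ (l, j) else 0)"
      by (intro sum.cong) (simp_all add: e0_def)
    finally show ?thesis using n by simp
  qed
  have e00: "dag e0 * e0 = 1\<^sub>m 1"
  proof (rule eq_matI)
    fix i j assume "i < dim_row (1\<^sub>m 1 :: 'a mat)" "j < dim_col (1\<^sub>m 1 :: 'a mat)"
    moreover have "(dag e0 * e0) $$ (0, 0) = 1"
      by (subst row0) (use n in \<open>simp_all add: e0_def\<close>)
    ultimately show "(dag e0 * e0) $$ (i, j) = 1\<^sub>m 1 $$ (i, j)" by simp
  qed simp_all
  have "e \<in> inj_mat n 1" "e0 \<in> inj_mat n 1"
    by (rule inj_matI[OF _ dag_carrier]; fact)+
  then obtain B where B: "B \<in> unitary n" "B * e0 = e"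
    using unitary_transitive[of e0 n 1 e] e(3) e00 n by auto
  note [simp] = unitary_dim[OF B(1)]
  \<comment> \<open>The diagonal matrix with entries \<open>\<delta>\<close>, 1, ..., 1; it is
    unitary because \<open>\<delta>\<close> has norm 1.\<close>
  define \<Delta> where "\<Delta> = multrow_mat n 0 \<delta>"
  have \<Delta>c: "\<Delta> \<in> carrier_mat n n" by (simp add: \<Delta>_def)
  note [simp] = carrier_matD[OF \<Delta>c]
  have \<Delta>M: "\<Delta> * M = multrow 0 \<delta> M" if "dim_row M = n" for M
    unfolding \<Delta>_def by (rule multrow_mat[symmetric, of _ _ "dim_col M"]) (rule carrier_matI, simp_all add: that)
  have "\<Delta> * dag \<Delta> = 1\<^sub>m n"
    by (subst \<Delta>M, simp, rule eq_matI) (use n \<delta> in \<open>auto simp: \<Delta>_def\<close>)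
  hence \<Delta>: "\<Delta> \<in> unitary n" by (simp add: unitary_def \<Delta>c)
  \<comment> \<open>The first row of \<open>dag B * U\<close> holds the inner products of
    \<open>e\<close> with the columns of \<open>U\<close>, which vanish.\<close>
  have "\<Delta> * (dag B * U) = dag B * U"
  proof -
    have "(dag B * U) $$ (0, j) = 0" if "j < k" for j
    proof -
      have "(dag B * U) $$ (0, j) = (dag e0 * (dag B * U)) $$ (0, j)"
        by (subst row0) (use that in simp_all)
      also have "dag e0 * (dag B * U) = dag (dag U * e)"
        unfolding B(2)[symmetric] by (simp add: dag_mult massoc)
      finally show ?thesis using that by (simp add: e(2))
    qed
    thus ?thesis by (subst \<Delta>M, simp, intro eq_matI) (simp_all del: index_mult_mat(1))
  qed
  hence "(B * \<Delta> * dag B) * U = U"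
    using unitary_cancel(2)[OF B(1), of U] by (simp add: massoc)
  moreover have "det (B * \<Delta> * dag B) = det B * \<delta> * det B ^ q"
    using B(1) n by (simp add: det_mult[of _ n] unitary_carrier dag_carrier \<Delta>c det_dag[of B n] mult_carrier_mat[of _ n n _ n])
      (simp add: \<Delta>_def det_multrow_mat)
  moreover have "det B * \<delta> * det B ^ q = \<delta>"
    using det_unitary[OF B(1)] by (simp add: mult_ac)
  moreover have "B * \<Delta> * dag B \<in> unitary n" by (intro unitary_mult unitary_dag B \<Delta>)
  ultimately show ?thesis by (intro bexI[of _ "B * \<Delta> * dag B"]) simp_all
qed

definition frames_gram :: "nat \<Rightarrow> nat \<Rightarrow> 'a mat \<Rightarrow> 'a mat set" where
  "frames_gram n k G = {T \<in> inj_mat n k. dag T * T = G}"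

text \<open>The determinant of a unitary transporter is corrected by a unitary matrix that fixes
  \<open>U\<close>; this makes the moments the same on every coset.\<close>

lemma special_transitive:
  assumes T: "T \<in> frames_gram n k G" and U: "U \<in> frames_gram n k G" and n: "n > 12 * k" "n > 12"
  shows "\<exists>A\<in>special n. A * T = U"
proof -
  have Tc: "T \<in> carrier_mat n k" and Uc: "U \<in> carrier_mat n k"
    using T U by (simp_all add: inj_mat_carrier frames_gram_def)
  obtain A where A: "A \<in> unitary n" "A * T = U"
    using unitary_transitive[of T n k U] T U n by (auto simp: frames_gram_def)
  have d: "det A * det A ^ q = 1" using A(1) by (rule det_unitary)
  hence d0: "det A \<noteq> 0" by auto
  have "inverse (det A) * inverse (det A) ^ q = 1"
    using d by (simp add: power_inverse flip: inverse_mult_distrib)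
  then obtain P where P: "P \<in> unitary n" "P * U = U" "det P = inverse (det A)"
    using ex_unitary_det[OF Uc n] by blast
  note [simp] = unitary_dim[OF A(1)] unitary_dim[OF P(1)] carrier_matD[OF Tc]
  have "(P * A) * T = U" using A P by (simp add: massoc)
  moreover have "P * A \<in> special n"
    using A P d0 det_mult[OF unitary_carrier[OF P(1)] unitary_carrier[OF A(1)]]
    by (simp add: special_def unitary_mult)
  ultimately show ?thesis by (rule bexI)
qed

lemma frames_gram_nonempty:
  assumes G: "G \<in> carrier_mat k k" "dag G = G" and n: "n > 12 * k"
  shows "frames_gram n k G \<noteq> {}"
proof -
  have "0\<^sub>m n 0 \<in> carrier_mat n 0" by simp
  from ex_gram[OF this _ G] obtain Y Z where "Y \<in> carrier_mat n k" "Z \<in> carrier_mat k n"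
    "dag Y * Y = G" "Z * Y = 1\<^sub>m k" using n by auto
  hence "Y \<in> frames_gram n k G" by (simp add: frames_gram_def inj_matI)
  thus ?thesis by blast
qed

lemma frames_gram_closed:
  assumes "A \<in> unitary n" "T \<in> frames_gram n k G"
  shows "A * T \<in> frames_gram n k G"
  using assms unitary_gram[OF assms(1), of T T] carrier_matD[OF inj_mat_carrier[of T n k]]
  by (simp add: frames_gram_def unitary_inj_mat)

lemma finite_frames_gram: "finite (frames_gram n k G)"
  by (rule finite_subset[OF _ finite_carrier_mat[of n k]]) (auto simp: frames_gram_def inj_mat_def)

text \<open>Transporters from \<open>T\<close> to \<open>U\<close> are turned into transporters from
  \<open>T'\<close> to \<open>U'\<close> by multiplying with \<open>b\<close> and \<open>a\<close>
  on the two sides. The roles of the pairs are symmetric, so one inequality yields equality.\<close>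

lemma card_transporter_le:
  assumes n: "n > 12 * k" "n > 12"
    and "T \<in> frames_gram n k G" "U \<in> frames_gram n k G" "T' \<in> frames_gram n k G" "U' \<in> frames_gram n k G"
  shows "card {s \<in> special n. s * T = U} \<le> card {s \<in> special n. s * T' = U'}"
proof -
  obtain a where a: "a \<in> special n" "a * T' = T" using special_transitive[OF assms(5,3) n] by blast
  obtain b where b: "b \<in> special n" "b * U = U'" using special_transitive[OF assms(4,6) n] by blast
  note au = special_unitary[OF a(1)] and bu = special_unitary[OF b(1)]
  have dT: "dim_row T' = n"
    using assms(5) inj_mat_dim(1)[of T' n k] by (simp add: frames_gram_def)
  note [simp] = unitary_dim[OF au] unitary_dim[OF bu]
  show ?thesis
  proof (rule card_inj_on_le[of "\<lambda>s. b * (s * a)"])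
    show "inj_on (\<lambda>s. b * (s * a)) {s \<in> special n. s * T = U}"
    proof (rule inj_on_inverseI[of _ "\<lambda>M. (dag b * M) * dag a"])
      fix s assume "s \<in> {s \<in> special n. s * T = U}"
      hence s: "s \<in> unitary n" by (simp add: special_unitary)
      note [simp] = unitary_dim[OF s]
      have "(dag b * (b * (s * a))) * dag a = s * (a * dag a)"
        using unitary_cancel(1)[OF bu, of "s * a"] by (simp add: massoc)
      thus "(dag b * (b * (s * a))) * dag a = s"
        by (simp add: unitary_mult_dag[OF au] mone_r)
    qed
    show "(\<lambda>s. b * (s * a)) ` {s \<in> special n. s * T = U} \<subseteq> {s \<in> special n. s * T' = U'}"
    proof safe
      fix s assume s: "s \<in> special n" "U = s * T"
      note [simp] = unitary_dim[OF special_unitary[OF s(1)]]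
      show "b * (s * a) \<in> special n" using a b s by (simp add: special_mult)
      show "b * (s * a) * T' = U'" using a(2) b(2) s(2) dT by (simp add: massoc)
    qed
  qed (simp add: finite_special)
qed

text \<open>As all transporter sets between frames with Gram matrix \<open>G\<close> have equal
  size, \<open>f\<close> and \<open>h\<close> may be replaced by the constant \<open>T0\<close> and
  the identity. Then every \<open>s\<close> is counted exactly once, for
  \<open>T = s * T0\<close>.\<close>

lemma sum_card_transporter:
  assumes n: "n > 12 * k" "n > 12"
    and f: "\<And>T. T \<in> frames_gram n k G \<Longrightarrow> f T \<in> frames_gram n k G \<and> h T \<in> frames_gram n k G"
    and G: "G \<in> carrier_mat k k" "dag G = G"
  shows "(\<Sum>T\<in>frames_gram n k G. card {s \<in> special n. s * f T = h T}) = card (special n)"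
proof -
  obtain T0 where T0: "T0 \<in> frames_gram n k G" using frames_gram_nonempty[OF G n(1)] by blast
  have "(\<Sum>T\<in>frames_gram n k G. card {s \<in> special n. s * f T = h T})
      = (\<Sum>T\<in>frames_gram n k G. card {s \<in> special n. s * T0 = T})"
    by (intro sum.cong le_antisym card_transporter_le[OF n, of _ G] T0) (use f in auto)
  also have "\<dots> = (\<Sum>T\<in>frames_gram n k G. \<Sum>s\<in>{s \<in> special n. s * T0 = T}. 1)" by simp
  also have "\<dots> = (\<Sum>s\<in>special n. 1)"
    by (rule sum.group) (auto simp: finite_special finite_frames_gram special_unitary frames_gram_closed[OF _ T0])
  finally show ?thesis by simp
qed

definition hom_frames :: "nat \<Rightarrow> nat \<Rightarrow> 'a mat \<Rightarrow> 'a mat \<Rightarrow> 'a mat set" where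
  "hom_frames n k z A = {T \<in> inj_mat n k. A * T = T * z}"

definition inv_forms :: "nat \<Rightarrow> 'a mat \<Rightarrow> 'a mat set" where
  "inv_forms k z = {G \<in> carrier_mat k k. dag G = G \<and> dag z * (G * z) = G}"

text \<open>Pairs of \<open>s\<close> and \<open>T\<close> with \<open>s * g * T = T * z\<close> are
  counted by \<open>T\<close>. Preservation of Gram matrices forces \<open>dag T * T\<close> to be
  \<open>z\<close>-invariant; for a fixed invariant \<open>G\<close>,
  \<open>sum_card_transporter\<close> with the frames \<open>g * T\<close> and \<open>T * z\<close>
  yields the order of the special group.\<close>

theorem sum_hom_frames:
  assumes n: "n > 12 * k" "n > 12" and g: "g \<in> unitary n"
    and z: "z \<in> carrier_mat k k" and zi: "zi \<in> carrier_mat k k" "z * zi = 1\<^sub>m k"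
  shows "(\<Sum>A\<in>(\<lambda>s. s * g) ` special n. card (hom_frames n k z A))
    = card (special n) * card (inv_forms k z)"
proof -
  note [simp] = unitary_dim[OF g] carrier_matD[OF z] carrier_matD[OF zi(1)]
  have fin: "finite (inj_mat n k :: 'a mat set)"
    by (rule finite_subset[OF _ finite_carrier_mat[of n k]]) (auto simp: inj_mat_def)
  have finf: "finite (inv_forms k z)"
    by (rule finite_subset[OF _ finite_carrier_mat[of k k]]) (auto simp: inv_forms_def)
  have inj: "inj_on (\<lambda>s. s * g) (special n)"
  proof (rule inj_on_inverseI[of _ "\<lambda>M. M * dag g"])
    fix s assume "s \<in> special n"
    note [simp] = unitary_dim[OF special_unitary[OF this]]
    show "s * g * dag g = s" by (simp add: massoc unitary_mult_dag[OF g] mone_r)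
  qed
  have zi': "zi * z = 1\<^sub>m k" by (rule mat_mult_left_right_inverse[OF z zi])
  define f where "f = (\<lambda>T. card {s \<in> special n. s * (g * T) = T * z})"
  define I where "I = {T \<in> inj_mat n k. dag T * T \<in> inv_forms k z}"
  have "(\<Sum>A\<in>(\<lambda>s. s * g) ` special n. card (hom_frames n k z A))
      = (\<Sum>s\<in>special n. card (hom_frames n k z (s * g)))"
    by (simp add: sum.reindex[OF inj])
  also have "\<dots> = (\<Sum>s\<in>special n. \<Sum>T\<in>inj_mat n k. of_bool (s * g * T = T * z))"
    using fin by (intro sum.cong) (auto simp: hom_frames_def sum_of_bool_eq Int_def)
  also have "\<dots> = (\<Sum>T\<in>inj_mat n k. \<Sum>s\<in>special n. of_bool (s * g * T = T * z))"
    by (rule sum.swap)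
  also have "\<dots> = (\<Sum>T\<in>inj_mat n k. f T)"
  proof (rule sum.cong[OF refl])
    fix T :: "'a mat" assume "T \<in> inj_mat n k"
    hence T: "dim_row T = n" "dim_col T = k" by (simp_all add: inj_mat_dim)
    have "(\<Sum>s\<in>special n. of_bool (s * g * T = T * z)) = card {s \<in> special n. s * g * T = T * z}"
      by (simp add: sum_of_bool_eq finite_special Int_def)
    also have "{s \<in> special n. s * g * T = T * z} = {s \<in> special n. s * (g * T) = T * z}"
      using T unitary_dim[OF special_unitary] by (intro Collect_cong conj_cong) (simp_all add: massoc)
    finally show "(\<Sum>s\<in>special n. of_bool (s * g * T = T * z)) = f T" by (simp add: f_def)
  qed
  also have "\<dots> = (\<Sum>T\<in>I. f T)"
  proof (rule sum.mono_neutral_right[OF fin])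
    show "\<forall>T\<in>inj_mat n k - I. f T = 0"
    proof
      fix T :: "'a mat" assume T: "T \<in> inj_mat n k - I"
      hence Td: "dim_row T = n" "dim_col T = k" using inj_mat_dim[of T n k] by simp_all
      have "\<not> (s * (g * T) = T * z)" if s: "s \<in> special n" for s
      proof
        assume eq: "s * (g * T) = T * z"
        have "dag T * T = dag (s * (g * T)) * (s * (g * T))"
          using unitary_gram[OF special_unitary[OF s], of "g * T" "g * T"] unitary_gram[OF g, of T T] Td by simp
        also have "\<dots> = dag z * ((dag T * T) * z)"
          unfolding eq using Td by (simp add: dag_mult massoc)
        finally have "dag z * ((dag T * T) * z) = dag T * T" ..
        moreover have "dag T * T \<in> carrier_mat k k" by (rule carrier_matI) (simp_all add: Td)
        moreover have "dag (dag T * T) = dag T * T" by (simp add: dag_mult)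
        ultimately have "dag T * T \<in> inv_forms k z" by (simp add: inv_forms_def)
        with T show False by (simp add: I_def)
      qed
      hence "{s \<in> special n. s * (g * T) = T * z} = {}" by blast
      thus "f T = 0" unfolding f_def by (simp only: card.empty)
    qed
  qed (auto simp: I_def)
  also have "\<dots> = (\<Sum>G\<in>inv_forms k z. \<Sum>T\<in>{T \<in> I. dag T * T = G}. f T)"
    by (rule sum.group[symmetric]) (use fin finf in \<open>auto simp: I_def\<close>)
  also have "\<dots> = (\<Sum>G\<in>inv_forms k z. card (special n))"
  proof (rule sum.cong[OF refl])
    fix G assume G: "G \<in> inv_forms k z"
    hence "{T \<in> I. dag T * T = G} = frames_gram n k G"
      by (auto simp: I_def frames_gram_def)
    moreover have "(\<Sum>T\<in>frames_gram n k G. f T) = card (special n)"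
      unfolding f_def
    proof (rule sum_card_transporter[OF n])
      fix T assume T: "T \<in> frames_gram n k G"
      hence Ti: "T \<in> inj_mat n k" and TG: "dag T * T = G" by (simp_all add: frames_gram_def)
      note [simp] = carrier_matD[OF inj_mat_carrier[OF Ti]]
      obtain S where S: "S \<in> carrier_mat k n" "S * T = 1\<^sub>m k"
        using inj_mat_left_inverse[OF Ti] by (rule bexE)
      note [simp] = carrier_matD[OF S(1)]
      have "(zi * S) * (T * z) = zi * ((S * T) * z)" by (simp add: massoc)
      also have "\<dots> = 1\<^sub>m k" by (simp add: S(2) mone_l zi')
      finally have "T * z \<in> inj_mat n k"
        by (intro inj_matI[of _ _ _ "zi * S"]) (simp_all add: carrier_mat_iff)
      moreover have "dag (T * z) * (T * z) = dag z * ((dag T * T) * z)"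
        by (simp add: dag_mult massoc)
      hence "dag (T * z) * (T * z) = G" using G by (simp add: TG inv_forms_def)
      ultimately show "g * T \<in> frames_gram n k G \<and> T * z \<in> frames_gram n k G"
        using frames_gram_closed[OF g T] by (simp add: frames_gram_def)
    qed (use G in \<open>simp_all add: inv_forms_def\<close>)
    ultimately show "(\<Sum>T\<in>{T \<in> I. dag T * T = G}. f T) = card (special n)" by simp
  qed
  finally show ?thesis by simp
qed

section \<open>Comparison with the groups of the statement\<close>

lemma carrier_GU: "carrier (GU q n) = unitary n"
proof (rule Set.set_eqI)
  fix A :: "'a mat"
  have "A \<in> carrier (GU q n) \<longleftrightarrow> A \<in> carrier (GL n) \<and> A * dag A = 1\<^sub>m n"
    by (simp add: GU_def dag_def)
  moreover have "A \<in> carrier (GL n)" if A: "A \<in> unitary n"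
    using unitary_dag_mult[OF A] unitary_mult_dag[OF A] unitary_carrier[OF A]
    by (simp add: GL_def units_of_def Units_def ring_mat_simps)
      (rule bexI[of _ "dag A"], simp_all add: dag_carrier)
  moreover have "A \<in> carrier_mat n n" if "A \<in> carrier (GL n)"
    using that by (simp add: GL_def units_of_def Units_def ring_mat_simps)
  moreover have "A \<in> unitary n \<longleftrightarrow> A \<in> carrier_mat n n \<and> A * dag A = 1\<^sub>m n"
    by (simp add: unitary_def)
  ultimately show "A \<in> carrier (GU q n) \<longleftrightarrow> A \<in> unitary n" by argo
qed

lemma SU_eq: "SU q n = special n"
  by (simp add: SU_def special_def carrier_GU)

lemma rcosets_SU:
  assumes "C \<in> rcosets\<^bsub>GU q n\<^esub> (SU q n :: 'a mat set)"
  shows "\<exists>g\<in>unitary n. C = (\<lambda>s. s * g) ` special n"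
proof -
  have "mult (GU q n) = ((*) :: 'a mat \<Rightarrow> _)"
    by (simp add: GU_def GL_def units_of_def ring_mat_simps)
  thus ?thesis using assms unfolding RCOSETS_def r_coset_def SU_eq carrier_GU by auto
qed

end

subsection \<open>Polynomials evaluated at matrices\<close>

definition pmat :: "'a::field mat \<Rightarrow> 'a poly \<Rightarrow> 'a mat" where
  "pmat A p = fold_coeffs (\<lambda>c M. c \<cdot>\<^sub>m 1\<^sub>m (dim_row A) + A * M) p (0\<^sub>m (dim_row A) (dim_row A))"

lemma pmat_0 [simp]: "pmat A 0 = 0\<^sub>m (dim_row A) (dim_row A)"
  by (simp add: pmat_def)

lemma pmat_pCons [simp]:
  assumes "dim_col A = dim_row A"
  shows "pmat A (pCons c p) = c \<cdot>\<^sub>m 1\<^sub>m (dim_row A) + A * pmat A p"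
proof (cases "c = 0 \<and> p = 0")
  case True
  thus ?thesis using assms by (simp add: mzero_r) (rule eq_matI; simp)
next
  case False
  thus ?thesis by (auto simp: pmat_def fold_coeffs_def)
qed

lemma pmat_dim [simp]:
  assumes "dim_col A = dim_row A"
  shows "dim_row (pmat A p) = dim_row A" "dim_col (pmat A p) = dim_row A"
  by (induction p) (simp_all add: assms)

lemma pmat_carrier:
  assumes "A \<in> carrier_mat n n" shows "pmat A p \<in> carrier_mat n n"
  using assms by (intro carrier_matI) simp_all

lemma pmat_1 [simp]: "dim_col A = dim_row A \<Longrightarrow> pmat A 1 = 1\<^sub>m (dim_row A)"
  unfolding one_pCons by (simp add: mzero_r) (rule eq_matI; simp)

lemma pmat_add:
  assumes A: "dim_col A = dim_row A"
  shows "pmat A (p + r) = pmat A p + pmat A r"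
proof (induction p r rule: poly_induct2)
  case 0
  show ?case by (rule eq_matI) simp_all
next
  case (pCons a p b r)
  show ?case
    by (simp add: A pCons madd_distl) (rule eq_matI; simp add: A algebra_simps del: index_mult_mat(1))
qed

lemma pmat_smult:
  assumes A: "dim_col A = dim_row A"
  shows "pmat A (Polynomial.smult c p) = c \<cdot>\<^sub>m pmat A p"
proof (induction p)
  case 0
  show ?case by (rule eq_matI) simp_all
next
  case (pCons a p)
  show ?case
    by (simp add: A pCons.IH msmult_r)
      (rule eq_matI; simp add: A algebra_simps del: index_mult_mat(1))
qed

lemma pmat_mult:
  assumes A: "dim_col A = dim_row A"
  shows "pmat A (p * r) = pmat A p * pmat A r"
proof (induction p)
  case 0
  show ?case by (simp add: A mzero_l)
next
  case (pCons a p)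
  have "pmat A (pCons a p * r) = a \<cdot>\<^sub>m pmat A r + (0 \<cdot>\<^sub>m 1\<^sub>m (dim_row A) + A * (pmat A p * pmat A r))"
    by (simp only: mult_pCons_left pmat_add[OF A] pmat_smult[OF A] pmat_pCons[OF A] pCons.IH)
  also have "\<dots> = pmat A (pCons a p) * pmat A r"
    by (simp add: A madd_distr msmult_l mone_l massoc)
      (rule eq_matI; simp add: A del: index_mult_mat(1))
  finally show ?case .
qed

lemma pmat_intertwine:
  assumes "A \<in> carrier_mat n n" "C \<in> carrier_mat k k" "T \<in> carrier_mat n k" "A * T = T * C"
  shows "pmat A p * T = T * pmat C p"
proof (induction p)
  note [simp] = assms(1-3)[THEN carrier_matD(1)] assms(1-3)[THEN carrier_matD(2)]
  case 0
  show ?case by (simp add: mzero_l mzero_r)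
next
  note [simp] = assms(1-3)[THEN carrier_matD(1)] assms(1-3)[THEN carrier_matD(2)]
  case (pCons a p)
  have "A * (T * pmat C p) = T * (C * pmat C p)"
    using arg_cong[OF assms(4), of "\<lambda>M. M * pmat C p"] by (simp add: massoc)
  thus ?case
    by (simp add: madd_distr madd_distl msmult_l msmult_r mone_l mone_r massoc pCons.IH)
qed

lemma pmat_four_block_diag:
  assumes A: "A \<in> carrier_mat a a" and D: "D \<in> carrier_mat d d"
  shows "pmat (four_block_mat A (0\<^sub>m a d) (0\<^sub>m d a) D) p
    = four_block_mat (pmat A p) (0\<^sub>m a d) (0\<^sub>m d a) (pmat D p)"
proof (induction p)
  note [simp] = carrier_matD[OF A] carrier_matD[OF D]
  case 0
  show ?case by simp
next
  note [simp] = carrier_matD[OF A] carrier_matD[OF D]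
  case (pCons c p)
  have "four_block_mat A (0\<^sub>m a d) (0\<^sub>m d a) D * four_block_mat (pmat A p) (0\<^sub>m a d) (0\<^sub>m d a) (pmat D p)
     = four_block_mat (A * pmat A p) (0\<^sub>m a d) (0\<^sub>m d a) (D * pmat D p)"
    using pmat_carrier[OF A, of p] pmat_carrier[OF D, of p]
    by (subst mult_four_block_mat[OF A _ _ D, of "0\<^sub>m a d" "0\<^sub>m d a" _ a _ d])
      (simp_all add: mzero_l mzero_r madd_zero_l madd_zero_r)
  thus ?case
    by (simp add: pCons.IH) (rule eq_matI; simp del: index_mult_mat(1); arith)
qed

text \<open>A nonzero element of least degree in the ideal generated by \<open>p\<close> and \<phi>
  divides both generators, hence is a unit.\<close>

lemma bezout_irreducible:
  fixes \<phi> p :: "'a::field poly"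
  assumes irr: "irreducible \<phi>" and nd: "\<not> \<phi> dvd p"
  shows "\<exists>a b. a * p + b * \<phi> = 1"
proof -
  define P where "P = (\<lambda>r. r \<noteq> 0 \<and> (\<exists>a b. r = a * p + b * \<phi>))"
  have "\<phi> = 0 * p + 1 * \<phi>" by simp
  moreover have "\<phi> \<noteq> 0" using irr by (simp add: Factorial_Ring.irreducible_def)
  ultimately have "P \<phi>" unfolding P_def by blast
  then obtain r where r: "P r" and min: "\<And>s. P s \<Longrightarrow> degree r \<le> degree s"
    using ex_has_least_nat[of P _ degree] by blast
  obtain a b where ab: "r = a * p + b * \<phi>" using r by (auto simp: P_def)
  have dvd: "r dvd c * p + d * \<phi>" for c d
  proof (rule ccontr)
    let ?s = "c * p + d * \<phi>"
    assume "\<not> r dvd ?s"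
    hence nz: "?s mod r \<noteq> 0" by (simp add: mod_eq_0_iff_dvd)
    have "?s mod r = ?s - (?s div r) * r" by (simp add: minus_div_mult_eq_mod)
    also have "\<dots> = (c - (?s div r) * a) * p + (d - (?s div r) * b) * \<phi>"
      by (subst (2) ab) (simp add: algebra_simps)
    finally have "P (?s mod r)" using nz by (auto simp: P_def)
    hence "degree r \<le> degree (?s mod r)" by (rule min)
    moreover have "degree (?s mod r) < degree r"
      using degree_mod_less[of r ?s] r nz by (auto simp: P_def)
    ultimately show False by simp
  qed
  have "r dvd p" "r dvd \<phi>" using dvd[of 1 0] dvd[of 0 1] by simp_all
  then obtain e where e: "\<phi> = r * e" by (elim dvdE)
  have "is_unit r"
  proof (rule ccontr)
    assume "\<not> is_unit r"
    hence "is_unit e" using Factorial_Ring.irreducibleD[OF irr e] by blast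
    hence "\<phi> dvd r" by (simp add: e mult_unit_dvd_iff)
    with \<open>r dvd p\<close> nd show False using dvd_trans by blast
  qed
  then obtain f where "1 = r * f" by (elim dvdE)
  hence "(f * a) * p + (f * b) * \<phi> = 1" by (simp add: ab algebra_simps)
  thus ?thesis by blast
qed

lemma irreducible_monic_dvd_eq:
  fixes \<phi> \<psi> :: "'a::field poly"
  assumes "irreducible \<phi>" "monic \<phi>" "irreducible \<psi>" "monic \<psi>" "\<phi> dvd \<psi>"
  shows "\<phi> = \<psi>"
proof -
  obtain e where e: "\<psi> = \<phi> * e" using assms(5) by (elim dvdE)
  have "\<not> is_unit \<phi>" using assms(1) unfolding Factorial_Ring.irreducible_def by blast
  hence "is_unit e" using Factorial_Ring.irreducibleD[OF assms(3) e] by blast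
  hence "degree e = 0" by (simp add: is_unit_iff_degree)
  then obtain c where c: "e = [:c:]" by (rule degree_eq_zeroE)
  have "lead_coeff \<psi> = lead_coeff \<phi> * c" unfolding e lead_coeff_mult by (simp add: c)
  hence "c = 1" unfolding assms(2) assms(4) by simp
  thus ?thesis using e c by simp
qed

text \<open>A Bezout identity for the coprime \<phi> and \<psi>, evaluated at \<open>A\<close>,
  loses its \<psi> term and leaves a left inverse.\<close>

lemma pmat_inverse_of_annihilator:
  fixes \<phi> \<psi> :: "'a::field poly"
  assumes A: "dim_col A = dim_row A" and z: "pmat A \<psi> = 0\<^sub>m (dim_row A) (dim_row A)"
    and "irreducible \<phi>" "monic \<phi>" "irreducible \<psi>" "monic \<psi>" "\<phi> \<noteq> \<psi>"
  shows "\<exists>B. B * pmat A \<phi> = 1\<^sub>m (dim_row A) \<and> dim_col B = dim_row A"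
proof -
  have "\<not> \<psi> dvd \<phi>" using irreducible_monic_dvd_eq[of \<psi> \<phi>] assms by blast
  then obtain a b where ab: "a * \<phi> + b * \<psi> = 1" using bezout_irreducible assms by blast
  have "pmat A (a * \<phi> + b * \<psi>) = pmat A a * pmat A \<phi> + pmat A b * 0\<^sub>m (dim_row A) (dim_row A)"
    by (simp only: pmat_add[OF A] pmat_mult[OF A] z)
  hence "pmat A a * pmat A \<phi> = 1\<^sub>m (dim_row A)"
    unfolding ab by (simp add: A mzero_r madd_zero_r)
  thus ?thesis by (intro exI[of _ "pmat A a"]) (simp add: A)
qed

definition kerp :: "'a::field mat \<Rightarrow> 'a poly \<Rightarrow> 'a vec set" where
  "kerp A p = {v \<in> carrier_vec (dim_row A). pmat A p *\<^sub>v v = 0\<^sub>v (dim_row A)}"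

lemma finite_kerp: "finite (kerp A p :: 'a::{field,finite} vec set)"
  by (rule finite_subset[OF _ finite_carrier_vec[of "dim_row A"]]) (auto simp: kerp_def)

lemma zero_in_kerp: "dim_col A = dim_row A \<Longrightarrow> 0\<^sub>v (dim_row A) \<in> kerp A p"
  by (simp add: kerp_def) (rule eq_vecI; simp add: scalar_prod_def)

lemma card_kerp_zero:
  fixes A :: "'a::{field,finite} mat"
  assumes "pmat A p = 0\<^sub>m (dim_row A) (dim_row A)"
  shows "card (kerp A p) = CARD('a) ^ dim_row A"
proof -
  have "0\<^sub>m (dim_row A) (dim_row A) *\<^sub>v v = 0\<^sub>v (dim_row A)" if "v \<in> carrier_vec (dim_row A)" for v :: "'a vec"
    using that by (intro eq_vecI) simp_all
  hence "kerp A p = carrier_vec (dim_row A)" unfolding kerp_def assms by auto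
  thus ?thesis by (simp add: card_carrier_vec)
qed

lemma card_kerp_inverse:
  assumes A: "dim_col A = dim_row A" and B: "B * pmat A p = 1\<^sub>m (dim_row A)" "dim_col B = dim_row A"
  shows "card (kerp A p) = 1"
proof -
  have "v = 0\<^sub>v (dim_row A)" if "v \<in> kerp A p" for v
  proof -
    have v: "v \<in> carrier_vec (dim_row A)" "pmat A p *\<^sub>v v = 0\<^sub>v (dim_row A)" using that by (simp_all add: kerp_def)
    have Bd: "dim_row B = dim_row A" using arg_cong[OF B(1), of dim_row] by simp
    have "v = (B * pmat A p) *\<^sub>v v" using v by (simp add: B)
    also have "\<dots> = B *\<^sub>v 0\<^sub>v (dim_row A)" using v A B(2) by (subst massoc_vec) simp_all
    also have "\<dots> = 0\<^sub>v (dim_row A)" using Bd B(2) by (intro eq_vecI) (simp_all add: scalar_prod_def)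
    finally show ?thesis .
  qed
  hence "kerp A p = {0\<^sub>v (dim_row A)}" using zero_in_kerp[OF A, of p] by blast
  thus ?thesis by simp
qed

lemma card_kerp_four_block_diag:
  fixes A D :: "'a::{field,finite} mat"
  assumes A: "A \<in> carrier_mat a a" and D: "D \<in> carrier_mat d d"
  shows "card (kerp (four_block_mat A (0\<^sub>m a d) (0\<^sub>m d a) D) p) = card (kerp A p) * card (kerp D p)"
proof -
  note [simp] = carrier_matD[OF A] carrier_matD[OF D]
  have mv: "four_block_mat (pmat A p) (0\<^sub>m a d) (0\<^sub>m d a) (pmat D p) *\<^sub>v (v @\<^sub>v w)
      = (pmat A p *\<^sub>v v) @\<^sub>v (pmat D p *\<^sub>v w)"
    if "v \<in> carrier_vec a" "w \<in> carrier_vec d" for v w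
    by (rule mult_mat_vec_split) (simp_all add: that pmat_carrier A D)
  have z: "0\<^sub>v (a + d) = (0\<^sub>v a @\<^sub>v 0\<^sub>v d :: 'a vec)" by (rule eq_vecI) simp_all
  have iff: "v @\<^sub>v w \<in> kerp (four_block_mat A (0\<^sub>m a d) (0\<^sub>m d a) D) p \<longleftrightarrow> v \<in> kerp A p \<and> w \<in> kerp D p"
    if vw: "v \<in> carrier_vec a" "w \<in> carrier_vec d" for v w
  proof -
    have "pmat A p *\<^sub>v v \<in> carrier_vec a"
      by (rule mult_mat_vec_carrier[OF pmat_carrier[OF A] vw(1)])
    from append_vec_eq[OF this zero_carrier_vec] show ?thesis
      using vw mv[OF vw] by (simp add: kerp_def pmat_four_block_diag[OF A D] z)
  qed
  have "bij_betw (\<lambda>(v, w). v @\<^sub>v w) (kerp A p \<times> kerp D p) (kerp (four_block_mat A (0\<^sub>m a d) (0\<^sub>m d a) D) p)"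
  proof (rule bij_betw_imageI)
    show "inj_on (\<lambda>(v, w). v @\<^sub>v w) (kerp A p \<times> kerp D p)"
    proof (rule inj_onI, clarify)
      fix v w v' w' assume "v \<in> kerp A p" "v' \<in> kerp A p" "v @\<^sub>v w = v' @\<^sub>v w'"
      thus "v = v' \<and> w = w'" using append_vec_eq[of v a v' w w'] by (simp add: kerp_def)
    qed
    show "(\<lambda>(v, w). v @\<^sub>v w) ` (kerp A p \<times> kerp D p) = kerp (four_block_mat A (0\<^sub>m a d) (0\<^sub>m d a) D) p"
    proof (rule equalityI; rule subsetI)
      fix u assume "u \<in> (\<lambda>(v, w). v @\<^sub>v w) ` (kerp A p \<times> kerp D p)"
      then obtain v w where u: "u = v @\<^sub>v w" and k: "v \<in> kerp A p" "w \<in> kerp D p" by auto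
      hence "v \<in> carrier_vec a" "w \<in> carrier_vec d" by (simp_all add: kerp_def)
      thus "u \<in> kerp (four_block_mat A (0\<^sub>m a d) (0\<^sub>m d a) D) p" using iff k u by simp
    next
      fix u assume u: "u \<in> kerp (four_block_mat A (0\<^sub>m a d) (0\<^sub>m d a) D) p"
      hence "u \<in> carrier_vec (a + d)" by (simp add: kerp_def)
      then obtain v w where vw: "v \<in> carrier_vec a" "w \<in> carrier_vec d" "u = v @\<^sub>v w"
        by (metis vec_first_last_append vec_first_carrier vec_last_carrier)
      thus "u \<in> (\<lambda>(v, w). v @\<^sub>v w) ` (kerp A p \<times> kerp D p)" using iff[OF vw(1,2)] u by force
    qed
  qed
  from bij_betw_same_card[OF this] show ?thesis by (simp add: card_cartesian_product)
qed

subsection \<open>Krylov matrices and companion matrices\<close>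

primrec vpow :: "'a::field mat \<Rightarrow> nat \<Rightarrow> 'a vec \<Rightarrow> 'a vec" where
  "vpow A 0 v = v"
| "vpow A (Suc i) v = A *\<^sub>v vpow A i v"

lemma vpow_carrier: "A \<in> carrier_mat n n \<Longrightarrow> v \<in> carrier_vec n \<Longrightarrow> vpow A i v \<in> carrier_vec n"
  by (induction i) simp_all

lemma pmat_mult_vec:
  assumes A: "A \<in> carrier_mat n n" and v: "v \<in> carrier_vec n"
  shows "degree p < N \<Longrightarrow> r < n \<Longrightarrow> (pmat A p *\<^sub>v v) $ r = (\<Sum>i<N. poly.coeff p i * vpow A i v $ r)"
proof (induction p arbitrary: N r)
  case 0
  thus ?case using A v by simp
next
  note [simp] = carrier_matD[OF A] carrier_vecD[OF v]
  case (pCons c p)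
  show ?case
  proof (cases "p = 0")
    case True
    have "(\<Sum>i<N. poly.coeff (pCons c p) i * vpow A i v $ r) = (\<Sum>i\<in>{0}. poly.coeff (pCons c p) i * vpow A i v $ r)"
      using pCons.prems by (intro sum.mono_neutral_right) (auto simp: True coeff_pCons split: nat.splits)
    moreover have "pmat A (pCons c p) = c \<cdot>\<^sub>m 1\<^sub>m n" by (simp add: True mzero_r madd_zero_r)
    moreover have "(c \<cdot>\<^sub>m 1\<^sub>m n *\<^sub>v v) $ r = c * v $ r" using pCons.prems v by simp
    ultimately show ?thesis by simp
  next
    case False
    then obtain N' where N': "N = Suc N'" "degree p < N'"
      using pCons.prems by (cases N) auto
    have pc: "pmat A p *\<^sub>v v \<in> carrier_vec n" by (rule mult_mat_vec_carrier[OF pmat_carrier[OF A] v])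
    have pc': "pmat A (pCons c p) = c \<cdot>\<^sub>m 1\<^sub>m n + A * pmat A p" by simp
    have "pmat A (pCons c p) *\<^sub>v v = c \<cdot>\<^sub>v v + A *\<^sub>v (pmat A p *\<^sub>v v)"
    proof -
      have "pmat A (pCons c p) *\<^sub>v v = (c \<cdot>\<^sub>m 1\<^sub>m n) *\<^sub>v v + (A * pmat A p) *\<^sub>v v"
        unfolding pc' by (rule add_mult_distrib_mat_vec[of _ n n]; (rule carrier_matI)?; simp add: v)
      also have "(c \<cdot>\<^sub>m 1\<^sub>m n) *\<^sub>v v = c \<cdot>\<^sub>v v"
          by (rule eq_vecI) (simp_all add: scalar_prod_left_unit[OF v])
      also have "(A * pmat A p) *\<^sub>v v = A *\<^sub>v (pmat A p *\<^sub>v v)" by (rule massoc_vec) simp_all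
      finally show ?thesis .
    qed
    hence "(pmat A (pCons c p) *\<^sub>v v) $ r = c * v $ r + (\<Sum>s<n. A $$ (r, s) * (pmat A p *\<^sub>v v) $ s)"
      using pCons.prems pc by (simp add: scalar_prod_def atLeast0LessThan)
    also have "(\<Sum>s<n. A $$ (r, s) * (pmat A p *\<^sub>v v) $ s)
        = (\<Sum>s<n. A $$ (r, s) * (\<Sum>i<N'. poly.coeff p i * vpow A i v $ s))"
      using pCons.IH[OF N'(2)] by simp
    also have "\<dots> = (\<Sum>i<N'. poly.coeff p i * (\<Sum>s<n. A $$ (r, s) * vpow A i v $ s))"
      by (simp add: sum_distrib_left mult_ac) (rule sum.swap)
    also have "\<dots> = (\<Sum>i<N'. poly.coeff p i * vpow A (Suc i) v $ r)"
      using pCons.prems vpow_carrier[OF A v, THEN carrier_vecD]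
      by (simp add: scalar_prod_def atLeast0LessThan)
    finally show ?thesis by (simp add: N' sum.lessThan_Suc_shift del: sum.lessThan_Suc)
  qed
qed

definition krylov :: "'a::field mat \<Rightarrow> nat \<Rightarrow> 'a vec \<Rightarrow> 'a mat" where
  "krylov A j v = mat (dim_row A) j (\<lambda>(r, i). vpow A i v $ r)"

lemma krylov_carrier: "A \<in> carrier_mat n n \<Longrightarrow> krylov A j v \<in> carrier_mat n j"
  by (simp add: krylov_def)

text \<open>A coordinate vector of length \<open>j\<close> is read as the coefficient sequence of a
  polynomial, so the image of the Krylov matrix consists of the polynomials of degree below
  \<open>j\<close> in \<open>A\<close> applied to \<open>v\<close>.\<close>

lemma krylov_mult_vec:
  assumes A: "A \<in> carrier_mat n n" and v: "v \<in> carrier_vec n" and u: "u \<in> carrier_vec j"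
  shows "\<exists>p. (p = 0 \<longleftrightarrow> u = 0\<^sub>v j) \<and> (p \<noteq> 0 \<longrightarrow> degree p < j) \<and> krylov A j v *\<^sub>v u = pmat A p *\<^sub>v v"
proof -
  define p where "p = (\<Sum>i<j. monom (u $ i) i)"
  have cp: "poly.coeff p i = (if i < j then u $ i else 0)" for i
    by (simp add: p_def coeff_sum)
  have "p = 0 \<longleftrightarrow> u = 0\<^sub>v j"
  proof
    assume "p = 0"
    hence "u $ i = 0" if "i < j" for i using cp[of i] that by simp
    thus "u = 0\<^sub>v j" using u by (intro eq_vecI) auto
  qed (simp add: p_def)
  moreover have "degree p < j" if "p \<noteq> 0"
  proof (rule ccontr)
    assume "\<not> degree p < j"
    hence "lead_coeff p = 0" by (simp add: cp)
    with that show False by simp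
  qed
  moreover have "krylov A j v *\<^sub>v u = pmat A p *\<^sub>v v"
  proof (rule eq_vecI)
    fix r assume "r < dim_vec (pmat A p *\<^sub>v v)"
    hence r: "r < n" using A by simp
    \<comment> \<open>A range long enough for \<open>pmat_mult_vec\<close> that also contains
      \<open>{..<j}\<close>; the coefficients beyond \<open>j\<close> vanish.\<close>
    have "degree p < Suc (degree p + j)" by simp
    hence "(pmat A p *\<^sub>v v) $ r = (\<Sum>i<Suc (degree p + j). poly.coeff p i * vpow A i v $ r)"
      by (rule pmat_mult_vec[OF A v _ r])
    also have "\<dots> = (\<Sum>i<j. poly.coeff p i * vpow A i v $ r)"
      by (rule sum.mono_neutral_right) (auto simp: cp)
    also have "\<dots> = (krylov A j v *\<^sub>v u) $ r"
      using A u r by (simp add: krylov_def scalar_prod_def cp atLeast0LessThan mult.commute)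
    finally show "(krylov A j v *\<^sub>v u) $ r = (pmat A p *\<^sub>v v) $ r" ..
  qed (use A in \<open>simp add: krylov_def\<close>)
  ultimately show ?thesis by blast
qed

text \<open>For monic \<phi>, multiplication by z on F[z]/(\<phi>) in the basis of powers of
  z.\<close>

definition companion :: "'a::field poly \<Rightarrow> 'a mat" where
  "companion \<phi> = mat (degree \<phi>) (degree \<phi>) (\<lambda>(i, c).
     if Suc c = degree \<phi> then - poly.coeff \<phi> i else if i = Suc c then 1 else 0)"

lemma companion_carrier: "companion \<phi> \<in> carrier_mat (degree \<phi>) (degree \<phi>)"
  by (simp add: companion_def)

lemma companion_dim [simp]: "dim_row (companion \<phi>) = degree \<phi>" "dim_col (companion \<phi>) = degree \<phi>"
  by (simp_all add: companion_def)

lemma mult_companion_index: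
  assumes T: "T \<in> carrier_mat n (degree \<phi>)" and "r < n" "c < degree \<phi>"
  shows "(T * companion \<phi>) $$ (r, c) = (if Suc c = degree \<phi>
    then - (\<Sum>i<degree \<phi>. poly.coeff \<phi> i * T $$ (r, i)) else T $$ (r, Suc c))"
proof (cases "Suc c = degree \<phi>")
  case True
  hence "(T * companion \<phi>) $$ (r, c) = (\<Sum>i<degree \<phi>. T $$ (r, i) * (- poly.coeff \<phi> i))"
    using assms by (simp add: companion_def scalar_prod_def atLeast0LessThan)
  thus ?thesis using True by (simp add: sum_negf mult.commute)
next
  case False
  hence "(T * companion \<phi>) $$ (r, c) = (\<Sum>i<degree \<phi>. T $$ (r, i) * (if i = Suc c then 1 else 0))"
    using assms by (simp add: companion_def scalar_prod_def atLeast0LessThan)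
  also have "\<dots> = (\<Sum>i<degree \<phi>. if i = Suc c then T $$ (r, i) else 0)"
    by (intro sum.cong) simp_all
  finally show ?thesis using False assms(3) by simp
qed

lemma monic_pmat_mult_vec:
  assumes A: "A \<in> carrier_mat n n" and v: "v \<in> carrier_vec n" and r: "r < n" and "monic \<phi>"
  shows "(pmat A \<phi> *\<^sub>v v) $ r = (\<Sum>i<degree \<phi>. poly.coeff \<phi> i * vpow A i v $ r) + vpow A (degree \<phi>) v $ r"
  using pmat_mult_vec[OF A v, of \<phi> "Suc (degree \<phi>)" r] r assms(4) by simp

text \<open>A vector killed by \<phi>(A) extends to a module homomorphism from F[z]/(\<phi>); the
  kernel condition enters in the last column.\<close>

lemma krylov_companion:
  assumes A: "A \<in> carrier_mat n n" and v: "v \<in> kerp A \<phi>" and \<phi>: "monic \<phi>"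
  shows "A * krylov A (degree \<phi>) v = krylov A (degree \<phi>) v * companion \<phi>"
proof (rule eq_matI)
  note [simp] = carrier_matD[OF A] carrier_matD[OF krylov_carrier[OF A]]
  fix r c
  assume "r < dim_row (krylov A (degree \<phi>) v * companion \<phi>)" "c < dim_col (krylov A (degree \<phi>) v * companion \<phi>)"
  hence rc: "r < n" "c < degree \<phi>" by simp_all
  have vc: "v \<in> carrier_vec n" "pmat A \<phi> *\<^sub>v v = 0\<^sub>v n" using v by (simp_all add: kerp_def)
  have "(A * krylov A (degree \<phi>) v) $$ (r, c) = vpow A (Suc c) v $ r"
    using rc vpow_carrier[OF A vc(1), THEN carrier_vecD]
    by (simp add: scalar_prod_def) (simp add: krylov_def)
  also have "\<dots> = (krylov A (degree \<phi>) v * companion \<phi>) $$ (r, c)"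
  proof (cases "Suc c = degree \<phi>")
    case True
    have "vpow A (degree \<phi>) v $ r = - (\<Sum>i<degree \<phi>. poly.coeff \<phi> i * vpow A i v $ r)"
      using monic_pmat_mult_vec[OF A vc(1) rc(1) \<phi>] vc(2) rc(1)
      by (simp add: eq_neg_iff_add_eq_0 add.commute)
    also have "(\<Sum>i<degree \<phi>. poly.coeff \<phi> i * vpow A i v $ r)
        = (\<Sum>i<degree \<phi>. poly.coeff \<phi> i * krylov A (degree \<phi>) v $$ (r, i))"
      using rc by (intro sum.cong) (simp_all add: krylov_def)
    finally show ?thesis
      by (subst mult_companion_index[OF krylov_carrier[OF A] rc]) (simp add: True)
  next
    case False
    hence "Suc c < degree \<phi>" using rc by simp
    thus ?thesis using False rc
      by (simp only: mult_companion_index[OF krylov_carrier[OF A] rc] if_False) (simp add: krylov_def)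
  qed
  finally show "(A * krylov A (degree \<phi>) v) $$ (r, c) = (krylov A (degree \<phi>) v * companion \<phi>) $$ (r, c)" .
qed (use A in \<open>simp_all add: krylov_def\<close>)

text \<open>Conversely a homomorphism from F[z]/(\<phi>) is determined by the image of 1, that is,
  by column 0.\<close>

lemma companion_krylov:
  assumes A: "A \<in> carrier_mat n n" and T: "T \<in> carrier_mat n (degree \<phi>)"
    and eq: "A * T = T * companion \<phi>" and \<phi>: "monic \<phi>" "degree \<phi> > 0"
  shows "col T 0 \<in> kerp A \<phi>" "krylov A (degree \<phi>) (col T 0) = T"
proof -
  note [simp] = carrier_matD[OF A] carrier_matD[OF T]
  have vc: "col T 0 \<in> carrier_vec n" by (simp add: carrier_vecI)
  have AT: "A *\<^sub>v col T c = col (A * T) c" if "c < degree \<phi>" for c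
    using that by (intro eq_vecI) simp_all
  have pow: "vpow A i (col T 0) = col T i" if "i < degree \<phi>" for i
    using that
  proof (induction i)
    case (Suc i)
    hence "vpow A (Suc i) (col T 0) = col (A * T) i" using AT[of i] by simp
    also have "\<dots> = col T (Suc i)"
      unfolding eq using Suc.prems
      by (intro eq_vecI) (simp_all add: mult_companion_index[OF T] del: index_mult_mat(1))
    finally show ?case .
  qed simp
  show "krylov A (degree \<phi>) (col T 0) = T"
    by (rule eq_matI) (simp_all add: krylov_def pow)
  have "pmat A \<phi> *\<^sub>v col T 0 = 0\<^sub>v n"
  proof (rule eq_vecI)
    fix r assume "r < dim_vec (0\<^sub>v n :: 'a vec)"
    hence r: "r < n" by simp
    obtain c where c: "degree \<phi> = Suc c" using \<phi>(2) gr0_implies_Suc by blast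
    have "vpow A (degree \<phi>) (col T 0) $ r = (T * companion \<phi>) $$ (r, c)"
      using c AT[of c] pow[of c] r unfolding eq by (simp del: index_mult_mat(1))
    also have "\<dots> = - (\<Sum>i<degree \<phi>. poly.coeff \<phi> i * vpow A i (col T 0) $ r)"
      using mult_companion_index[OF T r, of c] c r by (simp add: pow del: index_mult_mat(1))
    finally show "(pmat A \<phi> *\<^sub>v col T 0) $ r = 0\<^sub>v n $ r"
      using r by (simp add: monic_pmat_mult_vec[OF A vc r \<phi>(1)])
  qed simp
  thus "col T 0 \<in> kerp A \<phi>" using vc by (simp add: kerp_def)
qed

text \<open>By \<open>companion_krylov\<close> for the identity matrix, \<phi>(C) kills the first
  basis vector, and that vector generates the module. As \<phi>(C) commutes with every polynomial in
  C, it kills everything.\<close>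

lemma pmat_companion:
  assumes "monic \<phi>" "degree \<phi> > 0"
  shows "pmat (companion \<phi>) \<phi> = 0\<^sub>m (degree \<phi>) (degree \<phi>)"
proof -
  let ?C = "companion \<phi>" and ?j = "degree \<phi>" and ?e = "col (1\<^sub>m (degree \<phi>)) 0 :: 'a vec"
  have C: "?C \<in> carrier_mat ?j ?j" by (rule companion_carrier)
  have "?C * 1\<^sub>m ?j = 1\<^sub>m ?j * ?C" by (simp add: mone_l mone_r)
  note k = companion_krylov[OF C one_carrier_mat this assms]
  have e: "?e \<in> carrier_vec ?j" by (simp add: carrier_vecI)
  have "pmat ?C \<phi> *\<^sub>v u = 0\<^sub>v ?j" if u: "u \<in> carrier_vec ?j" for u
  proof -
    obtain p where p: "krylov ?C ?j ?e *\<^sub>v u = pmat ?C p *\<^sub>v ?e"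
      using krylov_mult_vec[OF C e u] by blast
    have "pmat ?C \<phi> *\<^sub>v u = pmat ?C \<phi> *\<^sub>v (pmat ?C p *\<^sub>v ?e)"
      using p u unfolding k(2) by simp
    also have "\<dots> = (pmat ?C \<phi> * pmat ?C p) *\<^sub>v ?e"
      using e by (subst massoc_vec) simp_all
    also have "pmat ?C \<phi> * pmat ?C p = pmat ?C p * pmat ?C \<phi>"
      by (simp add: pmat_mult[symmetric] mult.commute)
    also have "\<dots> *\<^sub>v ?e = pmat ?C p *\<^sub>v (pmat ?C \<phi> *\<^sub>v ?e)"
      using e by (subst massoc_vec) simp_all
    also have "pmat ?C \<phi> *\<^sub>v ?e = 0\<^sub>v ?j" using k(1) by (simp add: kerp_def)
    also have "pmat ?C p *\<^sub>v 0\<^sub>v ?j = 0\<^sub>v ?j" by (rule eq_vecI) (simp_all add: scalar_prod_def)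
    finally show ?thesis .
  qed
  thus ?thesis using mat_zero_vecI[of "pmat ?C \<phi>"] by simp
qed

subsection \<open>Counting embeddings of semisimple modules\<close>

definition homs :: "nat \<Rightarrow> nat \<Rightarrow> 'a::field mat \<Rightarrow> 'a mat \<Rightarrow> 'a mat set" where
  "homs n k z A = {T \<in> carrier_mat n k. A * T = T * z}"

lemma finite_homs: "finite (homs n k z A :: 'a::{field,finite} mat set)"
  by (rule finite_subset[OF _ finite_carrier_mat[of n k]]) (auto simp: homs_def)

lemma bij_betw_companion_homs:
  assumes A: "A \<in> carrier_mat n n" and \<phi>: "monic \<phi>" "degree \<phi> > 0"
  shows "bij_betw (krylov A (degree \<phi>)) (kerp A \<phi>) (homs n (degree \<phi>) (companion \<phi>) A)"
proof (rule bij_betwI[where g = "\<lambda>T. col T 0"])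
  show "krylov A (degree \<phi>) \<in> kerp A \<phi> \<rightarrow> homs n (degree \<phi>) (companion \<phi>) A"
    by (simp add: homs_def krylov_companion[OF A _ \<phi>(1)] krylov_carrier[OF A])
  show "(\<lambda>T. col T 0) \<in> homs n (degree \<phi>) (companion \<phi>) A \<rightarrow> kerp A \<phi>"
    by (simp add: homs_def companion_krylov(1)[OF A _ _ \<phi>])
  show "col (krylov A (degree \<phi>) v) 0 = v" if "v \<in> kerp A \<phi>" for v
  proof -
    have "dim_vec v = n" using that A by (simp add: kerp_def)
    thus ?thesis using A \<phi>(2) by (intro eq_vecI) (simp_all add: krylov_def)
  qed
  show "krylov A (degree \<phi>) (col T 0) = T" if "T \<in> homs n (degree \<phi>) (companion \<phi>) A" for T
    using that by (simp add: homs_def companion_krylov(2)[OF A _ _ \<phi>])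
qed

text \<open>\<open>zmat L\<close> is the action of z on the direct sum of the modules F[z]/(\<phi>)
  with \<phi> running through \<open>L\<close>, repetitions giving multiplicities;
  \<open>zdim L\<close> is the dimension of that sum.\<close>

primrec zdim :: "'a::field poly list \<Rightarrow> nat" where
  "zdim [] = 0"
| "zdim (\<phi> # L) = degree \<phi> + zdim L"

primrec zmat :: "'a::field poly list \<Rightarrow> 'a mat" where
  "zmat [] = 0\<^sub>m 0 0"
| "zmat (\<phi> # L) = four_block_mat (companion \<phi>) (0\<^sub>m (degree \<phi>) (zdim L)) (0\<^sub>m (zdim L) (degree \<phi>)) (zmat L)"

lemma zmat_carrier: "zmat L \<in> carrier_mat (zdim L) (zdim L)"
  by (induction L) (simp_all add: companion_carrier)

lemma homs_zmat_Cons_iff: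
  assumes A: "A \<in> carrier_mat n n" and T: "T \<in> carrier_mat n (degree \<phi>)" "U \<in> carrier_mat n (zdim L)"
  shows "hcat T U \<in> homs n (zdim (\<phi> # L)) (zmat (\<phi> # L)) A \<longleftrightarrow>
    T \<in> homs n (degree \<phi>) (companion \<phi>) A \<and> U \<in> homs n (zdim L) (zmat L) A"
proof -
  note [simp] = carrier_matD[OF A] carrier_matD[OF T(1)] carrier_matD[OF T(2)]
  have "A * hcat T U = hcat (A * T) (A * U)" by (rule mult_hcat) simp_all
  moreover have "hcat T U * zmat (\<phi> # L) = hcat (T * companion \<phi>) (U * zmat L)"
    using hcat_mult_four_block_diag[OF T companion_carrier zmat_carrier] by simp
  moreover have "hcat (A * T) (A * U) = hcat (T * companion \<phi>) (U * zmat L) \<longleftrightarrow>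
      A * T = T * companion \<phi> \<and> A * U = U * zmat L"
    by (rule hcat_eq_iff[of _ n "degree \<phi>" _ _ "zdim L"])
      (rule carrier_matI; simp add: carrier_matD[OF zmat_carrier])+
  moreover have "hcat T U \<in> carrier_mat n (degree \<phi> + zdim L)" by (rule hcat_carrier[OF T])
  ultimately show ?thesis by (simp add: homs_def T)
qed

lemma bij_betw_homs_zmat_Cons:
  assumes A: "A \<in> carrier_mat n n"
  shows "bij_betw (\<lambda>(T, U). hcat T U)
    (homs n (degree \<phi>) (companion \<phi>) A \<times> homs n (zdim L) (zmat L) A)
    (homs n (zdim (\<phi> # L)) (zmat (\<phi> # L)) A)"
proof (rule bij_betw_imageI)
  show "inj_on (\<lambda>(T, U). hcat T U) (homs n (degree \<phi>) (companion \<phi>) A \<times> homs n (zdim L) (zmat L) A)"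
  proof (rule inj_onI, clarify)
    fix T U T' U'
    assume *: "T \<in> homs n (degree \<phi>) (companion \<phi>) A" "U \<in> homs n (zdim L) (zmat L) A"
      "T' \<in> homs n (degree \<phi>) (companion \<phi>) A" "U' \<in> homs n (zdim L) (zmat L) A" and eq: "hcat T U = hcat T' U'"
    from * have "T \<in> carrier_mat n (degree \<phi>)" "T' \<in> carrier_mat n (degree \<phi>)"
      "U \<in> carrier_mat n (zdim L)" "U' \<in> carrier_mat n (zdim L)" by (simp_all add: homs_def)
    from hcat_eq_iff[OF this] eq show "T = T' \<and> U = U'" by simp
  qed
  show "(\<lambda>(T, U). hcat T U) ` (homs n (degree \<phi>) (companion \<phi>) A \<times> homs n (zdim L) (zmat L) A)
      = homs n (zdim (\<phi> # L)) (zmat (\<phi> # L)) A"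
  proof (rule equalityI; rule subsetI)
    fix M assume "M \<in> (\<lambda>(T, U). hcat T U) ` (homs n (degree \<phi>) (companion \<phi>) A \<times> homs n (zdim L) (zmat L) A)"
    then obtain T U where M: "M = hcat T U" and TU: "T \<in> homs n (degree \<phi>) (companion \<phi>) A" "U \<in> homs n (zdim L) (zmat L) A"
      by auto
    from TU have "T \<in> carrier_mat n (degree \<phi>)" "U \<in> carrier_mat n (zdim L)" by (simp_all add: homs_def)
    from homs_zmat_Cons_iff[OF A this] TU M show "M \<in> homs n (zdim (\<phi> # L)) (zmat (\<phi> # L)) A" by simp
  next
    fix M assume M: "M \<in> homs n (zdim (\<phi> # L)) (zmat (\<phi> # L)) A"
    hence "M \<in> carrier_mat n (degree \<phi> + zdim L)" by (simp add: homs_def)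
    from hcat_surj[OF this] obtain T U where TU: "T \<in> carrier_mat n (degree \<phi>)" "U \<in> carrier_mat n (zdim L)" "M = hcat T U"
      by (elim bexE)
    thus "M \<in> (\<lambda>(T, U). hcat T U) ` (homs n (degree \<phi>) (companion \<phi>) A \<times> homs n (zdim L) (zmat L) A)"
      using homs_zmat_Cons_iff[OF A TU(1,2)] M by force
  qed
qed

text \<open>A homomorphism out of a direct sum is a tuple of homomorphisms out of the summands, and
  out of F[z]/(\<phi>) there is one for each element of \<open>kerp A \<phi>\<close>.\<close>

lemma card_homs_zmat:
  fixes A :: "'a::{field,finite} mat"
  assumes A: "A \<in> carrier_mat n n" and L: "\<And>\<phi>. \<phi> \<in> set L \<Longrightarrow> monic \<phi> \<and> degree \<phi> > 0"
  shows "card (homs n (zdim L) (zmat L) A) = (\<Prod>\<phi>\<leftarrow>L. card (kerp A \<phi>))"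
  using L
proof (induction L)
  case Nil
  have "homs n 0 (0\<^sub>m 0 0) A = {0\<^sub>m n 0}"
    using A by (auto simp: homs_def intro!: eq_matI)
  thus ?case by simp
next
  case (Cons \<phi> L)
  have "card (homs n (zdim (\<phi> # L)) (zmat (\<phi> # L)) A)
      = card (homs n (degree \<phi>) (companion \<phi>) A) * card (homs n (zdim L) (zmat L) A)"
    using bij_betw_same_card[OF bij_betw_homs_zmat_Cons[OF A, of \<phi> L]] by (simp only: card_cartesian_product)
  also have "card (homs n (degree \<phi>) (companion \<phi>) A) = card (kerp A \<phi>)"
    using bij_betw_same_card[OF bij_betw_companion_homs[OF A, of \<phi>]] Cons.prems[of \<phi>] by simp
  finally show ?case using Cons by simp
qed

text \<open>A summand for \<phi> itself is killed entirely by \<phi>; on a summand for another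
  polynomial \<phi> acts invertibly.\<close>

lemma card_kerp_zmat:
  fixes \<phi> :: "'a::{field,finite} poly"
  assumes \<phi>: "irreducible \<phi>" "monic \<phi>" and L: "\<And>\<psi>. \<psi> \<in> set L \<Longrightarrow> irreducible \<psi> \<and> monic \<psi> \<and> degree \<psi> > 0"
  shows "card (kerp (zmat L) \<phi>) = (CARD('a) ^ degree \<phi>) ^ count_list L \<phi>"
  using L
proof (induction L)
  case Nil
  have "v = 0\<^sub>v 0" if "v \<in> carrier_vec 0" for v :: "'a vec"
    using that by (intro eq_vecI) simp_all
  hence "kerp (zmat []) \<phi> \<subseteq> {0\<^sub>v 0 :: 'a vec}" by (auto simp: kerp_def)
  hence "kerp (zmat []) \<phi> = {0\<^sub>v 0 :: 'a vec}" using zero_in_kerp[of "zmat []" \<phi>] by auto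
  thus ?case by simp
next
  case (Cons \<psi> L)
  hence \<psi>: "irreducible \<psi>" "monic \<psi>" "degree \<psi> > 0" by simp_all
  have "card (kerp (companion \<psi>) \<phi>) = (if \<psi> = \<phi> then CARD('a) ^ degree \<phi> else 1)"
  proof (cases "\<psi> = \<phi>")
    case True
    thus ?thesis using card_kerp_zero[of "companion \<psi>" \<phi>] pmat_companion[of \<psi>] \<psi> by simp
  next
    case False
    then obtain B where "B * pmat (companion \<psi>) \<phi> = 1\<^sub>m (dim_row (companion \<psi>))" "dim_col B = dim_row (companion \<psi>)"
      using pmat_inverse_of_annihilator[of "companion \<psi>" \<psi> \<phi>] pmat_companion[of \<psi>] \<psi> \<phi> by auto
    thus ?thesis using False card_kerp_inverse[of "companion \<psi>" B \<phi>] by simp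
  qed
  thus ?case
    using Cons card_kerp_four_block_diag[OF companion_carrier[of \<psi>] zmat_carrier[of L], of \<phi>] by simp
qed

text \<open>The submodule generated by \<open>v\<close> is zero or simple, so it lies in the image
  of \<open>U\<close> or meets it in zero. Concretely: if a nonzero \<open>p\<close> of degree below
  \<open>degree \<phi>\<close> sends \<open>v\<close> into the image of \<open>U\<close>, a Bezout
  identity for \<open>p\<close> and \<phi> puts \<open>v\<close> itself there.\<close>

lemma inj_mat_hcat_iff:
  fixes \<phi> :: "'a::field poly"
  assumes A: "A \<in> carrier_mat n n" and \<phi>: "irreducible \<phi>" "monic \<phi>" "degree \<phi> > 0"
    and v: "v \<in> kerp A \<phi>" and U: "U \<in> carrier_mat n k" and z: "z \<in> carrier_mat k k" and AU: "A * U = U * z"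
  shows "hcat (krylov A (degree \<phi>) v) U \<in> inj_mat n (degree \<phi> + k) \<longleftrightarrow>
    U \<in> inj_mat n k \<and> v \<notin> (\<lambda>w. U *\<^sub>v w) ` carrier_vec k"
proof -
  let ?j = "degree \<phi>" and ?T = "krylov A (degree \<phi>) v"
  note [simp] = carrier_matD[OF A] carrier_matD[OF U] carrier_matD[OF z]
  have vc: "v \<in> carrier_vec n" and v0: "pmat A \<phi> *\<^sub>v v = 0\<^sub>v n" using v by (simp_all add: kerp_def)
  have T: "?T \<in> carrier_mat n ?j" by (rule krylov_carrier[OF A])
  note [simp] = carrier_matD[OF T]
  have TU: "hcat ?T U \<in> carrier_mat n (?j + k)" by (rule hcat_carrier[OF T U])
  have z0: "0\<^sub>v (?j + k) = (0\<^sub>v ?j @\<^sub>v 0\<^sub>v k :: 'a vec)" by (rule eq_vecI) simp_all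
  have T0: "?T *\<^sub>v 0\<^sub>v ?j = 0\<^sub>v n" by (rule eq_vecI) (simp_all add: scalar_prod_def)
  show ?thesis
  proof (intro iffI conjI notI)
    assume inj: "hcat ?T U \<in> inj_mat n (?j + k)"
    show "U \<in> inj_mat n k"
      unfolding inj_mat_def
    proof (intro CollectI conjI ballI impI U)
      fix w :: "'a vec" assume w: "w \<in> carrier_vec k" "U *\<^sub>v w = 0\<^sub>v n"
      have "hcat ?T U *\<^sub>v (0\<^sub>v ?j @\<^sub>v w) = 0\<^sub>v n"
        using hcat_mult_vec[OF T U zero_carrier_vec w(1)] T0 w(2) by simp
      moreover have "0\<^sub>v ?j @\<^sub>v w \<in> carrier_vec (?j + k)" using w by simp
      ultimately have "0\<^sub>v ?j @\<^sub>v w = 0\<^sub>v (?j + k)" using inj by (simp add: inj_mat_def)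
      thus "w = 0\<^sub>v k" unfolding z0 using append_vec_eq[OF zero_carrier_vec zero_carrier_vec] by blast
    qed
    assume "v \<in> (\<lambda>w. U *\<^sub>v w) ` carrier_vec k"
    then obtain w where w: "w \<in> carrier_vec k" "v = U *\<^sub>v w" by (elim imageE)
    have T1: "?T *\<^sub>v unit_vec ?j 0 = v"
      using \<phi>(3) vc by (intro eq_vecI) (simp_all add: krylov_def scalar_prod_right_unit[of 0 ?j])
    have "U *\<^sub>v (- w) = - (U *\<^sub>v w)"
      using w by (intro eq_vecI) (simp_all add: scalar_prod_def sum_negf)
    hence "hcat ?T U *\<^sub>v (unit_vec ?j 0 @\<^sub>v - w) = v + - v"
      using hcat_mult_vec[OF T U unit_vec_carrier[of ?j 0], of "- w"] T1 w by simp
    also have "\<dots> = 0\<^sub>v n" using vc by (intro eq_vecI) simp_all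
    finally have "hcat ?T U *\<^sub>v (unit_vec ?j 0 @\<^sub>v - w) = 0\<^sub>v n" .
    moreover have "unit_vec ?j 0 @\<^sub>v - w \<in> carrier_vec (?j + k)" using w by simp
    ultimately have "unit_vec ?j 0 @\<^sub>v - w = 0\<^sub>v (?j + k)" using inj by (simp add: inj_mat_def)
    hence "unit_vec ?j 0 = (0\<^sub>v ?j :: 'a vec)"
      unfolding z0 using append_vec_eq[OF unit_vec_carrier zero_carrier_vec] by blast
    hence "unit_vec ?j 0 $ 0 = (0\<^sub>v ?j :: 'a vec) $ 0" by simp
    thus False using \<phi>(3) by simp
  next
    assume *: "U \<in> inj_mat n k \<and> v \<notin> (\<lambda>w. U *\<^sub>v w) ` carrier_vec k"
    show "hcat ?T U \<in> inj_mat n (?j + k)"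
      unfolding inj_mat_def
    proof (intro CollectI conjI ballI impI TU)
      fix x :: "'a vec" assume x: "x \<in> carrier_vec (?j + k)" "hcat ?T U *\<^sub>v x = 0\<^sub>v n"
      define u where "u = vec_first x ?j"
      define w where "w = vec_last x k"
      have uw: "u \<in> carrier_vec ?j" "w \<in> carrier_vec k" "x = u @\<^sub>v w"
        using x(1) by (simp_all add: u_def w_def)
      have s: "?T *\<^sub>v u + U *\<^sub>v w = 0\<^sub>v n" using hcat_mult_vec[OF T U uw(1,2)] x(2) uw(3) by simp
      obtain p where p: "p = 0 \<longleftrightarrow> u = 0\<^sub>v ?j" "p \<noteq> 0 \<longrightarrow> degree p < ?j" "?T *\<^sub>v u = pmat A p *\<^sub>v v"
        using krylov_mult_vec[OF A vc uw(1)] by blast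
      have "p = 0"
      proof (rule ccontr)
        assume "p \<noteq> 0"
        hence "\<not> \<phi> dvd p" using p(2) dvd_imp_degree_le[of \<phi> p] by auto
        then obtain a b where ab: "a * p + b * \<phi> = 1" using bezout_irreducible[OF \<phi>(1)] by blast
        have c: "pmat A r *\<^sub>v y \<in> carrier_vec n" if "y \<in> carrier_vec n" for r y
          by (rule mult_mat_vec_carrier[OF pmat_carrier[OF A] that])
        have "v = pmat A (a * p + b * \<phi>) *\<^sub>v v" unfolding ab using vc by simp
        also have "\<dots> = (pmat A a * pmat A p) *\<^sub>v v + (pmat A b * pmat A \<phi>) *\<^sub>v v"
          unfolding pmat_add[of A, simplified] pmat_mult[of A, simplified]
          by (rule add_mult_distrib_mat_vec[of _ n n]; (rule carrier_matI)?; simp add: vc)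
        also have "(pmat A b * pmat A \<phi>) *\<^sub>v v = pmat A b *\<^sub>v 0\<^sub>v n"
          using vc v0 by (subst massoc_vec) simp_all
        also have "\<dots> = 0\<^sub>v n" by (rule eq_vecI) (simp_all add: scalar_prod_def)
        also have "(pmat A a * pmat A p) *\<^sub>v v = pmat A a *\<^sub>v (?T *\<^sub>v u)"
          unfolding p(3) using vc by (subst massoc_vec) simp_all
        also have "?T *\<^sub>v u = U *\<^sub>v (- w)"
        proof (rule eq_vecI)
          fix i assume "i < dim_vec (U *\<^sub>v - w)"
          hence i: "i < n" by simp
          have "(?T *\<^sub>v u + U *\<^sub>v w) $ i = 0" using i by (simp add: s)
          hence "(?T *\<^sub>v u) $ i = - (U *\<^sub>v w) $ i" using i by (simp add: eq_neg_iff_add_eq_0)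
          also have "\<dots> = (U *\<^sub>v (- w)) $ i" using i uw(2) by (simp add: scalar_prod_def sum_negf)
          finally show "(?T *\<^sub>v u) $ i = (U *\<^sub>v (- w)) $ i" .
        qed simp
        also have "pmat A a *\<^sub>v (U *\<^sub>v (- w)) = (pmat A a * U) *\<^sub>v (- w)"
          using uw(2) by (subst massoc_vec) simp_all
        also have "\<dots> = U *\<^sub>v (pmat z a *\<^sub>v (- w))"
          unfolding pmat_intertwine[OF A z U AU] using uw(2) by (subst massoc_vec) simp_all
        finally have "v = U *\<^sub>v (pmat z a *\<^sub>v (- w)) + 0\<^sub>v n" .
        also have "\<dots> = U *\<^sub>v (pmat z a *\<^sub>v (- w))" by (rule eq_vecI) simp_all
        finally have "v = U *\<^sub>v (pmat z a *\<^sub>v (- w))" .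
        moreover have "pmat z a *\<^sub>v (- w) \<in> carrier_vec k"
          by (rule mult_mat_vec_carrier[OF pmat_carrier[OF z]]) (use uw(2) in simp)
        ultimately show False using * by blast
      qed
      hence u: "u = 0\<^sub>v ?j" using p(1) by simp
      have "U *\<^sub>v w = 0\<^sub>v n + U *\<^sub>v w" by (rule eq_vecI) simp_all
      hence "U *\<^sub>v w = 0\<^sub>v n" using s unfolding u T0 by simp
      hence "w = 0\<^sub>v k" using * uw(2) by (simp add: inj_mat_def)
      thus "x = 0\<^sub>v (?j + k)" using u uw(3) z0 by simp
    qed
  qed
qed

text \<open>As \<open>U\<close> is injective and intertwines the actions, it identifies
  \<open>kerp z \<phi>\<close> with the part of \<open>kerp A \<phi>\<close> in its image.\<close>

lemma card_kerp_inter_image: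
  fixes U :: "'a::{field,finite} mat"
  assumes A: "A \<in> carrier_mat n n" and U: "U \<in> inj_mat n k" and z: "z \<in> carrier_mat k k" and AU: "A * U = U * z"
  shows "card (kerp A \<phi> - (\<lambda>w. U *\<^sub>v w) ` carrier_vec k) = card (kerp A \<phi>) - card (kerp z \<phi>)"
    "card (kerp z \<phi>) \<le> card (kerp A \<phi>)"
proof -
  note Uc = inj_mat_carrier[OF U]
  note [simp] = carrier_matD[OF A] carrier_matD[OF Uc] carrier_matD[OF z]
  have inj: "inj_on (\<lambda>w. U *\<^sub>v w) (carrier_vec k)"
  proof (rule inj_onI)
    fix x y :: "'a vec" assume xy: "x \<in> carrier_vec k" "y \<in> carrier_vec k" "U *\<^sub>v x = U *\<^sub>v y"
    obtain S where S: "S \<in> carrier_mat k n" "S * U = 1\<^sub>m k" using inj_mat_left_inverse[OF U] by (rule bexE)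
    have "(S * U) *\<^sub>v x = (S * U) *\<^sub>v y"
      using xy carrier_matD[OF S(1)] by (simp only: assoc_mult_mat_vec[OF S(1) Uc])
    thus "x = y" using xy S(2) by simp
  qed
  have mem: "U *\<^sub>v w \<in> kerp A \<phi> \<longleftrightarrow> w \<in> kerp z \<phi>" if w: "w \<in> carrier_vec k" for w
  proof -
    have "pmat A \<phi> *\<^sub>v (U *\<^sub>v w) = (pmat A \<phi> * U) *\<^sub>v w" using w by (subst massoc_vec) simp_all
    also have "\<dots> = U *\<^sub>v (pmat z \<phi> *\<^sub>v w)"
      unfolding pmat_intertwine[OF A z Uc AU] using w by (subst massoc_vec) simp_all
    finally have 1: "pmat A \<phi> *\<^sub>v (U *\<^sub>v w) = U *\<^sub>v (pmat z \<phi> *\<^sub>v w)" .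
    have c: "pmat z \<phi> *\<^sub>v w \<in> carrier_vec k" by (rule mult_mat_vec_carrier[OF pmat_carrier[OF z] w])
    have U0: "U *\<^sub>v 0\<^sub>v k = 0\<^sub>v n" by (rule eq_vecI) (simp_all add: scalar_prod_def)
    have "U *\<^sub>v (pmat z \<phi> *\<^sub>v w) = 0\<^sub>v n \<longleftrightarrow> pmat z \<phi> *\<^sub>v w = 0\<^sub>v k"
      using U c U0 by (auto simp: inj_mat_def)
    moreover have "U *\<^sub>v w \<in> carrier_vec n" by (rule mult_mat_vec_carrier[OF Uc w])
    ultimately show ?thesis using w by (simp add: kerp_def 1)
  qed
  have eq: "kerp A \<phi> \<inter> (\<lambda>w. U *\<^sub>v w) ` carrier_vec k = (\<lambda>w. U *\<^sub>v w) ` kerp z \<phi>"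
  proof -
    have "kerp z \<phi> \<subseteq> carrier_vec k" by (auto simp: kerp_def)
    thus ?thesis using mem by auto
  qed
  have c: "card ((\<lambda>w. U *\<^sub>v w) ` kerp z \<phi>) = card (kerp z \<phi>)"
    by (rule card_image) (rule inj_on_subset[OF inj], auto simp: kerp_def)
  show "card (kerp z \<phi>) \<le> card (kerp A \<phi>)"
    unfolding c[symmetric] eq[symmetric] by (rule card_mono) (simp_all add: finite_kerp)
  have "card (kerp A \<phi> - (\<lambda>w. U *\<^sub>v w) ` carrier_vec k) = card (kerp A \<phi>) - card (kerp A \<phi> \<inter> (\<lambda>w. U *\<^sub>v w) ` carrier_vec k)"
    by (rule card_Diff_subset_Int) (simp add: finite_kerp)
  thus "card (kerp A \<phi> - (\<lambda>w. U *\<^sub>v w) ` carrier_vec k) = card (kerp A \<phi>) - card (kerp z \<phi>)"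
    by (simp only: eq c)
qed

definition frames :: "nat \<Rightarrow> 'a::field poly list \<Rightarrow> 'a mat \<Rightarrow> 'a mat set" where
  "frames n L A = {T \<in> homs n (zdim L) (zmat L) A. T \<in> inj_mat n (zdim L)}"

text \<open>A frame for \<open>\<phi> # L\<close> is a frame \<open>U\<close> for \<open>L\<close>
  together with a vector of \<open>kerp A \<phi>\<close> outside the image of \<open>U\<close>, and
  the number of such vectors does not depend on \<open>U\<close>. The second claim lets the
  truncated subtraction be read in the reals.\<close>

lemma card_frames_Cons:
  fixes A :: "'a::{field,finite} mat"
  assumes A: "A \<in> carrier_mat n n" and \<phi>: "irreducible \<phi>" "monic \<phi>" "degree \<phi> > 0"
  shows "card (frames n (\<phi> # L) A) = card (frames n L A) * (card (kerp A \<phi>) - card (kerp (zmat L) \<phi>))"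
    "frames n L A \<noteq> {} \<Longrightarrow> card (kerp (zmat L) \<phi>) \<le> card (kerp A \<phi>)"
proof -
  let ?j = "degree \<phi>" and ?im = "\<lambda>U :: 'a mat. (\<lambda>w. U *\<^sub>v w) ` carrier_vec (zdim L)"
  let ?S = "SIGMA U:frames n L A. kerp A \<phi> - ?im U"
  have fr: "U \<in> carrier_mat n (zdim L)" "A * U = U * zmat L" "U \<in> inj_mat n (zdim L)" if "U \<in> frames n L A" for U
    using that by (simp_all add: frames_def homs_def)
  have bij0: "bij_betw (\<lambda>(U, v). hcat (krylov A ?j v) U)
      (homs n (zdim L) (zmat L) A \<times> kerp A \<phi>) (homs n (zdim (\<phi> # L)) (zmat (\<phi> # L)) A)"
  proof -
    have "bij_betw (\<lambda>(U, v). (krylov A ?j v, U)) (homs n (zdim L) (zmat L) A \<times> kerp A \<phi>)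
        (homs n ?j (companion \<phi>) A \<times> homs n (zdim L) (zmat L) A)"
    proof -
      note b = bij_betw_companion_homs[OF A \<phi>(2,3)]
      show ?thesis
        using bij_betw_imp_inj_on[OF b] bij_betw_imp_surj_on[OF b]
        unfolding bij_betw_def inj_on_def by (auto simp: image_iff) blast
    qed
    from bij_betw_trans[OF this bij_betw_homs_zmat_Cons[OF A]] show ?thesis
      by (simp only: comp_def case_prod_unfold fst_conv snd_conv)
  qed
  have iff: "hcat (krylov A ?j v) U \<in> inj_mat n (zdim (\<phi> # L)) \<longleftrightarrow> U \<in> inj_mat n (zdim L) \<and> v \<notin> ?im U"
    if "U \<in> homs n (zdim L) (zmat L) A" "v \<in> kerp A \<phi>" for U v
    using that inj_mat_hcat_iff[OF A \<phi>, of v U "zdim L" "zmat L"] zmat_carrier[of L] by (simp add: homs_def)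
  have "bij_betw (\<lambda>(U, v). hcat (krylov A ?j v) U) ?S (frames n (\<phi> # L) A)"
  proof (rule bij_betw_subset[OF bij0])
    show "?S \<subseteq> homs n (zdim L) (zmat L) A \<times> kerp A \<phi>" by (auto simp: frames_def)
    show "(\<lambda>(U, v). hcat (krylov A ?j v) U) ` ?S = frames n (\<phi> # L) A"
    proof (rule equalityI; rule subsetI)
      fix M assume "M \<in> (\<lambda>(U, v). hcat (krylov A ?j v) U) ` ?S"
      then obtain U v where M: "M = hcat (krylov A ?j v) U" and U: "U \<in> frames n L A" and v: "v \<in> kerp A \<phi>" "v \<notin> ?im U"
        by auto
      have Uh: "U \<in> homs n (zdim L) (zmat L) A" "U \<in> inj_mat n (zdim L)" using U by (simp_all add: frames_def)
      have "M \<in> homs n (zdim (\<phi> # L)) (zmat (\<phi> # L)) A"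
        using bij_betw_apply[OF bij0, of "(U, v)"] Uh v M by simp
      thus "M \<in> frames n (\<phi> # L) A"
        using iff[OF Uh(1) v(1)] Uh v M unfolding frames_def by simp
    next
      fix M assume M: "M \<in> frames n (\<phi> # L) A"
      hence "M \<in> homs n (zdim (\<phi> # L)) (zmat (\<phi> # L)) A" unfolding frames_def by simp
      then obtain U v where Uv: "U \<in> homs n (zdim L) (zmat L) A" "v \<in> kerp A \<phi>" "M = hcat (krylov A ?j v) U"
        unfolding bij_betw_imp_surj_on[OF bij0, symmetric] by (elim imageE SigmaE) (simp only: prod.case)
      have "M \<in> inj_mat n (zdim (\<phi> # L))" using M unfolding frames_def by simp
      hence "U \<in> inj_mat n (zdim L)" "v \<notin> ?im U" using iff[OF Uv(1,2)] Uv(3) by simp_all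
      hence "(U, v) \<in> ?S" using Uv by (simp add: frames_def)
      thus "M \<in> (\<lambda>(U, v). hcat (krylov A ?j v) U) ` ?S" using Uv(3) by (force intro: rev_image_eqI)
    qed
  qed
  hence "card (frames n (\<phi> # L) A) = card ?S" by (rule bij_betw_same_card[symmetric])
  also have "\<dots> = (\<Sum>U\<in>frames n L A. card (kerp A \<phi> - ?im U))"
  proof (rule card_SigmaI)
    show "finite (frames n L A)"
      by (rule finite_subset[OF _ finite_homs]) (auto simp: frames_def)
  qed (simp add: finite_kerp)
  also have "\<dots> = (\<Sum>U\<in>frames n L A. card (kerp A \<phi>) - card (kerp (zmat L) \<phi>))"
    by (intro sum.cong refl card_kerp_inter_image(1)[OF A fr(3) zmat_carrier fr(2)])
  finally show "card (frames n (\<phi> # L) A) = card (frames n L A) * (card (kerp A \<phi>) - card (kerp (zmat L) \<phi>))"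
    by simp
  assume "frames n L A \<noteq> {}"
  then obtain U where "U \<in> frames n L A" by blast
  from card_kerp_inter_image(2)[OF A fr(3) zmat_carrier fr(2), OF this this]
  show "card (kerp (zmat L) \<phi>) \<le> card (kerp A \<phi>)" .
qed

subsection \<open>Conjugate polynomials and invariant forms\<close>

lemma pmat_monom_Suc:
  assumes "dim_col A = dim_row A"
  shows "pmat A (monom 1 (Suc d)) = pmat A (monom 1 d) * A"
proof -
  have "monom 1 (Suc d) = monom 1 d * [:0, 1 :: 'a:]" by (simp add: monom_Suc)
  hence "pmat A (monom 1 (Suc d)) = pmat A (monom 1 d) * pmat A [:0, 1:]"
    by (simp only: pmat_mult[OF assms])
  also have "pmat A [:0, 1:] = A"
    by (simp add: assms mzero_r) (rule eq_matI; simp add: assms mone_r madd_zero_r)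
  finally show ?thesis .
qed

lemma pmat_reflect_poly:
  assumes A: "A \<in> carrier_mat n n" and B: "B \<in> carrier_mat n n" and AB: "A * B = 1\<^sub>m n"
  shows "p \<noteq> 0 \<Longrightarrow> pmat A (reflect_poly p) = pmat A (monom 1 (degree p)) * pmat B p"
proof (induction p)
  case 0
  thus ?case by simp
next
  note [simp] = carrier_matD[OF A] carrier_matD[OF B]
  case (pCons c p)
  show ?case
  proof (cases "p = 0")
    case True
    thus ?thesis using pCons.prems
      by (simp add: monom_0 mzero_r) (rule eq_matI; simp add: madd_zero_r msmult_r mone_r)
  next
    case False
    let ?M = "pmat A (monom 1 (Suc (degree p)))"
    have r: "reflect_poly (pCons c p) = reflect_poly p + Polynomial.smult c (monom 1 (Suc (degree p)))"
      using False by (intro poly_eqI) (auto simp: coeff_reflect_poly coeff_pCons Suc_diff_le split: nat.splits)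
    have "?M * (B * pmat B p) = pmat A (monom 1 (degree p)) * ((A * B) * pmat B p)"
      by (subst pmat_monom_Suc) (simp_all add: massoc)
    also have "\<dots> = pmat A (reflect_poly p)"
      using False by (simp add: AB mone_l pCons.IH)
    finally have "?M * (B * pmat B p) = pmat A (reflect_poly p)" .
    hence "?M * pmat B (pCons c p) = c \<cdot>\<^sub>m ?M + pmat A (reflect_poly p)"
      by (simp add: madd_distl msmult_r mone_r)
    moreover have "pmat A (reflect_poly (pCons c p)) = pmat A (reflect_poly p) + c \<cdot>\<^sub>m ?M"
      unfolding r by (simp only: pmat_add[of A, simplified] pmat_smult[of A, simplified])
    moreover have "pmat A (reflect_poly p) + c \<cdot>\<^sub>m ?M = c \<cdot>\<^sub>m ?M + pmat A (reflect_poly p)"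
      by (rule eq_matI) (simp_all del: pmat_pCons)
    ultimately show ?thesis using False by simp
  qed
qed

context herm
begin

sublocale frob: comm_ring_hom "\<lambda>x::'a. x ^ q"
  by unfold_locales (simp_all add: frob_add power_mult_distrib)

sublocale frob_poly: map_poly_comm_ring_hom "\<lambda>x::'a. x ^ q" ..

lemma degree_map_frob [simp]: "degree (map_poly (\<lambda>c::'a. c ^ q) \<phi>) = degree \<phi>"
  by (rule degree_map_poly) simp

lemma coeff_conj_poly:
  fixes \<phi> :: "'a poly"
  assumes "poly \<phi> 0 \<noteq> 0"
  shows "poly.coeff (conj_poly q \<phi>) i = (if i \<le> degree \<phi>
    then inverse (poly \<phi> 0 ^ q) * poly.coeff \<phi> (degree \<phi> - i) ^ q else 0)"
  using assms by (simp add: conj_poly_def coeff_reflect_poly coeff_map_poly)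

lemma degree_conj_poly:
  fixes \<phi> :: "'a poly"
  assumes "poly \<phi> 0 \<noteq> 0"
  shows "degree (conj_poly q \<phi>) = degree \<phi>"
proof -
  have "poly.coeff (map_poly (\<lambda>c. c ^ q) \<phi>) 0 \<noteq> 0"
    using assms by (simp add: coeff_map_poly poly_0_coeff_0)
  thus ?thesis using assms by (simp add: conj_poly_def)
qed

lemma conj_poly_mult: "conj_poly q (\<phi> * \<psi> :: 'a poly) = conj_poly q \<phi> * conj_poly q \<psi>"
  by (simp add: conj_poly_def frob_poly.hom_mult reflect_poly_mult power_mult_distrib mult.commute)

lemma monic_conj_poly:
  fixes \<phi> :: "'a poly"
  assumes "poly \<phi> 0 \<noteq> 0"
  shows "monic (conj_poly q \<phi>)"
  using assms by (simp add: coeff_conj_poly degree_conj_poly poly_0_coeff_0)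

lemma conj_poly_at_0:
  fixes \<phi> :: "'a poly"
  assumes "poly \<phi> 0 \<noteq> 0" "monic \<phi>"
  shows "poly (conj_poly q \<phi>) 0 = inverse (poly \<phi> 0 ^ q)"
  using assms by (simp add: poly_0_coeff_0[of "conj_poly q \<phi>"] coeff_conj_poly)

lemma conj_conj_poly:
  fixes \<phi> :: "'a poly"
  assumes 0: "poly \<phi> 0 \<noteq> 0" and m: "monic \<phi>"
  shows "conj_poly q (conj_poly q \<phi>) = \<phi>"
proof (rule poly_eqI)
  fix i
  have "poly (conj_poly q \<phi>) 0 \<noteq> 0" using 0 by (simp add: conj_poly_at_0[OF assms])
  thus "poly.coeff (conj_poly q (conj_poly q \<phi>)) i = poly.coeff \<phi> i"
    using 0 by (simp add: coeff_conj_poly degree_conj_poly conj_poly_at_0[OF assms] power_mult_distrib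
        power_inverse coeff_eq_0 not_le)
qed

text \<open>Conjugation is multiplicative and, for nonzero constant term, preserves degrees and is
  an involution on monic polynomials; so a factorisation of the conjugate comes from one of
  \<phi>.\<close>

lemma irreducible_conj_poly:
  fixes \<phi> :: "'a poly"
  assumes irr: "irreducible \<phi>" and 0: "poly \<phi> 0 \<noteq> 0" and m: "monic \<phi>"
  shows "irreducible (conj_poly q \<phi>)"
proof (rule Factorial_Ring.irreducibleI)
  have d: "degree \<phi> > 0"
    using irr unfolding Factorial_Ring.irreducible_def is_unit_iff_degree by (metis is_unit_iff_degree gr0I)
  have c0: "poly (conj_poly q \<phi>) 0 \<noteq> 0" using 0 by (simp add: conj_poly_at_0[OF 0 m])
  show nz: "conj_poly q \<phi> \<noteq> 0" using c0 by auto
  show "\<not> is_unit (conj_poly q \<phi>)" using nz d by (simp add: is_unit_iff_degree degree_conj_poly[OF 0])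
  fix a b assume ab: "conj_poly q \<phi> = a * b"
  hence a0: "poly a 0 \<noteq> 0" and b0: "poly b 0 \<noteq> 0" using c0 by auto
  have "\<phi> = conj_poly q a * conj_poly q b"
    using conj_conj_poly[OF 0 m] by (simp add: ab conj_poly_mult)
  hence "is_unit (conj_poly q a) \<or> is_unit (conj_poly q b)" using Factorial_Ring.irreducibleD[OF irr] by blast
  moreover have "is_unit p \<longleftrightarrow> is_unit (conj_poly q p)" if "poly p 0 \<noteq> 0" for p :: "'a poly"
  proof -
    have "p \<noteq> 0" using that by auto
    moreover have "conj_poly q p \<noteq> 0" using monic_conj_poly[OF that] by auto
    ultimately show ?thesis by (simp add: is_unit_iff_degree degree_conj_poly[OF that])
  qed
  ultimately show "is_unit a \<or> is_unit b" using a0 b0 by blast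
qed

lemma dag_pmat:
  assumes "A \<in> carrier_mat n n"
  shows "dag (pmat A p) = pmat (dag A) (map_poly (\<lambda>c. c ^ q) p)"
proof (induction p)
  note [simp] = carrier_matD[OF assms]
  case 0
  show ?case by simp
next
  note [simp] = carrier_matD[OF assms]
  case (pCons c p)
  let ?p = "map_poly (\<lambda>c. c ^ q) p"
  have "pmat (dag A) ?p * dag A = dag A * pmat (dag A) ?p"
    by (rule pmat_intertwine[of "dag A" n "dag A" n]) (simp_all add: dag_carrier[OF assms])
  moreover have "map_poly (\<lambda>c. c ^ q) (pCons c p) = pCons (c ^ q) ?p"
    by (rule Polynomial.map_poly_pCons) simp
  ultimately show ?case
    by (simp add: dag_simps pCons.IH)
qed

text \<open>\<open>D\<close> is the action of z on the conjugate dual of the module on which z acts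
  by \<open>C\<close>. The formula shows that the conjugate polynomial kills the dual whenever
  \<psi> kills the module.\<close>

lemma pmat_conj_poly:
  fixes \<psi> :: "'a poly"
  assumes C: "C \<in> carrier_mat n n" and D: "D \<in> carrier_mat n n" and DC: "D * dag C = 1\<^sub>m n" and "\<psi> \<noteq> 0"
  shows "pmat D (conj_poly q \<psi>)
    = inverse (poly \<psi> 0 ^ q) \<cdot>\<^sub>m (pmat D (monom 1 (degree \<psi>)) * dag (pmat C \<psi>))"
proof -
  note [simp] = carrier_matD[OF C] carrier_matD[OF D]
  have "map_poly (\<lambda>c. c ^ q) \<psi> \<noteq> 0" using assms(4) by (simp add: map_poly_eq_0_iff)
  from pmat_reflect_poly[OF D dag_carrier[OF C] DC this] show ?thesis
    by (simp add: conj_poly_def pmat_smult dag_pmat[OF C])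
qed

lemma ex_dag_inverse_companion:
  fixes \<psi> :: "'a poly"
  assumes \<psi>: "monic \<psi>" "degree \<psi> > 0" "poly \<psi> 0 \<noteq> 0"
  shows "\<exists>D\<in>carrier_mat (degree \<psi>) (degree \<psi>). D * dag (companion \<psi>) = 1\<^sub>m (degree \<psi>)"
proof -
  obtain c p where p: "\<psi> = pCons c p" by (cases \<psi>)
  hence c: "c \<noteq> 0" using \<psi>(3) by simp
  let ?C = "companion \<psi>" and ?j = "degree \<psi>"
  \<comment> \<open>The annihilation of the companion matrix C by \<open>pCons c p\<close> reads c +
    C p(C) = 0, so this is the inverse of C.\<close>
  define B where "B = - inverse c \<cdot>\<^sub>m pmat ?C p"
  have Bd[simp]: "dim_row B = ?j" "dim_col B = ?j" by (simp_all add: B_def)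
  have Cp: "c \<cdot>\<^sub>m 1\<^sub>m ?j + ?C * pmat ?C p = 0\<^sub>m ?j ?j"
    using pmat_companion[OF \<psi>(1,2)] pmat_pCons[of ?C c p] unfolding p[symmetric] by simp
  have e: "c * (1\<^sub>m ?j $$ (i, j)) + (?C * pmat ?C p) $$ (i, j) = 0" if ij: "i < ?j" "j < ?j" for i j
  proof -
    have "(c \<cdot>\<^sub>m 1\<^sub>m ?j + ?C * pmat ?C p) $$ (i, j) = 0\<^sub>m ?j ?j $$ (i, j)" by (simp only: Cp)
    moreover have "(c \<cdot>\<^sub>m 1\<^sub>m ?j + ?C * pmat ?C p) $$ (i, j) = c * (1\<^sub>m ?j $$ (i, j)) + (?C * pmat ?C p) $$ (i, j)"
      using ij by (subst index_add_mat(1)) (simp_all del: index_mult_mat(1))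
    ultimately show ?thesis using ij by simp
  qed
  have "?C * B = 1\<^sub>m ?j"
  proof (rule eq_matI)
    fix i j assume "i < dim_row (1\<^sub>m ?j :: 'a mat)" "j < dim_col (1\<^sub>m ?j :: 'a mat)"
    hence ij: "i < ?j" "j < ?j" by simp_all
    have "?C * B = - inverse c \<cdot>\<^sub>m (?C * pmat ?C p)" unfolding B_def by (rule msmult_r) simp
    hence "(?C * B) $$ (i, j) = - inverse c * (?C * pmat ?C p) $$ (i, j)"
      using ij by (simp del: index_mult_mat(1))
    also have "(?C * pmat ?C p) $$ (i, j) = - (c * 1\<^sub>m ?j $$ (i, j))"
      using e[OF ij] by (simp add: eq_neg_iff_add_eq_0 add.commute)
    finally show "(?C * B) $$ (i, j) = 1\<^sub>m ?j $$ (i, j)" using c by simp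
  qed simp_all
  hence "dag B * dag ?C = 1\<^sub>m ?j"
    using dag_mult[of ?C B] by simp
  moreover have "dag B \<in> carrier_mat ?j ?j" by (rule carrier_matI) simp_all
  ultimately show ?thesis by (rule bexI)
qed

lemma dag_four_block_diag:
  assumes "A \<in> carrier_mat a a" "B \<in> carrier_mat b b"
  shows "dag (four_block_mat A (0\<^sub>m a b) (0\<^sub>m b a) B) = four_block_mat (dag A) (0\<^sub>m a b) (0\<^sub>m b a) (dag B)"
  using carrier_matD[OF assms(1)] carrier_matD[OF assms(2)]
  by (intro eq_matI) simp_all

text \<open>\<open>D\<close> is the conjugate dual of the module of \<open>L\<close>. Its
  constituents are the conjugates of the members of \<open>L\<close>, which the kernel sizes
  record.\<close>

lemma ex_dag_inverse_zmat:
  fixes L :: "'a poly list"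
  assumes "\<And>\<psi>. \<psi> \<in> set L \<Longrightarrow> irreducible \<psi> \<and> monic \<psi> \<and> degree \<psi> > 0 \<and> poly \<psi> 0 \<noteq> 0"
  shows "\<exists>D\<in>carrier_mat (zdim L) (zdim L). D * dag (zmat L) = 1\<^sub>m (zdim L) \<and>
    (\<forall>\<phi>. irreducible \<phi> \<and> monic \<phi> \<longrightarrow>
      card (kerp D \<phi>) = (CARD('a) ^ degree \<phi>) ^ count_list (map (conj_poly q) L) \<phi>)"
  using assms
proof (induction L)
  case Nil
  have "card (kerp (0\<^sub>m 0 0) \<phi>) = 1" if "irreducible \<phi>" "monic \<phi>" for \<phi> :: "'a poly"
    using card_kerp_zmat[OF that, of "[]"] by simp
  moreover have "0\<^sub>m 0 0 * dag (zmat []) = (1\<^sub>m 0 :: 'a mat)" by (rule eq_matI) simp_all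
  ultimately show ?case by (intro bexI[of _ "0\<^sub>m 0 0"]) simp_all
next
  case (Cons \<psi> L)
  let ?j = "degree \<psi>" and ?k = "zdim L"
  have \<psi>: "irreducible \<psi>" "monic \<psi>" "?j > 0" "poly \<psi> 0 \<noteq> 0" using Cons.prems[of \<psi>] by simp_all
  obtain D where D: "D \<in> carrier_mat ?k ?k" "D * dag (zmat L) = 1\<^sub>m ?k"
    "\<And>\<phi>. irreducible \<phi> \<and> monic \<phi> \<Longrightarrow>
      card (kerp D \<phi>) = (CARD('a) ^ degree \<phi>) ^ count_list (map (conj_poly q) L) \<phi>"
    using Cons.IH Cons.prems by auto
  obtain E where E: "E \<in> carrier_mat ?j ?j" "E * dag (companion \<psi>) = 1\<^sub>m ?j"
    using ex_dag_inverse_companion[OF \<psi>(2-4)] by (rule bexE)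
  note [simp] = carrier_matD[OF D(1)] carrier_matD[OF E(1)]
  have "\<psi> \<noteq> 0" using \<psi>(4) by auto
  have z: "pmat E (conj_poly q \<psi>) = 0\<^sub>m ?j ?j"
    unfolding pmat_conj_poly[OF companion_carrier E \<open>\<psi> \<noteq> 0\<close>] pmat_companion[OF \<psi>(2,3)]
    by (simp add: mzero_r)
  have kE: "card (kerp E \<phi>) = (if conj_poly q \<psi> = \<phi> then CARD('a) ^ degree \<phi> else 1)"
    if \<phi>: "irreducible \<phi>" "monic \<phi>" for \<phi>
  proof (cases "conj_poly q \<psi> = \<phi>")
    case True
    thus ?thesis using card_kerp_zero[of E \<phi>] z \<psi> degree_conj_poly[of \<psi>] by auto
  next
    case False
    then obtain B where "B * pmat E \<phi> = 1\<^sub>m (dim_row E)" "dim_col B = dim_row E"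
      using pmat_inverse_of_annihilator[of E "conj_poly q \<psi>" \<phi>] z \<phi>
        irreducible_conj_poly[OF \<psi>(1,4,2)] monic_conj_poly[OF \<psi>(4)] by auto
    thus ?thesis using False card_kerp_inverse[of E B \<phi>] by simp
  qed
  let ?D = "four_block_mat E (0\<^sub>m ?j ?k) (0\<^sub>m ?k ?j) D"
  have "?D * dag (zmat (\<psi> # L)) = four_block_mat (E * dag (companion \<psi>)) (0\<^sub>m ?j ?k) (0\<^sub>m ?k ?j) (D * dag (zmat L))"
    using carrier_matD[OF zmat_carrier[of L]]
    by (simp add: dag_four_block_diag[OF companion_carrier zmat_carrier])
      (subst mult_four_block_mat[OF E(1) _ _ D(1) dag_carrier[OF companion_carrier] _ _ dag_carrier[OF zmat_carrier]];
       simp add: mzero_l mzero_r madd_zero_l madd_zero_r)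
  hence "?D * dag (zmat (\<psi> # L)) = 1\<^sub>m (zdim (\<psi> # L))"
    unfolding E(2) D(2) by simp
  moreover have "?D \<in> carrier_mat (zdim (\<psi> # L)) (zdim (\<psi> # L))" using D(1) E(1) by simp
  moreover have "card (kerp ?D \<phi>) = (CARD('a) ^ degree \<phi>) ^ count_list (map (conj_poly q) (\<psi> # L)) \<phi>"
    if \<phi>: "irreducible \<phi>" "monic \<phi>" for \<phi>
    using card_kerp_four_block_diag[OF E(1) D(1), of \<phi>] D(3) kE \<phi> by simp
  ultimately show ?case by (intro bexI[of _ ?D]) simp_all
qed

text \<open>For \<open>c\<close> not fixed by the involution, every sesquilinear form is uniquely \<open>G + c G'\<close> with
  Hermitian \<open>G\<close> and \<open>G'\<close>.\<close>

lemma card_inv_forms: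
  assumes z: "z \<in> carrier_mat k k" and D: "D \<in> carrier_mat k k" and Dz: "D * dag z = 1\<^sub>m k"
  shows "card (inv_forms k z) ^ 2 = card (homs k k z D)"
proof -
  note [simp] = carrier_matD[OF z] carrier_matD[OF D]
  have zD: "dag z * D = 1\<^sub>m k" by (rule mat_mult_left_right_inverse[OF D dag_carrier[OF z] Dz])
  \<comment> \<open>With \<open>D\<close> inverse to \<open>dag z\<close>, an invariant sesquilinear
    form is the same as a homomorphism from the module to its conjugate dual.\<close>
  have eq: "D * G = G * z \<longleftrightarrow> dag z * (G * z) = G" if "G \<in> carrier_mat k k" for G
  proof
    note [simp] = carrier_matD[OF that]
    assume "D * G = G * z"
    hence "dag z * (G * z) = (dag z * D) * G" by (simp add: massoc)
    thus "dag z * (G * z) = G" by (simp add: zD mone_l)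
  next
    note [simp] = carrier_matD[OF that]
    assume *: "dag z * (G * z) = G"
    have "D * (dag z * (G * z)) = (D * dag z) * (G * z)" by (simp add: massoc)
    hence "D * (dag z * (G * z)) = G * z" by (simp add: Dz mone_l)
    thus "D * G = G * z" by (simp only: *)
  qed
  obtain c :: 'a where c: "c ^ q \<noteq> c" using ex_frob_neq by blast
  \<comment> \<open>For \<open>B = G + c \<cdot>\<^sub>m G'\<close> the difference
    \<open>B - dag B\<close> is \<open>(c - c ^ q) \<cdot>\<^sub>m G'\<close>, so multiplication by
    \<open>e\<close> recovers \<open>G'\<close>.\<close>
  define e where "e = inverse (c - c ^ q)"
  have ec: "e * (c - c ^ q) = 1" using c by (simp add: e_def)
  have eq': "e ^ q = - e"
  proof -
    have "e ^ q = inverse (c ^ q - c)" by (simp add: e_def power_inverse frob_diff)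
    also have "\<dots> = - e" by (simp add: e_def inverse_minus_eq[symmetric] del: inverse_minus_eq)
    finally show ?thesis .
  qed
  define f where "f = (\<lambda>(G, G'). G + c \<cdot>\<^sub>m G' :: 'a mat)"
  define g where "g = (\<lambda>B. (B - c \<cdot>\<^sub>m (e \<cdot>\<^sub>m (B - dag B)), e \<cdot>\<^sub>m (B - dag B)))"
  have "bij_betw f (inv_forms k z \<times> inv_forms k z) (homs k k z D)"
  proof (rule bij_betwI[where g = g])
    show "f \<in> inv_forms k z \<times> inv_forms k z \<rightarrow> homs k k z D"
    proof (rule funcsetI, clarify)
      fix G G' assume G: "G \<in> inv_forms k z" "G' \<in> inv_forms k z"
      hence Gc: "G \<in> carrier_mat k k" "G' \<in> carrier_mat k k" by (simp_all add: inv_forms_def)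
      note [simp] = Gc[THEN carrier_matD(1)] Gc[THEN carrier_matD(2)]
      have Dd: "D * G = G * z" "D * G' = G' * z" using G eq[OF Gc(1)] eq[OF Gc(2)] by (simp_all add: inv_forms_def)
      have "G + c \<cdot>\<^sub>m G' \<in> carrier_mat k k" by (rule carrier_matI) simp_all
      thus "f (G, G') \<in> homs k k z D"
        by (simp add: f_def homs_def madd_distl madd_distr msmult_l msmult_r Dd)
    qed
    show "g \<in> homs k k z D \<rightarrow> inv_forms k z \<times> inv_forms k z"
    proof (rule funcsetI)
      fix B assume "B \<in> homs k k z D"
      hence Bc: "B \<in> carrier_mat k k" and B: "D * B = B * z" by (simp_all add: homs_def)
      note [simp] = carrier_matD[OF Bc]
      have B1: "dag z * (B * z) = B" using eq[OF Bc] B by simp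
      have B2: "dag z * (dag B * z) = dag B"
        using arg_cong[OF B1, of dag] by (simp add: dag_mult massoc)
      let ?G' = "e \<cdot>\<^sub>m (B - dag B)"
      let ?G = "B - c \<cdot>\<^sub>m ?G'"
      have "?G \<in> carrier_mat k k" "?G' \<in> carrier_mat k k" by (rule carrier_matI; simp)+
      moreover have "dag z * (?G' * z) = ?G'"
        by (simp add: msmult_l msmult_r mminus_distl mminus_distr B1 B2)
      moreover from this have "dag z * (?G * z) = ?G"
        by (simp add: msmult_l msmult_r mminus_distl mminus_distr B1 B2)
      moreover have G'h: "dag ?G' = ?G'"
        by (simp add: dag_smult dag_minus eq') (rule eq_matI; simp add: algebra_simps)
      moreover have "dag ?G = ?G"
      proof -
        have "dag ?G = dag B - c ^ q \<cdot>\<^sub>m dag ?G'"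
          by (subst dag_minus, simp, simp, subst dag_smult, rule refl)
        hence "dag ?G = dag B - c ^ q \<cdot>\<^sub>m ?G'" by (simp only: G'h)
        also have "\<dots> = ?G"
        proof (rule eq_matI)
          fix i j assume "i < dim_row ?G" "j < dim_col ?G"
          hence ij: "i < k" "j < k" by simp_all
          have "(dag B - c ^ q \<cdot>\<^sub>m ?G') $$ (i, j) - ?G $$ (i, j)
             = (e * (c - c ^ q) - 1) * (B $$ (i, j) - dag B $$ (i, j))"
            using ij by (simp add: algebra_simps)
          thus "(dag B - c ^ q \<cdot>\<^sub>m ?G') $$ (i, j) = ?G $$ (i, j)" by (simp add: ec)
        qed simp_all
        finally show ?thesis .
      qed
      ultimately show "g B \<in> inv_forms k z \<times> inv_forms k z"
        unfolding g_def inv_forms_def by blast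
    qed
    show "g (f x) = x" if "x \<in> inv_forms k z \<times> inv_forms k z" for x
    proof -
      obtain G G' where x: "x = (G, G')" by (cases x)
      have Gc: "G \<in> carrier_mat k k" "G' \<in> carrier_mat k k" and Gh: "dag G = G" "dag G' = G'"
        using that by (simp_all add: x inv_forms_def)
      note [simp] = Gc[THEN carrier_matD(1)] Gc[THEN carrier_matD(2)]
      let ?B = "G + c \<cdot>\<^sub>m G'"
      have 1: "e \<cdot>\<^sub>m (?B - dag ?B) = G'"
      proof (rule eq_matI)
        fix i j assume "i < dim_row G'" "j < dim_col G'"
        hence ij: "i < k" "j < k" by simp_all
        have "(e \<cdot>\<^sub>m (?B - dag ?B)) $$ (i, j) = (e * (c - c ^ q)) * G' $$ (i, j)"
          using ij by (simp add: dag_add dag_smult Gh algebra_simps del: dag_index)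
        thus "(e \<cdot>\<^sub>m (?B - dag ?B)) $$ (i, j) = G' $$ (i, j)" by (simp only: ec mult_1)
      qed simp_all
      have "?B - c \<cdot>\<^sub>m G' = G" by (rule eq_matI) simp_all
      thus ?thesis using 1 by (simp add: x f_def g_def)
    qed
    show "f (g B) = B" if "B \<in> homs k k z D" for B
    proof -
      have "B \<in> carrier_mat k k" using that by (simp add: homs_def)
      note [simp] = carrier_matD[OF this]
      show ?thesis unfolding f_def g_def prod.case by (rule eq_matI) simp_all
    qed
  qed
  from bij_betw_same_card[OF this] show ?thesis
    by (simp add: card_cartesian_product power2_eq_square)
qed

end

subsection \<open>Joint moments of the kernel sizes\<close>

lemma count_list_replicate: "count_list (replicate k y) x = (if x = y then k else 0)"
  by (induction k) auto

lemma ex_list_with_counts: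
  assumes "finite P"
  shows "\<exists>L. set L \<subseteq> P \<and> (\<forall>x\<in>P. count_list L x = m x)"
  using assms
proof (induction P)
  case (insert y P)
  then obtain L where L: "set L \<subseteq> P" "\<forall>x\<in>P. count_list L x = m x" by blast
  have "count_list L y = 0" using L(1) insert.hyps by (intro count_notin) auto
  thus ?case using L insert.hyps
    by (intro exI[of _ "replicate (m y) y @ L"]) (auto simp: count_list_replicate)
qed simp

lemma prod_list_eq_prod_count:
  fixes f :: "'b \<Rightarrow> 'c::comm_monoid_mult"
  assumes "finite P" "set L \<subseteq> P"
  shows "(\<Prod>x\<leftarrow>L. f x) = (\<Prod>x\<in>P. f x ^ count_list L x)"
  using assms(2)
proof (induction L)
  case (Cons y L)
  have "(\<Prod>x\<in>P. f x ^ count_list (y # L) x) = (\<Prod>x\<in>P. (if x = y then f y else 1) * f x ^ count_list L x)"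
    by (intro prod.cong) auto
  also have "\<dots> = f y * (\<Prod>x\<in>P. f x ^ count_list L x)"
    using Cons.prems assms(1) by (simp add: prod.distrib)
  finally show ?case using Cons by simp
qed simp

definition nonzero_irreducible :: "'a::field poly \<Rightarrow> bool" where
  "nonzero_irreducible \<phi> \<longleftrightarrow> irreducible \<phi> \<and> monic \<phi> \<and> degree \<phi> > 0 \<and> poly \<phi> 0 \<noteq> 0"

text \<open>Iterating \<open>card_frames_Cons\<close>: with Q the order of F[z]/(\<phi>), a copy of
  \<phi> added after \<open>i\<close> others must avoid the \<open>Q ^ i\<close> kernel vectors
  spanned by those. The products are q-analogues of falling factorials of the dimension of
  \<open>kerp A \<phi>\<close>.\<close>

lemma card_frames:
  fixes A :: "'a::{field,finite} mat"
  assumes A: "A \<in> carrier_mat n n" and P: "finite P" "\<And>\<phi>. \<phi> \<in> P \<Longrightarrow> nonzero_irreducible \<phi>"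
  shows "set L \<subseteq> P \<Longrightarrow> real (card (frames n L A))
    = (\<Prod>\<phi>\<in>P. \<Prod>i<count_list L \<phi>. real (card (kerp A \<phi>)) - real (CARD('a) ^ degree \<phi>) ^ i)"
proof (induction L)
  case Nil
  have "0\<^sub>m n 0 \<in> inj_mat n 0"
    by (rule inj_matI[of _ _ _ "0\<^sub>m 0 n"]) (simp_all, rule eq_matI, simp_all)
  moreover have "A * 0\<^sub>m n 0 = 0\<^sub>m n 0 * 0\<^sub>m 0 0" using A by (intro eq_matI) simp_all
  moreover have "T = 0\<^sub>m n 0" if "T \<in> carrier_mat n 0" for T :: "'a mat"
    using that by (intro eq_matI) simp_all
  ultimately have "frames n [] A = {0\<^sub>m n 0}"
    unfolding frames_def homs_def by (auto simp del: carrier_matD)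
  thus ?case by simp
next
  case (Cons \<psi> L)
  have \<psi>: "irreducible \<psi>" "monic \<psi>" "degree \<psi> > 0" "\<psi> \<in> P"
    using P(2)[of \<psi>] Cons.prems by (auto simp: nonzero_irreducible_def)
  have L: "set L \<subseteq> P" using Cons.prems by simp
  let ?N = "\<lambda>\<phi>. real (card (kerp A \<phi>))" and ?Q = "\<lambda>\<phi>. real (CARD('a) ^ degree \<phi>)"
  have kz: "card (kerp (zmat L) \<psi>) = (CARD('a) ^ degree \<psi>) ^ count_list L \<psi>"
    by (rule card_kerp_zmat[OF \<psi>(1,2)]) (use L P(2) in \<open>auto simp: nonzero_irreducible_def\<close>)
  have "real (card (frames n (\<psi> # L) A)) = real (card (frames n L A)) * (?N \<psi> - ?Q \<psi> ^ count_list L \<psi>)"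
  proof (cases "frames n L A = {}")
    case True
    thus ?thesis using card_frames_Cons(1)[OF A \<psi>(1-3), of L] by simp
  next
    case False
    from card_frames_Cons(2)[OF A \<psi>(1-3) this] show ?thesis
      unfolding card_frames_Cons(1)[OF A \<psi>(1-3)] kz by (simp add: of_nat_diff)
  qed
  also have "\<dots> = (\<Prod>\<phi>\<in>P. (if \<phi> = \<psi> then ?N \<psi> - ?Q \<psi> ^ count_list L \<psi> else 1) *
      (\<Prod>i<count_list L \<phi>. ?N \<phi> - ?Q \<phi> ^ i))"
    using \<psi>(4) P(1) by (simp add: prod.distrib Cons.IH[OF L] mult.commute)
  also have "\<dots> = (\<Prod>\<phi>\<in>P. \<Prod>i<count_list (\<psi> # L) \<phi>. ?N \<phi> - ?Q \<phi> ^ i)"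
    by (intro prod.cong) (simp_all add: mult.commute)
  finally show ?case .
qed

text \<open>Shown without building a vector space over F[z]/(\<phi>): if the size were no power of
  the order Q of that field, every frame of copies of \<phi> could be extended, and all powers of Q
  would be bounded by the size of one kernel.\<close>

lemma card_kerp_eq_power:
  fixes A :: "'a::{field,finite} mat"
  assumes A: "A \<in> carrier_mat n n" and \<phi>: "nonzero_irreducible \<phi>"
  shows "\<exists>m. card (kerp A \<phi>) = (CARD('a) ^ degree \<phi>) ^ m"
proof (rule ccontr)
  assume ne: "\<nexists>m. card (kerp A \<phi>) = (CARD('a) ^ degree \<phi>) ^ m"
  let ?Q = "CARD('a) ^ degree \<phi>"
  have CARD: "CARD('a) > 1"
  proof -
    have "card {0, 1 :: 'a} \<le> CARD('a)" by (rule card_mono) simp_all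
    thus ?thesis by simp
  qed
  have d: "irreducible \<phi>" "monic \<phi>" "degree \<phi> > 0" using \<phi> by (simp_all add: nonzero_irreducible_def)
  have kz: "card (kerp (zmat (replicate m \<phi>)) \<phi>) = ?Q ^ m" for m
    by (subst card_kerp_zmat[OF d(1,2)]) (use d in \<open>auto simp: count_list_replicate\<close>)
  have "frames n (replicate m \<phi>) A \<noteq> {}" for m
  proof (induction m)
    case 0
    have "real (card (frames n [] A)) = 1" using card_frames[OF A, of "{}" "[]"] by simp
    thus ?case by auto
  next
    case (Suc m)
    hence "?Q ^ m \<le> card (kerp A \<phi>)" using card_frames_Cons(2)[OF A d Suc] kz by simp
    moreover have "card (kerp A \<phi>) \<noteq> ?Q ^ m" using ne by blast
    ultimately have "?Q ^ m < card (kerp A \<phi>)" by simp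
    moreover have "finite (frames n (replicate m \<phi>) A)"
      by (rule finite_subset[OF _ finite_homs]) (auto simp: frames_def)
    hence "card (frames n (replicate m \<phi>) A) > 0" using Suc by (simp add: card_gt_0_iff)
    ultimately have "card (frames n (replicate (Suc m) \<phi>) A) > 0"
      unfolding replicate_Suc card_frames_Cons(1)[OF A d] kz by simp
    thus ?case by (auto simp only: card_gt_0_iff)
  qed
  hence "?Q ^ m \<le> card (kerp A \<phi>)" for m
    using card_frames_Cons(2)[OF A d, of "replicate m \<phi>"] kz by simp
  hence "?Q ^ Suc (card (kerp A \<phi>)) \<le> card (kerp A \<phi>)" by blast
  moreover have "?Q > 1" using CARD d(3) by (rule one_less_power)
  hence "Suc (card (kerp A \<phi>)) < ?Q ^ Suc (card (kerp A \<phi>))"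
    using power_gt_expt[of ?Q "Suc (card (kerp A \<phi>))"] by simp
  ultimately show False by simp
qed

context herm
begin

lemma frames_eq_hom_frames: "frames n L A = hom_frames n (zdim L) (zmat L) A"
  by (auto simp: frames_def homs_def hom_frames_def inj_mat_def)

definition self_conj :: "'a poly \<Rightarrow> bool" where
  "self_conj \<phi> \<longleftrightarrow> conj_poly q \<phi> = \<phi>"

text \<open>By \<open>card_inv_forms\<close> the square of the number counts homomorphisms into the
  conjugate dual \<open>D\<close>. Distinct members of \<open>P\<close> are never conjugate, so a
  member that is not self-conjugate is no constituent of \<open>D\<close> and contributes 1, whereas
  a self-conjugate one of multiplicity \<open>m\<close> contributes
  \<open>CARD('a) ^ (degree \<phi> * m\<^sup>2)\<close>.\<close>

lemma card_inv_forms_zmat: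
  assumes P: "finite P" "\<And>\<phi>. \<phi> \<in> P \<Longrightarrow> nonzero_irreducible \<phi>"
    and rep: "\<And>\<phi> \<psi>. \<phi> \<in> P \<Longrightarrow> \<psi> \<in> P \<Longrightarrow> conj_poly q \<phi> = \<psi> \<Longrightarrow> \<phi> = \<psi>"
    and L: "set L \<subseteq> P"
  shows "card (inv_forms (zdim L) (zmat L))
    = (\<Prod>\<phi>\<in>P. if self_conj \<phi> then q ^ (degree \<phi> * (count_list L \<phi>)\<^sup>2) else 1)" (is "?c = ?r")
    "\<exists>zi\<in>carrier_mat (zdim L) (zdim L). zmat L * zi = 1\<^sub>m (zdim L)"
proof -
  have Li: "irreducible \<phi>" "monic \<phi>" "degree \<phi> > 0" "poly \<phi> 0 \<noteq> 0" if "\<phi> \<in> set L" for \<phi>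
    using that L P(2)[of \<phi>] by (auto simp: nonzero_irreducible_def)
  obtain D where D: "D \<in> carrier_mat (zdim L) (zdim L)" "D * dag (zmat L) = 1\<^sub>m (zdim L)"
    "\<And>\<phi>. irreducible \<phi> \<and> monic \<phi> \<Longrightarrow>
      card (kerp D \<phi>) = (CARD('a) ^ degree \<phi>) ^ count_list (map (conj_poly q) L) \<phi>"
    using ex_dag_inverse_zmat[of L] Li by auto
  note [simp] = carrier_matD[OF D(1)] carrier_matD[OF zmat_carrier[of L]]
  have "zmat L * dag D = 1\<^sub>m (zdim L)"
    using arg_cong[OF D(2), of dag] by (simp add: dag_mult)
  thus "\<exists>zi\<in>carrier_mat (zdim L) (zdim L). zmat L * zi = 1\<^sub>m (zdim L)"
    by (rule bexI) (rule dag_carrier[OF D(1)])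
  have cl: "count_list (map (conj_poly q) L) \<phi> = (if self_conj \<phi> then count_list L \<phi> else 0)" if \<phi>: "\<phi> \<in> P" for \<phi>
    using L
  proof (induction L)
    case (Cons \<psi> L)
    have "conj_poly q \<psi> = \<phi> \<longleftrightarrow> self_conj \<phi> \<and> \<psi> = \<phi>"
      using rep[of \<psi> \<phi>] Cons.prems \<phi> by (auto simp: self_conj_def)
    thus ?case using Cons by auto
  qed simp
  have "?c ^ 2 = card (homs (zdim L) (zdim L) (zmat L) D)"
    by (rule card_inv_forms[OF zmat_carrier D(1,2)])
  also have "\<dots> = (\<Prod>\<phi>\<leftarrow>L. card (kerp D \<phi>))"
    by (rule card_homs_zmat[OF D(1)]) (use Li in blast)
  also have "\<dots> = (\<Prod>\<phi>\<in>P. card (kerp D \<phi>) ^ count_list L \<phi>)"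
    by (rule prod_list_eq_prod_count[OF P(1) L])
  also have "\<dots> = (\<Prod>\<phi>\<in>P. (if self_conj \<phi> then q ^ (degree \<phi> * (count_list L \<phi>)\<^sup>2) else 1) ^ 2)"
  proof (rule prod.cong[OF refl])
    fix \<phi> assume \<phi>: "\<phi> \<in> P"
    hence "card (kerp D \<phi>) = (CARD('a) ^ degree \<phi>) ^ (if self_conj \<phi> then count_list L \<phi> else 0)"
      using D(3)[of \<phi>] P(2)[OF \<phi>] cl[OF \<phi>] by (simp add: nonzero_irreducible_def)
    thus "card (kerp D \<phi>) ^ count_list L \<phi> = (if self_conj \<phi> then q ^ (degree \<phi> * (count_list L \<phi>)\<^sup>2) else 1) ^ 2"
      by (simp add: card_q power2_eq_square mult_ac flip: power_mult power_mult_distrib)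
  qed
  also have "\<dots> = ?r ^ 2" by (simp add: prod_power_distrib)
  finally show "?c = ?r" by (rule power_eq_imp_eq_base) simp_all
qed

text \<open>The multiplicities \<open>m\<close> are realised by a list, and
  \<open>sum_hom_frames\<close> is applied to its module.\<close>

theorem joint_moments:
  assumes P: "finite P" "\<And>\<phi>. \<phi> \<in> P \<Longrightarrow> nonzero_irreducible \<phi>"
    and rep: "\<And>\<phi> \<psi>. \<phi> \<in> P \<Longrightarrow> \<psi> \<in> P \<Longrightarrow> conj_poly q \<phi> = \<psi> \<Longrightarrow> \<phi> = \<psi>"
  shows "\<exists>n0. \<forall>n\<ge>n0. \<forall>C\<in>rcosets\<^bsub>GU q n\<^esub> (SU q n :: 'a mat set).
    (\<Sum>A\<in>C. \<Prod>\<phi>\<in>P. \<Prod>i<m \<phi>. real (card (kerp A \<phi>)) - real (q ^ (2 * degree \<phi>)) ^ i)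
     = real (card C) * (\<Prod>\<phi>\<in>P. if self_conj \<phi> then real q ^ (degree \<phi> * (m \<phi>)\<^sup>2) else 1)"
proof -
  obtain L where L: "set L \<subseteq> P" "\<And>\<phi>. \<phi> \<in> P \<Longrightarrow> count_list L \<phi> = m \<phi>"
    using ex_list_with_counts[OF P(1)] by blast
  obtain zi where zi: "zi \<in> carrier_mat (zdim L) (zdim L)" "zmat L * zi = 1\<^sub>m (zdim L)"
    using card_inv_forms_zmat(2)[OF P rep L(1)] by blast
  show ?thesis
  \<comment> \<open>The \<open>13\<close> ensures both \<open>n > 12 * zdim L\<close> and, even for
    the zero module, \<open>n > 12\<close>.\<close>
  proof (intro exI[of _ "12 * zdim L + 13"] allI impI ballI)
    fix n C assume n: "12 * zdim L + 13 \<le> n" and C: "C \<in> rcosets\<^bsub>GU q n\<^esub> (SU q n :: 'a mat set)"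
    obtain g where g: "g \<in> unitary n" and Cg: "C = (\<lambda>s. s * g) ` special n"
      using rcosets_SU[OF C] by blast
    have inj: "inj_on (\<lambda>s. s * g) (special n)"
    proof (rule inj_on_inverseI[of _ "\<lambda>M. M * dag g"])
      fix s assume "s \<in> special n"
      note [simp] = unitary_dim[OF special_unitary[OF this]] unitary_dim[OF g]
      show "s * g * dag g = s" by (simp add: massoc unitary_mult_dag[OF g] mone_r)
    qed
    have card_inv: "card (inv_forms (zdim L) (zmat L))
      = (\<Prod>\<phi>\<in>P. if self_conj \<phi> then q ^ (degree \<phi> * (count_list L \<phi>)\<^sup>2) else 1)"
      by (rule card_inv_forms_zmat(1)[OF P rep L(1)])
    have cC: "card C = card (special n)" unfolding Cg by (rule card_image[OF inj])
    have Ac: "A \<in> carrier_mat n n" if "A \<in> C" for A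
      using that g by (auto simp: Cg intro: unitary_carrier unitary_mult special_unitary)
    have "(\<Sum>A\<in>C. \<Prod>\<phi>\<in>P. \<Prod>i<m \<phi>. real (card (kerp A \<phi>)) - real (q ^ (2 * degree \<phi>)) ^ i)
        = (\<Sum>A\<in>C. real (card (hom_frames n (zdim L) (zmat L) A)))"
    proof (rule sum.cong[OF refl])
      fix A assume "A \<in> C"
      show "(\<Prod>\<phi>\<in>P. \<Prod>i<m \<phi>. real (card (kerp A \<phi>)) - real (q ^ (2 * degree \<phi>)) ^ i)
          = real (card (hom_frames n (zdim L) (zmat L) A))"
      proof -
        have "real (card (frames n L A)) = (\<Prod>\<phi>\<in>P. \<Prod>i<count_list L \<phi>.
            real (card (kerp A \<phi>)) - real (CARD('a) ^ degree \<phi>) ^ i)"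
          by (rule card_frames[OF Ac[OF \<open>A \<in> C\<close>] P L(1)])
        also have "\<dots> = (\<Prod>\<phi>\<in>P. \<Prod>i<m \<phi>. real (card (kerp A \<phi>)) - real (q ^ (2 * degree \<phi>)) ^ i)"
          by (intro prod.cong) (simp_all add: L(2) card_q power_mult)
        finally show ?thesis by (simp only: frames_eq_hom_frames)
      qed
    qed
    also have "\<dots> = real (card (special n) * card (inv_forms (zdim L) (zmat L)))"
      unfolding Cg of_nat_sum[symmetric]
      by (subst sum_hom_frames[OF _ _ g zmat_carrier zi]) (use n in simp_all)
    also have "\<dots> = real (card C) * (\<Prod>\<phi>\<in>P. if self_conj \<phi> then real q ^ (degree \<phi> * (m \<phi>)\<^sup>2) else 1)"
      unfolding card_inv cC
      by (simp add: L(2) if_distrib[of real] cong: if_cong prod.cong)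
    finally show "(\<Sum>A\<in>C. \<Prod>\<phi>\<in>P. \<Prod>i<m \<phi>. real (card (kerp A \<phi>)) - real (q ^ (2 * degree \<phi>)) ^ i)
     = real (card C) * (\<Prod>\<phi>\<in>P. if self_conj \<phi> then real q ^ (degree \<phi> * (m \<phi>)\<^sup>2) else 1)" .
  qed
qed

end

subsection \<open>Truncated inversion with error bounds\<close>

context notes power_Suc [simp del] begin

text \<open>For \<open>N = Q ^ x\<close> this is \<open>Q ^ (m choose 2)\<close> times the Gaussian binomial coefficient of \<open>x\<close>
  over \<open>m\<close>.\<close>

definition binom_moment :: "real \<Rightarrow> nat \<Rightarrow> real \<Rightarrow> real" where
  "binom_moment Q m N = (\<Prod>i<m. N - Q ^ i) / (\<Prod>i<m. Q ^ Suc i - 1)"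

text \<open>A q-analogue of the identity that the sum over m <= K of (-1)^m binom(x, m) is (-1)^K
  binom(x - 1, K). Each new term is \<open>- t\<close> times the preceding partial sum, so the
  product acquires the factor \<open>1 - t\<close>.\<close>

lemma sum_binom_moment:
  assumes Q: "Q > 1"
  shows "(\<Sum>m\<le>K. (-1) ^ m * binom_moment Q m N) = (\<Prod>i<K. (Q ^ Suc i - N) / (Q ^ Suc i - 1))"
proof (induction K)
  case 0
  show ?case by (simp add: binom_moment_def)
next
  case (Suc K)
  define t where "t = (N - 1) / (Q ^ Suc K - 1)"
  have nz: "Q ^ Suc K - 1 \<noteq> 0" using one_less_power[OF Q, of "Suc K"] by simp
  define S :: real where "S = (-1) ^ K"
  have S: "S * S = 1" by (simp add: S_def flip: power_mult_distrib)
  let ?A = "\<Prod>i<K. Q ^ Suc i - N" and ?B = "\<Prod>i<K. Q ^ Suc i - 1"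
  have "(\<Prod>i<Suc K. N - Q ^ i) = (N - 1) * (\<Prod>i<K. N - Q ^ Suc i)"
    by (simp add: prod.lessThan_Suc_shift del: prod.lessThan_Suc)
  also have "(\<Prod>i<K. N - Q ^ Suc i) = (\<Prod>i<K. (-1) * (Q ^ Suc i - N))"
    by (intro prod.cong) simp_all
  also have "\<dots> = S * ?A" unfolding S_def by (subst prod.distrib) simp
  finally have "(-1) ^ Suc K * binom_moment Q (Suc K) N = - S * ((N - 1) * (S * ?A) / (?B * (Q ^ Suc K - 1)))"
    by (simp add: binom_moment_def S_def power_Suc)
  also have "\<dots> = - (S * S) * t * (?A / ?B)"
    by (simp add: t_def divide_inverse mult_ac)
  finally have e: "(-1) ^ Suc K * binom_moment Q (Suc K) N = - t * (?A / ?B)"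
    by (simp add: S)
  have "(\<Sum>m\<le>Suc K. (-1) ^ m * binom_moment Q m N) = ?A / ?B + - t * (?A / ?B)"
    unfolding sum.atMost_Suc e Suc by (simp add: prod_dividef)
  also have "\<dots> = (?A / ?B) * (1 - t)" by (simp only: right_diff_distrib mult_1_right) (simp add: mult.commute[of t])
  also have "1 - t = (Q ^ Suc K - N) / (Q ^ Suc K - 1)"
    using nz by (simp add: t_def field_simps)
  finally show ?case by (simp add: prod_dividef)
qed

lemma binom_moment_0 [simp]: "binom_moment Q 0 N = 1"
  by (simp add: binom_moment_def)

lemma binom_moment_nonneg:
  assumes Q: "Q > 1"
  shows "binom_moment Q m (Q ^ x) \<ge> 0"
proof -
  have d: "(\<Prod>i<m. Q ^ Suc i - 1) \<ge> 0"
    by (intro prod_nonneg) (use one_le_power[of Q] Q in \<open>simp add: less_imp_le del: power_Suc\<close>)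
  have "(\<Prod>i<m. Q ^ x - Q ^ i) \<ge> 0"
  proof (cases "m \<le> x")
    case True
    thus ?thesis using Q by (intro prod_nonneg) (simp add: power_increasing)
  next
    case False
    hence "(\<Prod>i<m. Q ^ x - Q ^ i) = 0" by (intro prod_zero) auto
    thus ?thesis by linarith
  qed
  with d show ?thesis by (simp add: binom_moment_def)
qed

text \<open>A Bonferroni-type bound. For \<open>x = 0\<close> the partial sum is 1; for
  \<open>0 < x\<close> and \<open>x \<le> K\<close> it contains a zero factor; for larger
  \<open>x\<close> the next term is its absolute value times a factor at least 1.\<close>

lemma binom_moment_error:
  assumes Q: "Q > 1"
  shows "\<bar>(\<Sum>m\<le>K. (-1) ^ m * binom_moment Q m (Q ^ x)) - of_bool (Q ^ x = 1)\<bar> \<le> binom_moment Q (Suc K) (Q ^ x)"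
proof -
  have pos: "Q ^ Suc i - 1 > 0" for i using one_less_power[OF Q, of "Suc i"] by simp
  consider "x = 0" | "x > 0" "x \<le> K" | "x > K" by linarith
  thus ?thesis
  proof cases
    case 1
    have "(Q ^ Suc i - 1) / (Q ^ Suc i - 1) = 1" for i using pos[of i] by simp
    hence "(\<Prod>i<K. (Q ^ Suc i - Q ^ x) / (Q ^ Suc i - 1)) = 1" using 1 by simp
    moreover have "Q ^ x = 1" using 1 by simp
    ultimately show ?thesis using binom_moment_nonneg[OF Q, of "Suc K" x]
      unfolding sum_binom_moment[OF Q] by simp
  next
    case 2
    have z: "(\<Prod>i<K. (Q ^ Suc i - Q ^ x) / (Q ^ Suc i - 1)) = 0"
      by (rule prod_zero) (use 2 in \<open>auto intro!: bexI[of _ "x - 1"]\<close>)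
    have "Q ^ x \<noteq> 1" using one_less_power[OF Q 2(1)] by simp
    thus ?thesis using binom_moment_nonneg[OF Q, of "Suc K" x]
      unfolding sum_binom_moment[OF Q] z by simp
  next
    case 3
    hence ne: "Q ^ x > 1" using one_less_power[OF Q, of x] by simp
    have le: "Q ^ Suc i \<le> Q ^ x" if "i \<le> K" for i
      using Q 3 that by (intro power_increasing) simp_all
    have "\<bar>\<Prod>i<K. (Q ^ Suc i - Q ^ x) / (Q ^ Suc i - 1)\<bar> = (\<Prod>i<K. (Q ^ x - Q ^ Suc i) / (Q ^ Suc i - 1))"
      unfolding abs_prod using pos le
      by (intro prod.cong) (auto simp: abs_divide less_imp_le abs_of_nonpos simp del: power_Suc)
    also have "\<dots> \<le> (\<Prod>i<K. (Q ^ x - Q ^ Suc i) / (Q ^ Suc i - 1)) * ((Q ^ x - 1) / (Q ^ Suc K - 1))"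
    proof -
      have "(Q ^ x - 1) / (Q ^ Suc K - 1) \<ge> 1" using pos[of K] le[of K] by (simp del: power_Suc)
      moreover have "(\<Prod>i<K. (Q ^ x - Q ^ Suc i) / (Q ^ Suc i - 1)) \<ge> 0"
        using pos le by (intro prod_nonneg) (auto simp: less_imp_le simp del: power_Suc)
      ultimately show ?thesis using mult_left_mono[of 1] by fastforce
    qed
    also have "\<dots> = binom_moment Q (Suc K) (Q ^ x)"
      unfolding binom_moment_def
      by (subst prod.lessThan_Suc_shift) (simp add: prod_dividef)
    finally show ?thesis using ne unfolding sum_binom_moment[OF Q] by simp
  qed
qed

text \<open>Factors are exchanged one at a time. The error is kept as a product of the
  \<open>1 + e x\<close>, because averages of such products are again given by joint
  moments.\<close>

lemma abs_prod_diff_le: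
  fixes a b e :: "'b \<Rightarrow> real"
  assumes "finite P" "\<And>x. x \<in> P \<Longrightarrow> \<bar>a x\<bar> \<le> 1" "\<And>x. x \<in> P \<Longrightarrow> \<bar>b x - a x\<bar> \<le> e x"
  shows "\<bar>(\<Prod>x\<in>P. b x) - (\<Prod>x\<in>P. a x)\<bar> \<le> (\<Prod>x\<in>P. 1 + e x) - 1"
  using assms
proof (induction P)
  case (insert y P)
  have e0: "e x \<ge> 0" if "x \<in> insert y P" for x using insert.prems(2)[OF that] by linarith
  have IH: "\<bar>prod b P - prod a P\<bar> \<le> (\<Prod>x\<in>P. 1 + e x) - 1" by (rule insert.IH) (use insert.prems in auto)
  have a: "\<bar>prod a P\<bar> \<le> 1" unfolding abs_prod using insert.prems by (intro prod_le_1) auto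
  have by': "\<bar>b y\<bar> \<le> 1 + e y" using insert.prems(1,2)[of y] by fastforce
  have "b y * prod b P - a y * prod a P = b y * (prod b P - prod a P) + (b y - a y) * prod a P"
    by (simp add: algebra_simps)
  hence "\<bar>b y * prod b P - a y * prod a P\<bar> \<le> \<bar>b y\<bar> * \<bar>prod b P - prod a P\<bar> + \<bar>b y - a y\<bar> * \<bar>prod a P\<bar>"
    by (metis abs_mult abs_triangle_ineq)
  also have "\<dots> \<le> (1 + e y) * ((\<Prod>x\<in>P. 1 + e x) - 1) + e y * 1"
    using IH a by' insert.prems(2)[of y] e0[of y] by (intro add_mono mult_mono) auto
  also have "\<dots> = (1 + e y) * (\<Prod>x\<in>P. 1 + e x) - 1" by (simp add: algebra_simps)
  finally show ?case using insert.hyps by simp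
qed simp

text \<open>Method of moments: for fixed \<open>K\<close> each indicator of \<open>N x A = 1\<close>
  is replaced by a truncated alternating sum. The averages are exact from some \<open>n\<close> on,
  and the error is at most the average of the product of the
  \<open>1 + binom_moment (Q x) (Suc K) (N x A)\<close>, less 1. First \<open>n\<close> and then
  \<open>K\<close> tends to infinity.\<close>

theorem sieve_limit:
  fixes C :: "nat \<Rightarrow> 'b set" and N :: "'c \<Rightarrow> 'b \<Rightarrow> real" and Q :: "'c \<Rightarrow> real" and c :: "'c \<Rightarrow> nat \<Rightarrow> real"
  assumes P: "finite P" and Q: "\<And>x. x \<in> P \<Longrightarrow> Q x > 1"
    and C: "\<forall>\<^sub>F n in sequentially. finite (C n) \<and> C n \<noteq> {}"
    and N: "\<forall>\<^sub>F n in sequentially. \<forall>x\<in>P. \<forall>A\<in>C n. \<exists>k::nat. N x A = Q x ^ k"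
    and mom: "\<And>m. \<forall>\<^sub>F n in sequentially.
      (\<Sum>A\<in>C n. \<Prod>x\<in>P. binom_moment (Q x) (m x) (N x A)) = real (card (C n)) * (\<Prod>x\<in>P. c x (m x))"
    and c: "\<And>x. x \<in> P \<Longrightarrow> c x \<longlonglongrightarrow> 0" "\<And>x. x \<in> P \<Longrightarrow> c x 0 = 1"
    and s: "\<And>x. x \<in> P \<Longrightarrow> (\<lambda>m. (-1) ^ m * c x m) sums s x"
  shows "(\<lambda>n. real (card {A \<in> C n. \<forall>x\<in>P. N x A = 1}) / real (card (C n))) \<longlonglongrightarrow> (\<Prod>x\<in>P. s x)"
proof -
  let ?p = "\<lambda>n. real (card {A \<in> C n. \<forall>x\<in>P. N x A = 1}) / real (card (C n))"
  \<comment> \<open>Expanding a product of finite sums involves only finitely many multiplicity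
    functions, so one threshold for \<open>n\<close> serves them all.\<close>
  have lin: "\<forall>\<^sub>F n in sequentially. (\<Sum>A\<in>C n. \<Prod>x\<in>P. \<Sum>m\<in>M. w m * binom_moment (Q x) m (N x A))
      = real (card (C n)) * (\<Prod>x\<in>P. \<Sum>m\<in>M. w m * c x m)" if M: "finite M" for M :: "nat set" and w :: "nat \<Rightarrow> real"
  proof -
    have "finite (PiE P (\<lambda>_. M))" using P M by (intro finite_PiE)
    hence "\<forall>\<^sub>F n in sequentially. \<forall>m\<in>PiE P (\<lambda>_. M).
      (\<Sum>A\<in>C n. \<Prod>x\<in>P. binom_moment (Q x) (m x) (N x A)) = real (card (C n)) * (\<Prod>x\<in>P. c x (m x))"
      by (intro eventually_ball_finite ballI mom)
    thus ?thesis
    proof eventually_elim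
      case (elim n)
      have "(\<Sum>A\<in>C n. \<Prod>x\<in>P. \<Sum>m\<in>M. w m * binom_moment (Q x) m (N x A))
          = (\<Sum>A\<in>C n. \<Sum>g\<in>PiE P (\<lambda>_. M). \<Prod>x\<in>P. w (g x) * binom_moment (Q x) (g x) (N x A))"
        using P M by (simp add: prod_sum_PiE)
      also have "\<dots> = (\<Sum>g\<in>PiE P (\<lambda>_. M). \<Sum>A\<in>C n. (\<Prod>x\<in>P. w (g x)) * (\<Prod>x\<in>P. binom_moment (Q x) (g x) (N x A)))"
        by (subst sum.swap) (simp add: prod.distrib)
      also have "\<dots> = (\<Sum>g\<in>PiE P (\<lambda>_. M). (\<Prod>x\<in>P. w (g x)) * (real (card (C n)) * (\<Prod>x\<in>P. c x (g x))))"
        using elim by (intro sum.cong refl) (simp flip: sum_distrib_left)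
      also have "\<dots> = real (card (C n)) * (\<Sum>g\<in>PiE P (\<lambda>_. M). \<Prod>x\<in>P. w (g x) * c x (g x))"
        by (simp add: sum_distrib_left prod.distrib mult_ac)
      also have "\<dots> = real (card (C n)) * (\<Prod>x\<in>P. \<Sum>m\<in>M. w m * c x m)"
        using P M by (simp add: prod_sum_PiE)
      finally show ?case .
    qed
  qed
  have bound: "\<forall>\<^sub>F n in sequentially. \<bar>?p n - (\<Prod>x\<in>P. \<Sum>m\<le>K. (-1) ^ m * c x m)\<bar> \<le> (\<Prod>x\<in>P. 1 + c x (Suc K)) - 1" for K
  proof -
    \<comment> \<open>These weights select the terms for 0 and \<open>Suc K\<close>, so that
      \<open>lin\<close> also evaluates the average of the error bound.\<close>
    define w where "w = (\<lambda>m. of_bool (m = 0 \<or> m = Suc K) :: real)"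
    have w: "(\<Sum>m\<in>{0, Suc K}. w m * f m) = f 0 + f (Suc K)" for f :: "nat \<Rightarrow> real" by (simp add: w_def)
    show ?thesis
      using C N lin[of "{..K}" "\<lambda>m. (-1) ^ m", OF finite_atMost] lin[of "{0, Suc K}" w, unfolded w, simplified]
    proof eventually_elim
      case (elim n)
      have fin: "finite (C n)" and ne: "card (C n) > 0" using elim(1) by (auto simp: card_gt_0_iff)
      let ?b = "\<lambda>A. \<Prod>x\<in>P. \<Sum>m\<le>K. (-1) ^ m * binom_moment (Q x) m (N x A)"
      let ?a = "\<lambda>A. \<Prod>x\<in>P. of_bool (N x A = 1) :: real"
      let ?e = "\<lambda>A. \<Prod>x\<in>P. 1 + binom_moment (Q x) (Suc K) (N x A)"
      have "real (card {A \<in> C n. \<forall>x\<in>P. N x A = 1}) = (\<Sum>A\<in>C n. of_bool (\<forall>x\<in>P. N x A = 1))"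
        using fin by (simp add: sum_of_bool_eq Int_def)
      also have "\<dots> = (\<Sum>A\<in>C n. ?a A)"
        using P by (intro sum.cong refl) (auto simp: of_bool_def prod_zero_iff)
      finally have pa: "real (card {A \<in> C n. \<forall>x\<in>P. N x A = 1}) = (\<Sum>A\<in>C n. ?a A)" .
      have "\<bar>(\<Sum>A\<in>C n. ?a A) - (\<Sum>A\<in>C n. ?b A)\<bar> \<le> (\<Sum>A\<in>C n. \<bar>?b A - ?a A\<bar>)"
        by (subst abs_minus_commute) (simp flip: sum_subtractf)
      also have "\<dots> \<le> (\<Sum>A\<in>C n. ?e A - 1)"
      proof (intro sum_mono abs_prod_diff_le P)
        fix A x assume A: "A \<in> C n" and x: "x \<in> P"
        obtain k where "N x A = Q x ^ k" using elim(2) A x by blast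
        thus "\<bar>(\<Sum>m\<le>K. (-1) ^ m * binom_moment (Q x) m (N x A)) - of_bool (N x A = 1)\<bar>
            \<le> binom_moment (Q x) (Suc K) (N x A)"
          using binom_moment_error[OF Q[OF x]] by simp
      qed simp
      also have "\<dots> = (\<Sum>A\<in>C n. ?e A) - real (card (C n))" by (simp add: sum_subtractf)
      also have "(\<Sum>A\<in>C n. ?e A) = real (card (C n)) * (\<Prod>x\<in>P. 1 + c x (Suc K))"
        using elim(4) c(2) by simp
      finally have "\<bar>(\<Sum>A\<in>C n. ?a A) - real (card (C n)) * (\<Prod>x\<in>P. \<Sum>m\<le>K. (-1) ^ m * c x m)\<bar>
          \<le> real (card (C n)) * ((\<Prod>x\<in>P. 1 + c x (Suc K)) - 1)"
        using elim(3) by (simp add: algebra_simps)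
      moreover have "?p n - (\<Prod>x\<in>P. \<Sum>m\<le>K. (-1) ^ m * c x m)
          = ((\<Sum>A\<in>C n. ?a A) - real (card (C n)) * (\<Prod>x\<in>P. \<Sum>m\<le>K. (-1) ^ m * c x m)) / real (card (C n))"
        unfolding pa using ne by (simp add: diff_divide_distrib)
      ultimately show ?case using ne by (simp add: abs_divide pos_divide_le_eq mult.commute)
    qed
  qed
  have lim1: "(\<lambda>K. \<Prod>x\<in>P. \<Sum>m\<le>K. (-1) ^ m * c x m) \<longlonglongrightarrow> (\<Prod>x\<in>P. s x)"
    using s by (intro tendsto_prod) (simp add: sums_def_le)
  have lim2: "(\<lambda>K. (\<Prod>x\<in>P. 1 + c x (Suc K)) - 1) \<longlonglongrightarrow> (\<Prod>x\<in>P. 1 + 0) - 1"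
    using c(1) by (intro tendsto_intros tendsto_prod) (auto intro: LIMSEQ_Suc)
  show ?thesis
  proof (rule LIMSEQ_I)
    fix \<epsilon> :: real assume \<epsilon>: "\<epsilon> > 0"
    have "\<forall>\<^sub>F K in sequentially. \<bar>(\<Prod>x\<in>P. \<Sum>m\<le>K. (-1) ^ m * c x m) - (\<Prod>x\<in>P. s x)\<bar> < \<epsilon> / 2"
      using tendstoD[OF lim1, of "\<epsilon> / 2"] \<epsilon> by (simp add: dist_real_def)
    moreover have "\<forall>\<^sub>F K in sequentially. (\<Prod>x\<in>P. 1 + c x (Suc K)) - 1 < \<epsilon> / 2"
      using order_tendstoD(2)[OF lim2, of "\<epsilon> / 2"] \<epsilon> by simp
    ultimately have "\<exists>K. \<bar>(\<Prod>x\<in>P. \<Sum>m\<le>K. (-1) ^ m * c x m) - (\<Prod>x\<in>P. s x)\<bar> < \<epsilon> / 2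
        \<and> (\<Prod>x\<in>P. 1 + c x (Suc K)) - 1 < \<epsilon> / 2"
      using eventually_happens[OF eventually_conj] by (metis (no_types, lifting) trivial_limit_sequentially)
    then obtain K where K: "\<bar>(\<Prod>x\<in>P. \<Sum>m\<le>K. (-1) ^ m * c x m) - (\<Prod>x\<in>P. s x)\<bar> < \<epsilon> / 2"
        "(\<Prod>x\<in>P. 1 + c x (Suc K)) - 1 < \<epsilon> / 2" by blast
    have "\<forall>\<^sub>F n in sequentially. norm (?p n - (\<Prod>x\<in>P. s x)) < \<epsilon>"
      using bound[of K] by eventually_elim (use K in \<open>simp; linarith\<close>)
    thus "\<exists>n0. \<forall>n\<ge>n0. norm (?p n - (\<Prod>x\<in>P. s x)) < \<epsilon>"
      by (simp add: eventually_sequentially)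
  qed
qed

subsection \<open>Euler's product identities\<close>

lemma prodinf_eq_limit:
  fixes f :: "nat \<Rightarrow> real"
  assumes "summable (\<lambda>n. \<bar>f n - 1\<bar>)" "(\<lambda>n. \<Prod>i<n. f i) \<longlonglongrightarrow> l"
  shows "(\<Prod>i. f i) = l" "convergent_prod f"
proof -
  show conv: "convergent_prod f"
    using assms(1) by (intro abs_convergent_prod_imp_convergent_prod) (simp add: abs_convergent_prod_conv_summable)
  have "(\<lambda>n. \<Prod>i<Suc n. f i) \<longlonglongrightarrow> (\<Prod>i. f i)"
    using convergent_prod_LIMSEQ[OF conv] by (simp add: lessThan_Suc_atMost)
  moreover have "(\<lambda>n. \<Prod>i<Suc n. f i) \<longlonglongrightarrow> l" using assms(2) by (rule LIMSEQ_Suc)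
  ultimately show "(\<Prod>i. f i) = l" by (rule LIMSEQ_unique)
qed

text \<open>With \<open>F\<close> the sum below, comparing coefficients gives \<open>(1 - x) * F x = F (x * y)\<close>.\<close>

lemma euler_first:
  fixes x y :: real
  defines "d \<equiv> \<lambda>m. 1 / (\<Prod>i<m. 1 - y ^ Suc i)"
  assumes y: "0 < y" "y < 1" and x: "\<bar>x\<bar> < 1"
  shows "summable (\<lambda>m. d m * x ^ m)"
    and "(\<lambda>n. \<Prod>k<n. 1 - x * y ^ k) \<longlonglongrightarrow> 1 / (\<Sum>m. d m * x ^ m)" "(\<Sum>m. d m * x ^ m) \<noteq> 0"
proof -
  have y1: "1 - y ^ Suc i > 0" for i using power_Suc_less_one[OF y] by simp
  have dS: "d (Suc m) * (1 - y ^ Suc m) = d m" for m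
    using y1[of m] by (simp add: d_def)
  have summ: "summable (\<lambda>m. d m * z ^ m)" if z: "\<bar>z\<bar> < 1" for z
  proof -
    have "(\<lambda>m. \<bar>z\<bar> / (1 - y ^ Suc m)) \<longlonglongrightarrow> \<bar>z\<bar> / (1 - 0)"
      using y by (intro tendsto_intros LIMSEQ_Suc[OF LIMSEQ_power_zero]) simp_all
    moreover have "\<bar>z\<bar> / (1 - 0) < (1 + \<bar>z\<bar>) / 2" using z by simp
    ultimately have "\<forall>\<^sub>F m in sequentially. \<bar>z\<bar> / (1 - y ^ Suc m) < (1 + \<bar>z\<bar>) / 2"
      by (rule order_tendstoD)
    then obtain M where M: "\<And>m. m \<ge> M \<Longrightarrow> \<bar>z\<bar> / (1 - y ^ Suc m) < (1 + \<bar>z\<bar>) / 2"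
      by (auto simp: eventually_sequentially)
    show ?thesis
    proof (rule summable_ratio_test[of "(1 + \<bar>z\<bar>) / 2" M])
      fix m assume "m \<ge> M"
      have "d (Suc m) = d m / (1 - y ^ Suc m)" using dS[of m] y1[of m] by (simp add: field_simps)
      hence "norm (d (Suc m) * z ^ Suc m) = (\<bar>z\<bar> / (1 - y ^ Suc m)) * norm (d m * z ^ m)"
        using y1[of m] by (simp add: abs_mult abs_divide power_Suc[of z])
      also have "\<dots> \<le> (1 + \<bar>z\<bar>) / 2 * norm (d m * z ^ m)"
        using M[OF \<open>m \<ge> M\<close>] by (intro mult_right_mono) auto
      finally show "norm (d (Suc m) * z ^ Suc m) \<le> (1 + \<bar>z\<bar>) / 2 * norm (d m * z ^ m)" .
    qed (use z in simp)
  qed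
  define F where "F = (\<lambda>z. \<Sum>m. d m * z ^ m)"
  show "summable (\<lambda>m. d m * x ^ m)" by (rule summ[OF x])
  have d0: "d 0 = 1" by (simp add: d_def)
  have fe: "(1 - z) * F z = F (z * y)" if z: "\<bar>z\<bar> < 1" for z
  proof -
    have zy: "\<bar>z * y\<bar> < 1"
    proof -
      have "\<bar>z\<bar> * y \<le> \<bar>z\<bar> * 1" using y by (intro mult_left_mono) auto
      thus ?thesis using z y by (simp add: abs_mult)
    qed
    have "F z - F (z * y) = (\<Sum>m. d m * z ^ m - d m * (z * y) ^ m)"
      unfolding F_def by (rule suminf_diff[OF summ[OF z] summ[OF zy]])
    also have "\<dots> = (\<Sum>m. d (Suc m) * z ^ Suc m - d (Suc m) * (z * y) ^ Suc m)"
      using suminf_split_head[OF summable_diff[OF summ[OF z] summ[OF zy]]] by simp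
    also have "\<dots> = (\<Sum>m. z * (d m * z ^ m))"
    proof (rule suminf_cong)
      fix m
      have "d (Suc m) * z ^ Suc m - d (Suc m) * (z * y) ^ Suc m = (d (Suc m) * (1 - y ^ Suc m)) * z ^ Suc m"
        by (simp only: power_mult_distrib) (simp add: algebra_simps)
      thus "d (Suc m) * z ^ Suc m - d (Suc m) * (z * y) ^ Suc m = z * (d m * z ^ m)"
        by (simp only: dS) (simp add: power_Suc[of z])
    qed
    also have "\<dots> = z * F z" unfolding F_def by (rule suminf_mult[OF summ[OF z]])
    finally show ?thesis by (simp add: algebra_simps)
  qed
  have xy: "\<bar>x * y ^ n\<bar> < 1" for n
  proof -
    have "\<bar>x\<bar> * y ^ n \<le> \<bar>x\<bar> * 1" using y by (intro mult_left_mono power_le_one) auto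
    thus ?thesis using x y by (simp add: abs_mult)
  qed
  \<comment> \<open>Iterating \<open>fe\<close> moves the argument towards 0, where \<open>F\<close>
    is continuous with value 1.\<close>
  have it: "(\<Prod>k<n. 1 - x * y ^ k) * F x = F (x * y ^ n)" for n
  proof (induction n)
    case (Suc n)
    have "(\<Prod>k<Suc n. 1 - x * y ^ k) * F x = (1 - x * y ^ n) * ((\<Prod>k<n. 1 - x * y ^ k) * F x)" by simp
    also have "\<dots> = F (x * y ^ Suc n)" unfolding Suc by (subst fe[OF xy]) (simp add: mult_ac power_Suc)
    finally show ?case .
  qed simp
  have "isCont F 0" unfolding F_def
    by (rule isCont_powser[of _ "1/2"]) (use summ[of "1/2"] in simp_all)
  moreover have "(\<lambda>n. x * y ^ n) \<longlonglongrightarrow> 0"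
    using y by (intro tendsto_mult_right_zero LIMSEQ_power_zero) simp
  ultimately have "(\<lambda>n. F (x * y ^ n)) \<longlonglongrightarrow> F 0" by (rule isCont_tendsto_compose)
  moreover have "F 0 = 1" unfolding F_def by (subst powser_zero) (rule d0)
  ultimately have l: "(\<lambda>n. (\<Prod>k<n. 1 - x * y ^ k) * F x) \<longlonglongrightarrow> 1" by (simp add: it)
  show nz: "(\<Sum>m. d m * x ^ m) \<noteq> 0"
  proof
    assume "(\<Sum>m. d m * x ^ m) = 0"
    hence "F x = 0" by (simp add: F_def)
    with l show False by (simp add: LIMSEQ_const_iff)
  qed
  hence "(\<lambda>n. (\<Prod>k<n. 1 - x * y ^ k) * F x / F x) \<longlonglongrightarrow> 1 / F x"
    using l by (intro tendsto_divide tendsto_const) (simp_all add: F_def)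
  thus "(\<lambda>n. \<Prod>k<n. 1 - x * y ^ k) \<longlonglongrightarrow> 1 / (\<Sum>m. d m * x ^ m)" using nz by (simp add: F_def)
qed

text \<open>Comparing coefficients gives G(z) = (1 - z y) G(z y) for y = 1/Q, and iteration from z =
  1 produces the product.\<close>

lemma euler_second:
  fixes Q :: real
  defines "c \<equiv> \<lambda>m. 1 / (\<Prod>i<m. Q ^ Suc i - 1)"
  assumes Q: "Q > 1"
  shows "c \<longlonglongrightarrow> 0" and "(\<lambda>m. (-1) ^ m * c m) sums (\<Prod>i. 1 - 1 / Q ^ Suc i)"
    and "convergent_prod (\<lambda>i. 1 - 1 / Q ^ Suc i)"
proof -
  define y where "y = 1 / Q"
  have y: "0 < y" "y < 1" using Q by (simp_all add: y_def)
  have Q1: "Q ^ Suc i - 1 > 0" for i using one_less_power[OF Q, of "Suc i"] by simp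
  have cS: "c (Suc m) * (Q ^ Suc m - 1) = c m" for m using Q1[of m] by (simp add: c_def)
  have summ: "summable (\<lambda>m. ((-1) ^ m * c m) * z ^ m)" for z :: real
  proof -
    have "(\<lambda>m. \<bar>z\<bar> * y ^ Suc m / (1 - y ^ Suc m)) \<longlonglongrightarrow> \<bar>z\<bar> * 0 / (1 - 0)"
      using y by (intro tendsto_intros LIMSEQ_Suc[OF LIMSEQ_power_zero]) simp_all
    hence "\<forall>\<^sub>F m in sequentially. \<bar>z\<bar> * y ^ Suc m / (1 - y ^ Suc m) < 1 / 2"
      by (rule order_tendstoD) simp
    then obtain M where M: "\<And>m. m \<ge> M \<Longrightarrow> \<bar>z\<bar> * y ^ Suc m / (1 - y ^ Suc m) < 1 / 2"
      by (auto simp: eventually_sequentially)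
    show ?thesis
    proof (rule summable_ratio_test[of "1 / 2" M])
      fix m assume "m \<ge> M"
      have "c (Suc m) = c m / (Q ^ Suc m - 1)" using cS[of m] Q1[of m] by (simp add: field_simps)
      also have "Q ^ Suc m - 1 = (1 - y ^ Suc m) / y ^ Suc m"
        using Q by (simp add: y_def power_divide field_simps)
      finally have cw: "c (Suc m) = c m * (y ^ Suc m / (1 - y ^ Suc m))" by simp
      define w where "w = y ^ Suc m / (1 - y ^ Suc m)"
      have "w > 0" using y power_Suc_less_one[OF y, of m] by (simp add: w_def)
      hence "norm ((-1) ^ Suc m * c (Suc m) * z ^ Suc m) = \<bar>z\<bar> * w * norm ((-1) ^ m * c m * z ^ m)"
        unfolding cw w_def[symmetric] by (simp add: abs_mult power_Suc[of z] power_Suc[of "-1"])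
      hence "norm ((-1) ^ Suc m * c (Suc m) * z ^ Suc m)
          = (\<bar>z\<bar> * y ^ Suc m / (1 - y ^ Suc m)) * norm ((-1) ^ m * c m * z ^ m)"
        by (simp add: w_def)
      also have "\<dots> \<le> 1 / 2 * norm ((-1) ^ m * c m * z ^ m)"
        using M[OF \<open>m \<ge> M\<close>] by (intro mult_right_mono) auto
      finally show "norm ((-1) ^ Suc m * c (Suc m) * z ^ Suc m) \<le> 1 / 2 * norm ((-1) ^ m * c m * z ^ m)" .
    qed simp
  qed
  define G where "G = (\<lambda>z. \<Sum>m. ((-1) ^ m * c m) * z ^ m)"
  have c0: "c 0 = 1" by (simp add: c_def)
  show "c \<longlonglongrightarrow> 0" using summable_LIMSEQ_zero[OF summ[of "-1"]] by (simp flip: power_mult_distrib add: mult_ac)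
  have fe: "G z = (1 - z * y) * G (z * y)" for z
  proof -
    let ?a = "\<lambda>m. (-1) ^ m * c m"
    have "G z - G (z * y) = (\<Sum>m. ?a m * z ^ m - ?a m * (z * y) ^ m)"
      unfolding G_def by (rule suminf_diff[OF summ summ])
    also have "\<dots> = (\<Sum>m. ?a (Suc m) * z ^ Suc m - ?a (Suc m) * (z * y) ^ Suc m)"
      using suminf_split_head[OF summable_diff[OF summ[of z] summ[of "z * y"]]] by simp
    also have "\<dots> = (\<Sum>m. (- (z * y)) * (?a m * (z * y) ^ m))"
    proof (rule suminf_cong)
      fix m
      have e: "1 - y ^ Suc m = (Q ^ Suc m - 1) * y ^ Suc m"
        using Q by (simp add: y_def power_divide field_simps)
      have "?a (Suc m) * z ^ Suc m - ?a (Suc m) * (z * y) ^ Suc m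
          = (-1) ^ Suc m * c (Suc m) * z ^ Suc m * (1 - y ^ Suc m)"
        by (simp only: power_mult_distrib) (simp add: algebra_simps)
      also have "\<dots> = (-1) ^ Suc m * (c (Suc m) * (Q ^ Suc m - 1)) * (z * y) ^ Suc m"
        unfolding e by (simp only: power_mult_distrib mult_ac)
      also have "\<dots> = (- (z * y)) * (?a m * (z * y) ^ m)" unfolding cS by (simp add: power_Suc)
      finally show "?a (Suc m) * z ^ Suc m - ?a (Suc m) * (z * y) ^ Suc m = (- (z * y)) * (?a m * (z * y) ^ m)" .
    qed
    also have "\<dots> = - (z * y) * G (z * y)" unfolding G_def by (rule suminf_mult[OF summ])
    finally show ?thesis by (simp add: algebra_simps)
  qed
  have it: "G 1 = (\<Prod>k<n. 1 - y ^ Suc k) * G (y ^ n)" for n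
  proof (induction n)
    case (Suc n)
    thus ?case using fe[of "y ^ n"] by (simp add: mult_ac power_Suc)
  qed simp
  have "isCont G 0" unfolding G_def
    by (rule isCont_powser[of _ 1]) (use summ[of 1] in simp_all)
  moreover have "(\<lambda>n. y ^ n) \<longlonglongrightarrow> 0" using y by (intro LIMSEQ_power_zero) simp
  ultimately have "(\<lambda>n. G (y ^ n)) \<longlonglongrightarrow> G 0" by (rule isCont_tendsto_compose)
  moreover have "G 0 = 1" unfolding G_def by (subst powser_zero) (simp add: c0)
  \<comment> \<open>The limit 1 makes \<open>G (y ^ n)\<close> nonzero for large \<open>n\<close>,
    which is enough to divide by it.\<close>
  ultimately have Gy: "(\<lambda>n. G (y ^ n)) \<longlonglongrightarrow> 1" by simp
  hence Gl: "(\<lambda>n. G 1 / G (y ^ n)) \<longlonglongrightarrow> G 1 / 1" by (intro tendsto_intros) simp_all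
  have "\<forall>\<^sub>F n in sequentially. 0 < G (y ^ n)" by (rule order_tendstoD(1)[OF Gy]) simp
  hence "\<forall>\<^sub>F n in sequentially. G 1 / G (y ^ n) = (\<Prod>k<n. 1 - y ^ Suc k)"
  proof (rule eventually_mono)
    fix n assume "0 < G (y ^ n)"
    thus "G 1 / G (y ^ n) = (\<Prod>k<n. 1 - y ^ Suc k)" using it[of n] by simp
  qed
  from Lim_transform_eventually[OF Gl this] have lim: "(\<lambda>n. \<Prod>k<n. 1 - y ^ Suc k) \<longlonglongrightarrow> G 1"
    by simp
  have sm: "summable (\<lambda>n. \<bar>1 - y ^ Suc n - 1\<bar>)"
    using y summable_geometric[of y] by (simp add: summable_Suc_iff[of "\<lambda>n. y ^ n"])
  have yQ: "1 - 1 / Q ^ Suc i = 1 - y ^ Suc i" for i by (simp add: y_def power_divide)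
  show "convergent_prod (\<lambda>i. 1 - 1 / Q ^ Suc i)"
    unfolding yQ by (rule prodinf_eq_limit(2)[OF sm lim])
  have "(\<Prod>i. 1 - 1 / Q ^ Suc i) = G 1"
    unfolding yQ by (rule prodinf_eq_limit(1)[OF sm lim])
  thus "(\<lambda>m. (-1) ^ m * c m) sums (\<Prod>i. 1 - 1 / Q ^ Suc i)"
    using summable_sums[OF summ[of 1]] by (simp add: G_def)
qed

text \<open>With x = -1/r and y = x^2 the series is that of \<open>euler_first\<close> at
  \<open>x\<close>, so it is the inverse of the product of the 1 - x^(2k+1). Euler's identity
  between partitions into odd parts and into distinct parts turns this into the product of the 1 +
  x^i.\<close>

lemma euler_odd:
  fixes r :: real
  defines "c \<equiv> \<lambda>m. r ^ (m\<^sup>2) / (\<Prod>i<m. (r\<^sup>2) ^ Suc i - 1)"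
  assumes r: "r > 1"
  shows "c \<longlonglongrightarrow> 0" and "(\<lambda>m. (-1) ^ m * c m) sums (\<Prod>i. 1 + 1 / (- r) ^ Suc i)"
    and "convergent_prod (\<lambda>i. 1 + 1 / (- r) ^ Suc i)"
proof -
  define x where "x = - 1 / r"
  define y where "y = 1 / r\<^sup>2"
  have x: "\<bar>x\<bar> < 1" "x \<noteq> 0" using r by (simp_all add: x_def)
  have yx: "y = x ^ 2" by (simp add: x_def y_def power_divide)
  have y: "0 < y" "y < 1" using r by (simp_all add: y_def one_less_power)
  let ?d = "\<lambda>m. 1 / (\<Prod>i<m. 1 - y ^ Suc i)"
  have cd: "c m = ?d m * (1 / r) ^ m" for m
  proof (induction m)
    case (Suc m)
    have "(Suc m)\<^sup>2 = m\<^sup>2 + (2 * m + 1)" by (simp add: power2_eq_square)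
    hence "r ^ ((Suc m)\<^sup>2) = r ^ (m\<^sup>2) * r ^ (2 * m + 1)" by (simp only: power_add)
    hence "c (Suc m) = c m * (r ^ (2 * m + 1) / ((r\<^sup>2) ^ Suc m - 1))"
      by (simp add: c_def)
    also have "r ^ (2 * m + 1) / ((r\<^sup>2) ^ Suc m - 1) = (1 / r) / (1 - y ^ Suc m)"
    proof -
      define u where "u = (r\<^sup>2) ^ Suc m"
      have "u = r ^ (2 * Suc m)" by (simp only: u_def power_mult)
      also have "\<dots> = r ^ (2 * m + 1) * r" by (simp add: power_Suc mult_ac)
      finally have "u = r ^ (2 * m + 1) * r" .
      moreover have "y ^ Suc m = 1 / u" by (simp add: u_def y_def power_divide)
      moreover have u1: "u > 1" unfolding u_def using r by (intro one_less_power) simp_all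
      moreover have "(1 / r) / (1 - 1 / u) = (u / r) / (u - 1)" using u1 r by (simp add: field_simps)
      ultimately show ?thesis using r by (simp add: u_def[symmetric])
    qed
    finally show ?case using Suc by (simp add: power_Suc[of "1 / r"] mult_ac)
  qed (simp add: c_def)
  have xr: "(-1) ^ m * (?d m * (1 / r) ^ m) = ?d m * x ^ m" for m
    by (simp add: x_def power_divide power_minus')
  show "c \<longlonglongrightarrow> 0"
    unfolding cd by (rule summable_LIMSEQ_zero[OF euler_first(1)[OF y]]) (use r in simp)
  note E = euler_first[OF y x(1)]
  let ?F = "\<Sum>m. ?d m * x ^ m"
  have x1: "\<bar>x ^ Suc i\<bar> < 1" for i using x power_Suc_less_one[of "\<bar>x\<bar>" i] by (simp add: power_abs)
  have smx: "summable (\<lambda>n. \<bar>x ^ Suc n\<bar>)"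
    using x(1) summable_geometric[of "\<bar>x\<bar>"] by (simp add: power_abs summable_Suc_iff[of "\<lambda>n. \<bar>x\<bar> ^ n"])
  have cA: "convergent_prod (\<lambda>i. 1 - x ^ Suc i)"
    by (intro abs_convergent_prod_imp_convergent_prod summable_imp_abs_convergent_prod) (use smx in simp)
  have cB: "convergent_prod (\<lambda>i. 1 + x ^ Suc i)"
    by (intro abs_convergent_prod_imp_convergent_prod summable_imp_abs_convergent_prod) (use smx in simp)
  let ?a = "\<Prod>i. 1 - x ^ Suc i" and ?b = "\<Prod>i. 1 + x ^ Suc i"
  have LA: "(\<lambda>n. \<Prod>i<n. 1 - x ^ Suc i) \<longlonglongrightarrow> ?a"
    using convergent_prod_LIMSEQ[OF cA] by (subst filterlim_sequentially_Suc[symmetric]) (simp only: lessThan_Suc_atMost)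
  have LB: "(\<lambda>n. \<Prod>i<n. 1 + x ^ Suc i) \<longlonglongrightarrow> ?b"
    using convergent_prod_LIMSEQ[OF cB] by (subst filterlim_sequentially_Suc[symmetric]) (simp only: lessThan_Suc_atMost)
  have "1 - x ^ Suc i \<noteq> 0" for i using x1[of i] by (simp add: abs_less_iff del: power_Suc)
  hence a0: "?a \<noteq> 0" by (intro prodinf_nonzero[OF cA])
  \<comment> \<open>Among the first \<open>2 * n\<close> factors the odd exponents give
    \<open>1 - x * y ^ k\<close>, and the even ones factor as differences of squares. In the limit
    the common product \<open>?a\<close> cancels.\<close>
  have split: "(\<Prod>i<2 * n. 1 - x ^ Suc i) = (\<Prod>k<n. 1 - x * y ^ k) * ((\<Prod>i<n. 1 - x ^ Suc i) * (\<Prod>i<n. 1 + x ^ Suc i))" for n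
  proof (induction n)
    case (Suc n)
    have "(\<Prod>i<2 * Suc n. 1 - x ^ Suc i) = (\<Prod>i<2 * n. 1 - x ^ Suc i) * ((1 - x ^ Suc (2 * n)) * (1 - x ^ Suc (Suc (2 * n))))"
      by (simp del: power_Suc)
    also have "x ^ Suc (2 * n) = x * y ^ n" by (simp add: yx power_mult power_Suc)
    also have "1 - x ^ Suc (Suc (2 * n)) = (1 - x ^ Suc n) * (1 + x ^ Suc n)"
    proof -
      have "x ^ Suc (Suc (2 * n)) = x ^ Suc n * x ^ Suc n"
        by (simp only: power_add[symmetric]) (simp add: mult_2)
      thus ?thesis by (simp add: algebra_simps)
    qed
    finally show ?case unfolding Suc by (simp add: mult_ac del: power_Suc)
  qed simp
  have "(\<lambda>n. \<Prod>i<2 * n. 1 - x ^ Suc i) \<longlonglongrightarrow> ?a"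
    by (rule filterlim_compose[OF LA]) (rule filterlim_subseq, simp add: strict_mono_def)
  moreover have "(\<lambda>n. \<Prod>i<2 * n. 1 - x ^ Suc i) \<longlonglongrightarrow> 1 / ?F * (?a * ?b)"
    unfolding split by (intro tendsto_mult E(2) LA LB)
  ultimately have "?a = 1 / ?F * (?a * ?b)" by (rule LIMSEQ_unique)
  hence "?b = ?F" using a0 E(3) by (simp add: field_simps)
  moreover have xi: "1 + 1 / (- r) ^ Suc i = 1 + x ^ Suc i" for i
  proof -
    have "x = 1 / (- r)" by (simp add: x_def)
    thus ?thesis by (simp only: power_one_over)
  qed
  moreover have "(\<lambda>m. (-1) ^ m * c m) = (\<lambda>m. ?d m * x ^ m)"
    by (rule ext) (simp only: cd xr)
  ultimately show "(\<lambda>m. (-1) ^ m * c m) sums (\<Prod>i. 1 + 1 / (- r) ^ Suc i)"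
    using summable_sums[OF E(1)] by simp
  show "convergent_prod (\<lambda>i. 1 + 1 / (- r) ^ Suc i)" unfolding xi by (rule cB)
qed

end

subsection \<open>Factors of the characteristic polynomial\<close>

sublocale herm \<subseteq> ac: field_hom "to_ac :: 'a \<Rightarrow> 'a alg_closure"
  by unfold_locales simp_all

sublocale herm \<subseteq> ac_poly: map_poly_comm_ring_hom "to_ac :: 'a \<Rightarrow> 'a alg_closure" ..

lemma det_pmat_linear:
  fixes M :: "'a::field mat"
  assumes M: "M \<in> carrier_mat n n"
  shows "det (pmat M [:-\<alpha>, 1:]) = 0 \<longleftrightarrow> poly (char_poly M) \<alpha> = 0"
proof -
  note [simp] = carrier_matD[OF M]
  have "pmat M [:-\<alpha>, 1:] = char_matrix M \<alpha>"
    unfolding char_matrix_def by (simp add: mzero_r) (rule eq_matI; simp add: mone_r madd_zero_r)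
  thus ?thesis using eigenvalue_det[OF M] eigenvalue_root_char_poly[OF M] by simp
qed

lemma det_pmat_mult:
  fixes M :: "'a::field mat"
  assumes M: "M \<in> carrier_mat n n"
  shows "det (pmat M (p * r)) = det (pmat M p) * det (pmat M r)"
  using det_mult[OF pmat_carrier[OF M] pmat_carrier[OF M]] M by (simp add: pmat_mult)

text \<open>Over an algebraically closed field \<open>p\<close> splits into linear factors, and the
  determinant at \<open>M\<close> is multiplicative in \<open>p\<close>.\<close>

lemma det_pmat_eq_0_iff:
  fixes M :: "'a::alg_closed_field mat"
  assumes M: "M \<in> carrier_mat n n"
  shows "p \<noteq> 0 \<Longrightarrow> det (pmat M p) = 0 \<longleftrightarrow> (\<exists>\<alpha>. poly p \<alpha> = 0 \<and> poly (char_poly M) \<alpha> = 0)"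
proof (induction "degree p" arbitrary: p rule: less_induct)
  case less
  note [simp] = carrier_matD[OF M]
  show ?case
  proof (cases "degree p = 0")
    case True
    then obtain c where c: "p = [:c:]" by (rule degree_eq_zeroE)
    have "pmat M p = c \<cdot>\<^sub>m 1\<^sub>m n" by (simp add: c mzero_r madd_zero_r)
    hence "det (pmat M p) \<noteq> 0" using less.prems by (simp add: c det_smult)
    thus ?thesis using less.prems by (simp add: c)
  next
    case False
    then obtain \<alpha> where "poly p \<alpha> = 0" using alg_closed_imp_poly_has_root[of p] by auto
    then obtain r where r: "p = [:-\<alpha>, 1:] * r" using poly_eq_0_iff_dvd by (metis dvdE)
    hence "r \<noteq> 0" using less.prems by auto
    hence "degree p = Suc (degree r)" unfolding r by (subst degree_mult_eq) simp_all
    hence IH: "det (pmat M r) = 0 \<longleftrightarrow> (\<exists>\<beta>. poly r \<beta> = 0 \<and> poly (char_poly M) \<beta> = 0)"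
      using less.hyps[of r] \<open>r \<noteq> 0\<close> by simp
    have "det (pmat M p) = 0 \<longleftrightarrow> poly (char_poly M) \<alpha> = 0 \<or> det (pmat M r) = 0"
      unfolding r det_pmat_mult[OF M] by (simp only: mult_eq_0_iff det_pmat_linear[OF M])
    also have "\<dots> \<longleftrightarrow> (\<exists>\<beta>. poly p \<beta> = 0 \<and> poly (char_poly M) \<beta> = 0)"
      unfolding IH r by auto
    finally show ?thesis .
  qed
qed

lemma det_eq_0_iff_card_kerp:
  fixes A :: "'a::{field,finite} mat"
  assumes A: "A \<in> carrier_mat n n"
  shows "det (pmat A p) = 0 \<longleftrightarrow> card (kerp A p) \<noteq> 1"
proof -
  note [simp] = carrier_matD[OF A]
  have "det (pmat A p) = 0 \<longleftrightarrow> (\<exists>v\<in>kerp A p. v \<noteq> 0\<^sub>v n)"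
    unfolding det_0_iff_vec_prod_zero_field[OF pmat_carrier[OF A]] by (auto simp: kerp_def)
  also have "\<dots> \<longleftrightarrow> kerp A p \<noteq> {0\<^sub>v n}" using zero_in_kerp[of A p] by auto
  also have "\<dots> \<longleftrightarrow> card (kerp A p) \<noteq> 1"
  proof -
    have "card (kerp A p) = 1 \<Longrightarrow> kerp A p = {0\<^sub>v n}"
      using zero_in_kerp[of A p] by (auto simp: card_1_singleton_iff)
    thus ?thesis by auto
  qed
  finally show ?thesis .
qed

context herm
begin

lemma map_pmat:
  fixes A :: "'a mat"
  assumes A: "A \<in> carrier_mat n n"
  shows "map_mat to_ac (pmat A p) = pmat (map_mat to_ac A) (map_poly to_ac p)"
proof (induction p)
  note [simp] = carrier_matD[OF A]
  case 0
  show ?case by simp (rule eq_matI; simp)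
next
  note [simp] = carrier_matD[OF A]
  case (pCons c p)
  have "map_mat to_ac (A * pmat A p) = map_mat to_ac A * map_mat to_ac (pmat A p)"
    by (rule ac.mat_hom_mult[OF A pmat_carrier[OF A]])
  moreover have "map_poly to_ac (pCons c p) = pCons (to_ac c) (map_poly to_ac p)"
    by (rule Polynomial.map_poly_pCons) simp
  moreover have "map_mat to_ac (pmat A (pCons c p)) = to_ac c \<cdot>\<^sub>m 1\<^sub>m n + map_mat to_ac (A * pmat A p)"
    by (simp, rule eq_matI; simp del: index_mult_mat(1))
  ultimately show ?case by (simp add: pCons.IH)
qed

text \<open>For the converse, a Bezout identity evaluated at a common root would read 0 = 1.\<close>

lemma ac_common_root:
  fixes \<phi> p :: "'a poly"
  assumes irr: "irreducible \<phi>"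
  shows "\<phi> dvd p \<longleftrightarrow> (\<exists>\<alpha>. poly (map_poly to_ac \<phi>) \<alpha> = 0 \<and> poly (map_poly to_ac p) \<alpha> = 0)"
proof
  assume "\<phi> dvd p"
  then obtain r where r: "p = \<phi> * r" by (elim dvdE)
  have nz: "\<phi> \<noteq> 0" "\<not> is_unit \<phi>" using irr unfolding Factorial_Ring.irreducible_def by blast+
  hence "degree (map_poly to_ac \<phi>) > 0" by (simp add: is_unit_iff_degree degree_map_poly)
  then obtain \<alpha> where "poly (map_poly to_ac \<phi>) \<alpha> = 0" using alg_closed_imp_poly_has_root by blast
  thus "\<exists>\<alpha>. poly (map_poly to_ac \<phi>) \<alpha> = 0 \<and> poly (map_poly to_ac p) \<alpha> = 0"
    unfolding r ac_poly.hom_mult by auto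
next
  assume "\<exists>\<alpha>. poly (map_poly to_ac \<phi>) \<alpha> = 0 \<and> poly (map_poly to_ac p) \<alpha> = 0"
  then obtain \<alpha> where \<alpha>: "poly (map_poly to_ac \<phi>) \<alpha> = 0" "poly (map_poly to_ac p) \<alpha> = 0" by blast
  show "\<phi> dvd p"
  proof (rule ccontr)
    assume "\<not> \<phi> dvd p"
    then obtain a b where ab: "a * p + b * \<phi> = 1" using bezout_irreducible[OF irr] by blast
    have "poly (map_poly to_ac (a * p + b * \<phi>)) \<alpha> = 0"
      by (simp add: ac_poly.hom_add ac_poly.hom_mult \<alpha>)
    thus False unfolding ab by simp
  qed
qed

text \<open>Singularity of \<phi>(A) is decided over the algebraic closure, where it means a common
  root of \<phi> and the characteristic polynomial. This replaces factors by the kernel sizes that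
  the moments control.\<close>

theorem dvd_char_poly_iff:
  fixes A :: "'a mat"
  assumes A: "A \<in> carrier_mat n n" and irr: "irreducible \<phi>"
  shows "\<phi> dvd char_poly A \<longleftrightarrow> card (kerp A \<phi>) \<noteq> 1"
proof -
  have "\<phi> \<noteq> 0" using irr by (simp add: Factorial_Ring.irreducible_def)
  hence nz: "map_poly to_ac \<phi> \<noteq> 0" by (simp add: map_poly_eq_0_iff)
  have Am: "map_mat to_ac A \<in> carrier_mat n n" using A by simp
  have "card (kerp A \<phi>) \<noteq> 1 \<longleftrightarrow> to_ac (det (pmat A \<phi>)) = 0"
    by (simp add: det_eq_0_iff_card_kerp[OF A])
  also have "\<dots> \<longleftrightarrow> det (pmat (map_mat to_ac A) (map_poly to_ac \<phi>)) = 0"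
    by (simp only: ac.hom_det[symmetric] map_pmat[OF A])
  also have "\<dots> \<longleftrightarrow> (\<exists>\<alpha>. poly (map_poly to_ac \<phi>) \<alpha> = 0 \<and> poly (map_poly to_ac (char_poly A)) \<alpha> = 0)"
    by (simp only: det_pmat_eq_0_iff[OF Am nz] ac.char_poly_hom[OF A])
  also have "\<dots> \<longleftrightarrow> \<phi> dvd char_poly A" by (rule ac_common_root[OF irr, symmetric])
  finally show ?thesis ..
qed

text \<open>The determinant at the conjugate polynomial is a nonzero multiple of the
  \<open>q\<close>-th power of the one at \<phi>, so it is enough to test one polynomial of each
  conjugate pair.\<close>

lemma card_kerp_conj_poly:
  assumes A: "A \<in> unitary n" and "\<phi> \<noteq> 0" "poly \<phi> 0 \<noteq> 0"
  shows "card (kerp A (conj_poly q \<phi>)) = 1 \<longleftrightarrow> card (kerp A \<phi>) = 1"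
proof -
  note Ac = unitary_carrier[OF A]
  note [simp] = carrier_matD[OF Ac]
  have dA: "det A \<noteq> 0" using det_unitary[OF A] by auto
  have X: "pmat A [:0, 1:] = A"
    by (simp add: mzero_r) (rule eq_matI; simp add: mone_r madd_zero_r)
  have "det (pmat A (monom 1 d)) \<noteq> 0" for d
  proof (induction d)
    case 0
    show ?case by (simp add: monom_0 flip: one_pCons)
  next
    case (Suc d)
    have "monom 1 (Suc d) = [:0, 1:] * (monom 1 d :: 'a poly)" by (simp add: monom_Suc)
    thus ?case using Suc dA by (simp only: det_pmat_mult[OF Ac] X mult_eq_0_iff) simp
  qed
  moreover have "det (pmat A (conj_poly q \<phi>)) = inverse (poly \<phi> 0 ^ q) ^ n * (det (pmat A (monom 1 (degree \<phi>))) * det (pmat A \<phi>) ^ q)"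
  proof -
    have "pmat A (monom 1 (degree \<phi>)) * dag (pmat A \<phi>) \<in> carrier_mat n n"
      by (rule carrier_matI) simp_all
    moreover have "det (pmat A (monom 1 (degree \<phi>)) * dag (pmat A \<phi>)) = det (pmat A (monom 1 (degree \<phi>))) * det (pmat A \<phi>) ^ q"
      using det_mult[OF pmat_carrier[OF Ac] dag_carrier[OF pmat_carrier[OF Ac]]]
      by (simp add: det_dag[OF pmat_carrier[OF Ac]])
    ultimately show ?thesis
      unfolding pmat_conj_poly[OF Ac Ac unitary_mult_dag[OF A] assms(2)]
      by (simp add: det_smult)
  qed
  ultimately have "det (pmat A (conj_poly q \<phi>)) = 0 \<longleftrightarrow> det (pmat A \<phi>) = 0"
    using assms(3) by simp
  thus ?thesis unfolding det_eq_0_iff_card_kerp[OF Ac] by blast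
qed

subsection \<open>Self-conjugate irreducible polynomials have odd degree\<close>

text \<open>If \<open>a\<close> is a root of a self-conjugate irreducible \<open>\<phi>\<close>, so is \<open>a\<close> to the power \<open>-q\<close>; hence the
  latter is a \<open>q\<^sup>2\<close>-Frobenius conjugate of \<open>a\<close>, and iterating shows that the number of
  conjugates divides an odd number.\<close>

lemma frob_poly_ac:
  "poly (map_poly to_ac (p :: 'a poly)) x ^ q = poly (map_poly to_ac (map_poly (\<lambda>c. c ^ q) p)) (x ^ q)"
proof (induction p)
  case (pCons c p)
  have "map_poly to_ac (pCons c p) = pCons (to_ac c) (map_poly to_ac p)"
    "map_poly (\<lambda>c. c ^ q) (pCons c p) = pCons (c ^ q) (map_poly (\<lambda>c. c ^ q) p)"
    "map_poly to_ac (pCons (c ^ q) (map_poly (\<lambda>c. c ^ q) p)) = pCons (to_ac (c ^ q)) (map_poly to_ac (map_poly (\<lambda>c. c ^ q) p))"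
    by (rule Polynomial.map_poly_pCons; simp)+
  thus ?case by (simp add: frob_add_ac power_mult_distrib pCons.IH)
qed simp

lemma frob2_poly_ac:
  "poly (map_poly to_ac (p :: 'a poly)) x ^ (q\<^sup>2) = poly (map_poly to_ac p) (x ^ (q\<^sup>2))"
proof -
  have "map_poly (\<lambda>c. c ^ q) (map_poly (\<lambda>c. c ^ q) p) = p"
    by (rule poly_eqI) (simp add: coeff_map_poly)
  thus ?thesis by (simp add: power2_eq_square power_mult frob_poly_ac)
qed

lemma frob2_inj_ac:
  assumes "(x :: 'a alg_closure) ^ (q\<^sup>2) = y ^ (q\<^sup>2)" shows "x = y"
proof -
  have inj: "u = v" if "u ^ q = v ^ q" for u v :: "'a alg_closure"
  proof -
    have "(u - v) ^ q + v ^ q = u ^ q" by (simp flip: frob_add_ac)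
    hence "(u - v) ^ q = 0" using that by simp
    thus ?thesis by simp
  qed
  from assms have "(x ^ q) ^ q = (y ^ q) ^ q" by (simp only: power2_eq_square power_mult)
  thus ?thesis by (rule inj[OF inj])
qed

text \<open>The equation x^(q^2) = x has at most q^2 solutions, and the field supplies that
  many.\<close>

lemma range_to_ac: "(x :: 'a alg_closure) ^ (q\<^sup>2) = x \<Longrightarrow> x \<in> range to_ac"
proof -
  assume x: "x ^ (q\<^sup>2) = x"
  let ?p = "monom 1 (q\<^sup>2) - monom 1 1 :: 'a alg_closure poly"
  have q2: "q\<^sup>2 > 1" using q_ge_2 one_less_power[of q 2] by simp
  have d: "degree ?p = q\<^sup>2"
    using q2 by (subst diff_conv_add_uminus, subst degree_add_eq_left) (auto simp: degree_monom_eq)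
  hence nz: "?p \<noteq> 0" using q2 by force
  have fin: "finite {x. poly ?p x = 0}" by (rule poly_roots_finite[OF nz])
  have sub: "range (to_ac :: 'a \<Rightarrow> _) \<subseteq> {x. poly ?p x = 0}"
  proof
    fix y assume "y \<in> range (to_ac :: 'a \<Rightarrow> _)"
    then obtain c :: 'a where c: "y = to_ac c" by blast
    have "c ^ (q\<^sup>2) = c" using power_card_field_eq_self[of c] by (simp add: card_q)
    thus "y \<in> {x. poly ?p x = 0}" by (simp add: c poly_monom flip: to_ac_power)
  qed
  moreover have "card {x. poly ?p x = 0} \<le> card (range (to_ac :: 'a \<Rightarrow> _))"
    using card_poly_roots_bound[OF nz] d by (simp add: card_image inj_to_ac card_q)
  ultimately have "range (to_ac :: 'a \<Rightarrow> _) = {x. poly ?p x = 0}" by (intro card_seteq fin)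
  moreover have "x \<in> {x. poly ?p x = 0}" using x by (simp add: poly_monom)
  ultimately show ?thesis by simp
qed

text \<open>Raising \<phi>(a) = 0 to the power \<open>q\<close> makes a^q a root of the polynomial
  with conjugated coefficients, and reflection inverts the root.\<close>

lemma conj_poly_root:
  fixes \<phi> :: "'a poly"
  assumes "poly (map_poly to_ac \<phi>) a = 0" "a \<noteq> 0"
  shows "poly (map_poly to_ac (conj_poly q \<phi>)) (inverse (a ^ q)) = 0"
proof -
  let ?p = "map_poly (\<lambda>c. c ^ q) \<phi>" and ?x = "inverse (a ^ q)"
  have "map_poly to_ac (reflect_poly ?p) = reflect_poly (map_poly to_ac ?p)"
    by (rule poly_eqI) (simp add: coeff_map_poly coeff_reflect_poly degree_map_poly)
  moreover have "map_poly to_ac (Polynomial.smult c r) = Polynomial.smult (to_ac c) (map_poly to_ac r)" for c :: 'a and r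
    by (rule poly_eqI) (simp add: coeff_map_poly)
  ultimately have "poly (map_poly to_ac (conj_poly q \<phi>)) ?x
      = to_ac (inverse (poly \<phi> 0 ^ q)) * poly (reflect_poly (map_poly to_ac ?p)) ?x"
    by (simp only: conj_poly_def poly_smult)
  also have "poly (reflect_poly (map_poly to_ac ?p)) ?x = ?x ^ degree ?p * poly (map_poly to_ac ?p) (a ^ q)"
    using assms(2) by (simp add: poly_reflect_poly_nz degree_map_poly)
  also have "poly (map_poly to_ac ?p) (a ^ q) = 0"
    unfolding frob_poly_ac[symmetric] assms(1) by simp
  finally show ?thesis by simp
qed

theorem odd_degree_self_conj:
  assumes \<phi>: "nonzero_irreducible \<phi>" and sc: "self_conj \<phi>"
  shows "odd (degree \<phi>)"
proof -
  define Q where "Q = q\<^sup>2"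
  have irr: "irreducible \<phi>" and d0: "degree \<phi> > 0" and c0: "poly \<phi> 0 \<noteq> 0"
    using \<phi> by (simp_all add: nonzero_irreducible_def)
  let ?f = "map_poly to_ac \<phi>"
  have degf: "degree ?f = degree \<phi>" by (rule degree_map_poly) simp
  have f0: "?f \<noteq> 0" using d0 by auto
  obtain a where a: "poly ?f a = 0" using alg_closed_imp_poly_has_root[of ?f] d0 degf by auto
  have a0: "a \<noteq> 0"
  proof
    assume "a = 0"
    thus False using a c0 by (simp add: poly_0_coeff_0 coeff_map_poly)
  qed
  have pS: "a ^ (Q ^ Suc i) = (a ^ (Q ^ i)) ^ Q" for i by (simp add: power_mult[symmetric] mult.commute)
  have root: "poly ?f (a ^ (Q ^ i)) = 0" for i
  proof (induction i)
    case (Suc i)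
    have "poly ?f (a ^ (Q ^ Suc i)) = poly ?f (a ^ (Q ^ i)) ^ Q"
    proof -
      have "poly ?f ((a ^ (Q ^ i)) ^ Q) = poly ?f (a ^ (Q ^ i)) ^ Q"
        unfolding Q_def by (rule frob2_poly_ac[symmetric])
      thus ?thesis by (simp only: pS)
    qed
    also have "Q > 0" by (simp add: Q_def)
    hence "poly ?f (a ^ (Q ^ i)) ^ Q = 0" by (simp add: Suc)
    finally show ?case .
  qed (simp add: a)
  \<comment> \<open>The \<open>q\<^sup>2\<close>-Frobenius is injective on the closure, so a
    repetition in the orbit of \<open>a\<close> can be shifted back to \<open>a\<close>
    itself.\<close>
  have cancel: "a ^ (Q ^ (i + k)) = a ^ (Q ^ i) \<Longrightarrow> a ^ (Q ^ k) = a" for i k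
  proof (induction i)
    case (Suc i)
    have "(a ^ (Q ^ (i + k))) ^ Q = (a ^ (Q ^ i)) ^ Q"
      using Suc.prems by (simp only: pS[symmetric] add_Suc[symmetric])
    hence "a ^ (Q ^ (i + k)) = a ^ (Q ^ i)" unfolding Q_def by (rule frob2_inj_ac)
    thus ?case by (rule Suc.IH)
  qed simp
  have "\<exists>d>0. a ^ (Q ^ d) = a"
  proof -
    have "finite {x. poly ?f x = 0}" by (rule poly_roots_finite[OF f0])
    moreover have "range (\<lambda>i. a ^ (Q ^ i)) \<subseteq> {x. poly ?f x = 0}" using root by auto
    ultimately have "finite (range (\<lambda>i. a ^ (Q ^ i)))" by (rule finite_subset[rotated])
    hence "\<not> inj (\<lambda>i::nat. a ^ (Q ^ i))" using finite_imageD[of "\<lambda>i. a ^ (Q ^ i)" UNIV] by auto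
    then obtain i j where "i < j" "a ^ (Q ^ i) = a ^ (Q ^ j)"
      unfolding inj_def by (metis linorder_neqE_nat)
    thus ?thesis using cancel[of i "j - i"] by (intro exI[of _ "j - i"]) simp
  qed
  \<comment> \<open>The length of the Frobenius orbit of \<open>a\<close>.\<close>
  define d where "d = (LEAST d. d > 0 \<and> a ^ (Q ^ d) = a)"
  have d: "d > 0" "a ^ (Q ^ d) = a"
    using LeastI_ex[OF \<open>\<exists>d>0. a ^ (Q ^ d) = a\<close>] by (simp_all add: d_def)
  have dmin: "\<not> (a ^ (Q ^ k) = a)" if "0 < k" "k < d" for k
    using not_less_Least[of k "\<lambda>d. d > 0 \<and> a ^ (Q ^ d) = a"] that by (simp add: d_def)
  have per: "a ^ (Q ^ (k + d)) = a ^ (Q ^ k)" for k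
  proof -
    have "a ^ (Q ^ (k + d)) = (a ^ (Q ^ d)) ^ (Q ^ k)" by (simp add: power_add mult.commute flip: power_mult)
    thus ?thesis by (simp only: d(2))
  qed
  have dvd: "d dvd k" if "a ^ (Q ^ k) = a" for k
  proof -
    have "a ^ (Q ^ (r + d * m)) = a ^ (Q ^ r)" for r m
    proof (induction m)
      case (Suc m)
      thus ?case using per[of "r + d * m"] by (simp add: algebra_simps)
    qed simp
    from this[of "k mod d" "k div d"] that have "a ^ (Q ^ (k mod d)) = a" by simp
    hence "k mod d = 0" using dmin[of "k mod d"] d(1) mod_less_divisor[of d k] by auto
    thus ?thesis by (rule mod_0_imp_dvd)
  qed
  \<comment> \<open>The product over the orbit is fixed by Frobenius, so its coefficients lie in the
    field and \<phi> divides it. Hence every root of \<phi> is in the orbit and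
    \<open>degree \<phi> = d\<close>.\<close>
  define \<psi> where "\<psi> = (\<Prod>i<d. [:- (a ^ (Q ^ i)), 1:])"
  have deg\<psi>: "degree \<psi> = d" unfolding \<psi>_def by (subst degree_prod_eq_sum_degree) simp_all
  have \<psi>roots: "poly \<psi> x = 0 \<longleftrightarrow> (\<exists>i<d. x = a ^ (Q ^ i))" for x
    by (auto simp: \<psi>_def poly_prod)
  interpret fr: comm_ring_hom "\<lambda>x::'a alg_closure. x ^ Q"
    by unfold_locales (simp_all add: Q_def power2_eq_square power_mult frob_add_ac power_mult_distrib)
  interpret frp: map_poly_comm_ring_hom "\<lambda>x::'a alg_closure. x ^ Q" ..
  have "map_poly (\<lambda>x. x ^ Q) \<psi> = (\<Prod>i<d. [:- (a ^ (Q ^ Suc i)), 1:])"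
    unfolding \<psi>_def frp.hom_prod
  proof (rule prod.cong[OF refl])
    fix i
    have "Q > 0" by (simp add: Q_def)
    have "map_poly (\<lambda>x. x ^ Q) [:- (a ^ Q ^ i), 1:] = [:(- (a ^ Q ^ i)) ^ Q, 1:]"
      using \<open>Q > 0\<close> by (simp add: Polynomial.map_poly_pCons)
    also have "(- (a ^ Q ^ i)) ^ Q = - ((a ^ Q ^ i) ^ Q)" by (rule fr.hom_uminus)
    finally show "map_poly (\<lambda>x. x ^ Q) [:- (a ^ Q ^ i), 1:] = [:- (a ^ Q ^ Suc i), 1:]" by (simp only: pS)
  qed
  also have "\<dots> = \<psi>"
  proof -
    obtain d' where d': "d = Suc d'" using d(1) gr0_implies_Suc by blast
    have "(\<Prod>i<d. [:- (a ^ (Q ^ Suc i)), 1:]) = (\<Prod>i<d'. [:- (a ^ (Q ^ Suc i)), 1:]) * [:- (a ^ (Q ^ d)), 1:]"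
      by (simp add: d' del: power_Suc)
    also have "\<dots> = [:- (a ^ (Q ^ 0)), 1:] * (\<Prod>i<d'. [:- (a ^ (Q ^ Suc i)), 1:])"
      unfolding d(2) by (simp del: power_Suc add: mult.commute)
    also have "\<dots> = \<psi>" unfolding \<psi>_def d' by (subst prod.lessThan_Suc_shift) simp
    finally show ?thesis .
  qed
  finally have fix\<psi>: "map_poly (\<lambda>x. x ^ Q) \<psi> = \<psi>" .
  have "poly.coeff \<psi> i ^ (q\<^sup>2) = poly.coeff \<psi> i" for i
    using arg_cong[OF fix\<psi>, of "\<lambda>p. poly.coeff p i"] by (simp add: coeff_map_poly Q_def)
  hence co: "poly.coeff \<psi> i \<in> range to_ac" for i by (rule range_to_ac)
  define \<psi>0 where "\<psi>0 = map_poly of_ac \<psi>"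
  have \<psi>0: "map_poly to_ac \<psi>0 = \<psi>"
    by (rule poly_eqI) (simp add: \<psi>0_def coeff_map_poly to_ac_of_ac[OF co])
  have "poly \<psi> a = 0" using \<psi>roots d(1) by (intro \<psi>roots[THEN iffD2] exI[of _ 0]) simp
  hence dv: "\<phi> dvd \<psi>0" unfolding ac_common_root[OF irr] \<psi>0 using a by blast
  have \<psi>0nz: "\<psi>0 \<noteq> 0" using \<psi>0 deg\<psi> d(1) by auto
  have "degree \<psi>0 = d" using deg\<psi> \<psi>0 degree_map_poly[of to_ac \<psi>0] by simp
  hence le1: "degree \<phi> \<le> d" using dvd_imp_degree_le[OF dv \<psi>0nz] by simp
  have all: "\<exists>i<d. x = a ^ (Q ^ i)" if "poly ?f x = 0" for x
  proof -
    obtain r where "\<psi>0 = \<phi> * r" using dv by (elim dvdE)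
    hence "\<psi> = ?f * map_poly to_ac r" unfolding \<psi>0[symmetric] by (simp only: ac_poly.hom_mult)
    thus ?thesis using that \<psi>roots[of x] by simp
  qed
  have "inj_on (\<lambda>i. a ^ (Q ^ i)) {..<d}"
  proof (rule linorder_inj_onI')
    fix i j assume "i \<in> {..<d}" "j \<in> {..<d}" "i < j"
    thus "a ^ (Q ^ i) \<noteq> a ^ (Q ^ j)" using cancel[of i "j - i"] dmin[of "j - i"] by force
  qed
  hence "d = card ((\<lambda>i. a ^ (Q ^ i)) ` {..<d})" by (simp add: card_image)
  also have "\<dots> \<le> card {x. poly ?f x = 0}"
    by (rule card_mono[OF poly_roots_finite[OF f0]]) (use root in auto)
  also have "\<dots> \<le> degree \<phi>" using card_poly_roots_bound[OF f0] degf by simp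
  finally have deg: "degree \<phi> = d" using le1 by simp
  have "poly ?f (inverse (a ^ q)) = 0"
    using conj_poly_root[OF a a0] sc by (simp only: self_conj_def)
  from all[OF this] obtain i where i: "inverse (a ^ q) = a ^ (Q ^ i)" by (elim exE conjE)
  \<comment> \<open>Taking the inverse \<open>q\<close>-th power commutes with Frobenius. Done
    twice, it amounts to \<open>2 * i\<close> Frobenius steps by the choice of \<open>i\<close>, and
    to a single step by its definition.\<close>
  have "a ^ (Q ^ (i + i)) = (a ^ (Q ^ i)) ^ (Q ^ i)" by (simp only: power_add power_mult)
  also have "\<dots> = inverse (a ^ q) ^ (Q ^ i)" by (simp only: i)
  also have "\<dots> = inverse ((a ^ (Q ^ i)) ^ q)"
    by (simp add: power_inverse mult.commute flip: power_mult)
  also have "\<dots> = inverse (inverse (a ^ q) ^ q)" by (simp only: i)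
  also have "\<dots> = a ^ (q * q)" by (simp add: power_inverse power_mult)
  also have "\<dots> = a ^ (Q ^ 1)" by (simp add: Q_def power2_eq_square)
  finally have ii: "a ^ (Q ^ (i + i)) = a ^ (Q ^ 1)" .
  show ?thesis
  \<comment> \<open>The period divides \<open>2 * i - 1\<close>; for \<open>i = 0\<close> this is
    -1, which is treated apart because exponents are natural numbers.\<close>
  proof (cases i)
    case 0
    hence "a ^ (Q ^ 1) = a" using ii by simp
    hence "d dvd 1" by (rule dvd)
    thus ?thesis using deg by simp
  next
    case (Suc i')
    hence "a ^ (Q ^ (1 + (2 * i' + 1))) = a ^ (Q ^ 1)" using ii by (simp add: mult_2)
    hence "a ^ (Q ^ (2 * i' + 1)) = a" by (rule cancel)
    hence "d dvd 2 * i' + 1" by (rule dvd)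
    have "odd d"
    proof
      assume "even d"
      hence "even (2 * i' + 1)" using \<open>d dvd 2 * i' + 1\<close> by (rule dvd_trans)
      thus False by simp
    qed
    thus ?thesis using deg by simp
  qed
qed

end

subsection \<open>The limiting proportion\<close>

context herm
begin

lemma finite_monic_irreducibles: "finite (monic_irreducibles j :: 'a poly set)"
proof (rule finite_imageD)
  have inj: "p = r" if "p \<in> monic_irreducibles j" "r \<in> monic_irreducibles j" "vec (Suc j) (poly.coeff p) = vec (Suc j) (poly.coeff r)"
    for p r :: "'a poly"
  proof (rule poly_eqI)
    fix i
    show "poly.coeff p i = poly.coeff r i"
    proof (cases "i \<le> j")
      case True
      thus ?thesis using arg_cong[OF that(3), of "\<lambda>v. v $ i"] by simp
    next
      case False
      thus ?thesis using that by (simp add: monic_irreducibles_def coeff_eq_0)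
    qed
  qed
  thus "inj_on (\<lambda>p. vec (Suc j) (poly.coeff p)) (monic_irreducibles j :: 'a poly set)"
    by (intro inj_onI)
  show "finite ((\<lambda>p. vec (Suc j) (poly.coeff p)) ` (monic_irreducibles j :: 'a poly set))"
    by (rule finite_subset[OF _ finite_carrier_vec[of "Suc j"]]) auto
qed

lemma monic_irreducibles_iff:
  fixes \<phi> :: "'a poly"
  assumes "j > 0"
  shows "\<phi> \<in> monic_irreducibles j \<longleftrightarrow> nonzero_irreducible \<phi> \<and> degree \<phi> = (j :: nat)"
proof -
  have "poly \<phi> 0 \<noteq> 0 \<longleftrightarrow> \<phi> \<noteq> [:0, 1:]" if \<phi>: "irreducible \<phi>" "monic \<phi>" for \<phi> :: "'a poly"
  proof
    assume "\<phi> \<noteq> [:0, 1:]"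
    show "poly \<phi> 0 \<noteq> 0"
    proof
      assume "poly \<phi> 0 = 0"
      hence "[:0, 1:] dvd \<phi>" by (simp add: poly_eq_0_iff_dvd)
      then obtain e where e: "\<phi> = [:0, 1:] * e" by (elim dvdE)
      have "\<not> is_unit [:0, 1 :: 'a:]" by (simp add: is_unit_iff_degree)
      hence "is_unit e" using Factorial_Ring.irreducibleD[OF \<phi>(1) e] by blast
      hence "degree e = 0" by (simp add: is_unit_iff_degree)
      then obtain c where c: "e = [:c:]" by (rule degree_eq_zeroE)
      have "lead_coeff \<phi> = c" unfolding e lead_coeff_mult by (simp add: c)
      with \<open>\<phi> \<noteq> [:0, 1:]\<close> \<phi>(2) e c show False by simp
    qed
  qed auto
  thus ?thesis using assms by (auto simp: monic_irreducibles_def nonzero_irreducible_def)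
qed

lemma conj_monic_irreducible:
  assumes "\<phi> \<in> (monic_irreducibles j :: 'a poly set)" "j > 0"
  shows "conj_poly q \<phi> \<in> monic_irreducibles j" "conj_poly q (conj_poly q \<phi>) = \<phi>"
proof -
  have \<phi>: "irreducible \<phi>" "monic \<phi>" "degree \<phi> = j" "poly \<phi> 0 \<noteq> 0"
    using assms(1) monic_irreducibles_iff[OF assms(2), of \<phi>] unfolding nonzero_irreducible_def by blast+
  show "conj_poly q (conj_poly q \<phi>) = \<phi>" by (rule conj_conj_poly[OF \<phi>(4,2)])
  have "nonzero_irreducible (conj_poly q \<phi>)"
    unfolding nonzero_irreducible_def
    using \<phi> assms(2) irreducible_conj_poly[OF \<phi>(1,4,2)] monic_conj_poly[OF \<phi>(4)] degree_conj_poly[OF \<phi>(4)]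
      conj_poly_at_0[OF \<phi>(4,2)] by simp
  thus "conj_poly q \<phi> \<in> monic_irreducibles j"
    using monic_irreducibles_iff[OF assms(2), of "conj_poly q \<phi>"] degree_conj_poly[OF \<phi>(4)] \<phi>(3) by simp
qed

section \<open>Representatives of conjugate pairs\<close>

definition self_conjs :: "nat \<Rightarrow> 'a poly set" where
  "self_conjs j = {\<phi> \<in> monic_irreducibles j. self_conj \<phi>}"

definition conj_pairs :: "nat \<Rightarrow> 'a poly set set" where
  "conj_pairs j = {{\<phi>, conj_poly q \<phi>} | \<phi>. \<phi> \<in> monic_irreducibles j \<and> \<phi> \<noteq> conj_poly q \<phi>}"

definition pair_reps :: "nat \<Rightarrow> 'a poly set" where
  "pair_reps j = (\<lambda>s. SOME \<phi>. \<phi> \<in> s) ` conj_pairs j"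

lemma card_self_conjs: "card (self_conjs j) = N_tilde TYPE('a) q j"
proof -
  have "self_conjs j = {\<phi> \<in> monic_irreducibles j. \<phi> = conj_poly q \<phi>}"
    by (auto simp: self_conjs_def self_conj_def)
  thus ?thesis by (simp add: N_tilde_def)
qed

lemma conj_pair_cases:
  assumes "s \<in> conj_pairs j" "j > 0" "\<phi> \<in> s"
  shows "\<phi> \<in> monic_irreducibles j" "conj_poly q \<phi> \<noteq> \<phi>" "s = {\<phi>, conj_poly q \<phi>}"
proof -
  obtain \<psi> where \<psi>: "\<psi> \<in> monic_irreducibles j" "\<psi> \<noteq> conj_poly q \<psi>" "s = {\<psi>, conj_poly q \<psi>}"
    using assms(1) by (auto simp: conj_pairs_def)
  note c = conj_monic_irreducible[OF \<psi>(1) assms(2)]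
  show "\<phi> \<in> monic_irreducibles j" "conj_poly q \<phi> \<noteq> \<phi>" "s = {\<phi>, conj_poly q \<phi>}"
    using assms(3) \<psi> c by auto
qed

lemma some_in_pair: "s \<in> conj_pairs j \<Longrightarrow> (SOME \<phi>. \<phi> \<in> s) \<in> s"
  by (rule someI_ex) (auto simp: conj_pairs_def)

lemma card_pair_reps:
  assumes "j > 0" shows "card (pair_reps j) = M_tilde TYPE('a) q j"
proof -
  have "inj_on (\<lambda>s. SOME \<phi>. \<phi> \<in> s) (conj_pairs j)"
  proof (rule inj_onI)
    fix s t assume s: "s \<in> conj_pairs j" and t: "t \<in> conj_pairs j" and eq: "(SOME \<phi>. \<phi> \<in> s) = (SOME \<phi>. \<phi> \<in> t)"
    from conj_pair_cases(3)[OF s assms some_in_pair[OF s]] conj_pair_cases(3)[OF t assms some_in_pair[OF t]] eq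
    show "s = t" by simp
  qed
  thus ?thesis by (simp add: pair_reps_def card_image M_tilde_def conj_pairs_def)
qed

lemma pair_reps_props:
  assumes "\<phi> \<in> pair_reps j" "j > 0"
  shows "\<phi> \<in> monic_irreducibles j" "\<not> self_conj \<phi>" "conj_poly q \<phi> \<notin> pair_reps j"
proof -
  obtain s where s: "s \<in> conj_pairs j" "\<phi> = (SOME \<phi>. \<phi> \<in> s)" using assms(1) by (auto simp: pair_reps_def)
  hence \<phi>s: "\<phi> \<in> s" using some_in_pair by simp
  note c = conj_pair_cases[OF s(1) assms(2) \<phi>s]
  show "\<phi> \<in> monic_irreducibles j" "\<not> self_conj \<phi>" using c by (simp_all add: self_conj_def)
  show "conj_poly q \<phi> \<notin> pair_reps j"
  proof
    assume "conj_poly q \<phi> \<in> pair_reps j"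
    then obtain t where t: "t \<in> conj_pairs j" "conj_poly q \<phi> = (SOME \<phi>. \<phi> \<in> t)" by (auto simp: pair_reps_def)
    hence "conj_poly q \<phi> \<in> t" using some_in_pair by simp
    from conj_pair_cases(3)[OF t(1) assms(2) this] conj_monic_irreducible(2)[OF c(1) assms(2)] c(3)
    have "t = s" by auto
    with s(2) t(2) c(2) show False by simp
  qed
qed

lemma pair_reps_cover:
  assumes "\<phi> \<in> monic_irreducibles j" "j > 0" "\<not> self_conj \<phi>"
  shows "\<phi> \<in> pair_reps j \<or> conj_poly q \<phi> \<in> pair_reps j"
proof -
  let ?s = "{\<phi>, conj_poly q \<phi>}"
  have "\<phi> \<noteq> conj_poly q \<phi>" using assms(3) by (simp add: self_conj_def)
  hence s: "?s \<in> conj_pairs j" unfolding conj_pairs_def using assms(1) by blast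
  hence "(SOME \<psi>. \<psi> \<in> ?s) \<in> pair_reps j" by (simp only: pair_reps_def image_eqI)
  moreover have "(SOME \<psi>. \<psi> \<in> ?s) \<in> ?s" by (rule some_in_pair[OF s])
  ultimately show ?thesis by auto
qed

text \<open>The index set of the sieve. One member of each conjugate pair satisfies the condition of
  \<open>joint_moments\<close> and still detects every factor of degree at most
  \<open>t\<close>.\<close>

definition test_polys :: "nat \<Rightarrow> 'a poly set" where
  "test_polys t = (\<Union>j\<in>{1..t}. self_conjs j \<union> pair_reps j)"

lemma finite_self_conjs: "finite (self_conjs j)"
  by (rule finite_subset[OF _ finite_monic_irreducibles[of j]]) (auto simp: self_conjs_def)

lemma finite_pair_reps: "j > 0 \<Longrightarrow> finite (pair_reps j)"
  by (rule finite_subset[OF _ finite_monic_irreducibles[of j]]) (auto dest: pair_reps_props(1))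

lemma finite_test_polys: "finite (test_polys t)"
  by (auto simp: test_polys_def finite_self_conjs finite_pair_reps)

lemma test_polys_nonzero_irreducible: "\<phi> \<in> test_polys t \<Longrightarrow> nonzero_irreducible \<phi>"
  using monic_irreducibles_iff pair_reps_props(1)
  by (fastforce simp: test_polys_def self_conjs_def)

lemma test_polys_degree:
  assumes "\<phi> \<in> test_polys t"
  shows "degree \<phi> \<in> {1..t}" "\<phi> \<in> self_conjs (degree \<phi>) \<or> \<phi> \<in> pair_reps (degree \<phi>)"
proof -
  obtain j where j: "j \<in> {1..t}" "\<phi> \<in> self_conjs j \<or> \<phi> \<in> pair_reps j" using assms by (auto simp: test_polys_def)
  hence "\<phi> \<in> monic_irreducibles j" using pair_reps_props(1)[of \<phi> j] by (auto simp: self_conjs_def)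
  hence "degree \<phi> = j" by (simp add: monic_irreducibles_def)
  with j show "degree \<phi> \<in> {1..t}" "\<phi> \<in> self_conjs (degree \<phi>) \<or> \<phi> \<in> pair_reps (degree \<phi>)" by simp_all
qed

lemma test_polys_rep:
  assumes "\<phi> \<in> test_polys t" "\<psi> \<in> test_polys t" "conj_poly q \<phi> = \<psi>"
  shows "\<phi> = \<psi>"
proof (rule ccontr)
  assume ne: "\<phi> \<noteq> \<psi>"
  have dp: "degree \<phi> > 0" "poly \<phi> 0 \<noteq> 0" "monic \<phi>"
    using test_polys_nonzero_irreducible[OF assms(1)] by (simp_all add: nonzero_irreducible_def)
  have deg: "degree \<psi> = degree \<phi>" using degree_conj_poly[OF dp(2)] assms(3) by simp
  have "\<not> self_conj \<phi>" using ne assms(3) by (simp add: self_conj_def)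
  hence \<phi>: "\<phi> \<in> pair_reps (degree \<phi>)" using test_polys_degree(2)[OF assms(1)] by (simp add: self_conjs_def)
  have "\<not> self_conj \<psi>"
    using ne assms(3) conj_conj_poly[OF dp(2,3)] by (auto simp: self_conj_def)
  hence "\<psi> \<in> pair_reps (degree \<phi>)"
    using test_polys_degree(2)[OF assms(2)] deg by (simp add: self_conjs_def)
  with pair_reps_props(3)[OF \<phi> dp(1)] assms(3) show False by simp
qed

text \<open>A factor is made monic; it is not z because \<open>A\<close> is invertible; and if it is
  no test polynomial itself, its conjugate is one, and both kernels are trivial at the same
  time.\<close>

lemma no_factor_upto_iff:
  assumes A: "A \<in> unitary n"
  shows "no_factor_upto t (char_poly A) \<longleftrightarrow> (\<forall>\<phi>\<in>test_polys t. card (kerp A \<phi>) = 1)"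
proof
  note Ac = unitary_carrier[OF A]
  assume nf: "no_factor_upto t (char_poly A)"
  show "\<forall>\<phi>\<in>test_polys t. card (kerp A \<phi>) = 1"
  proof
    fix \<phi> assume \<phi>: "\<phi> \<in> test_polys t"
    hence "irreducible \<phi>" "degree \<phi> \<le> t"
      using test_polys_nonzero_irreducible[OF \<phi>] test_polys_degree(1)[OF \<phi>] by (simp_all add: nonzero_irreducible_def)
    thus "card (kerp A \<phi>) = 1" using nf dvd_char_poly_iff[OF Ac] by (auto simp: no_factor_upto_def)
  qed
next
  note Ac = unitary_carrier[OF A]
  assume k1: "\<forall>\<phi>\<in>test_polys t. card (kerp A \<phi>) = 1"
  show "no_factor_upto t (char_poly A)"
    unfolding no_factor_upto_def
  proof (intro allI impI notI)
    fix \<psi> assume \<psi>: "irreducible \<psi> \<and> degree \<psi> \<le> t" and dvd: "\<psi> dvd char_poly A"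
    define c where "c = inverse (lead_coeff \<psi>)"
    define \<phi> where "\<phi> = Polynomial.smult c \<psi>"
    have \<psi>0: "\<psi> \<noteq> 0" "\<not> is_unit \<psi>" using \<psi> unfolding Factorial_Ring.irreducible_def by blast+
    hence c0: "c \<noteq> 0" by (simp add: c_def)
    have irr: "irreducible \<phi>" using \<psi> c0 by (simp add: \<phi>_def)
    have m: "monic \<phi>" using \<psi>0 by (simp add: \<phi>_def c_def)
    have dv: "\<phi> dvd char_poly A" using dvd c0 by (simp add: \<phi>_def smult_dvd_iff)
    have deg: "degree \<phi> > 0" "degree \<phi> \<le> t"
      using \<psi>0 \<psi> c0 by (simp_all add: \<phi>_def is_unit_iff_degree)
    have "poly (char_poly A) 0 \<noteq> 0"
    proof
      assume "poly (char_poly A) 0 = 0"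
      hence "det (char_matrix A 0) = 0"
        using eigenvalue_root_char_poly[OF Ac] eigenvalue_det[OF Ac] by simp
      moreover have "char_matrix A 0 = A"
        unfolding char_matrix_def using Ac by (intro eq_matI) simp_all
      ultimately show False using det_unitary[OF A] by simp
    qed
    hence p0: "poly \<phi> 0 \<noteq> 0" using dv by (metis dvdE poly_mult mult_zero_left)
    have "\<phi> \<in> monic_irreducibles (degree \<phi>)"
      using monic_irreducibles_iff[OF deg(1), of \<phi>] irr m p0 deg by (simp add: nonzero_irreducible_def)
    hence "\<phi> \<in> self_conjs (degree \<phi>) \<or> \<phi> \<in> pair_reps (degree \<phi>) \<or> conj_poly q \<phi> \<in> pair_reps (degree \<phi>)"
      using pair_reps_cover[OF _ deg(1), of \<phi>] by (auto simp: self_conjs_def)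
    hence "\<phi> \<in> test_polys t \<or> conj_poly q \<phi> \<in> test_polys t"
      using deg by (auto simp: test_polys_def Bex_def intro!: exI[of _ "degree \<phi>"])
    hence "card (kerp A \<phi>) = 1"
      using k1 card_kerp_conj_poly[OF A _ p0] \<psi>0(1) c0 by (auto simp: \<phi>_def)
    thus False using dv dvd_char_poly_iff[OF Ac irr] by simp
  qed
qed

lemma char_limit:
  fixes C :: "nat \<Rightarrow> 'a mat set"
  assumes C: "\<And>n. n \<ge> 1 \<Longrightarrow> C n \<in> rcosets\<^bsub>GU q n\<^esub> (SU q n)"
  defines "s \<equiv> \<lambda>\<phi>. if self_conj \<phi> then (\<Prod>i. 1 + 1 / (- (real q ^ degree \<phi>)) ^ Suc i)
                    else (\<Prod>i. 1 - 1 / (real (q ^ (2 * degree \<phi>))) ^ Suc i)"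
  shows "(\<lambda>n. real (card {A \<in> C n. no_factor_upto t (char_poly A)}) / real (card (C n)))
    \<longlonglongrightarrow> (\<Prod>\<phi>\<in>test_polys t. s \<phi>)"
proof -
  let ?P = "test_polys t"
  let ?Q = "\<lambda>\<phi>::'a poly. real (q ^ (2 * degree \<phi>))"
  \<comment> \<open>The mean of \<open>binom_moment\<close>: the moment from
    \<open>joint_moments\<close> divided by the normalising product.\<close>
  define c where "c = (\<lambda>(\<phi>::'a poly) m. (if self_conj \<phi> then real q ^ (degree \<phi> * m\<^sup>2) else 1) / (\<Prod>i<m. ?Q \<phi> ^ Suc i - 1))"
  have CU: "\<exists>g\<in>unitary n. C n = (\<lambda>s. s * g) ` special n" if "n \<ge> 1" for n
    by (rule rcosets_SU[OF C[OF that]])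
  have Cu: "A \<in> unitary n" if "n \<ge> 1" "A \<in> C n" for n A
    using CU[OF that(1)] that(2) unitary_mult special_unitary by fastforce
  have q1: "real q > 1" using q_ge_2 by simp
  have Q1: "?Q \<phi> > 1" if "\<phi> \<in> ?P" for \<phi>
    using test_polys_nonzero_irreducible[OF that] q1 one_less_power[of "real q" "2 * degree \<phi>"]
    by (simp add: nonzero_irreducible_def)
  have r1: "real q ^ degree \<phi> > 1" if "\<phi> \<in> ?P" for \<phi>
    using test_polys_nonzero_irreducible[OF that] q1 one_less_power[of "real q" "degree \<phi>"]
    by (simp add: nonzero_irreducible_def)
  \<comment> \<open>With \<open>real q ^ degree \<phi>\<close> as \<open>r\<close>, this brings the
    self-conjugate case into the form of \<open>euler_odd\<close>.\<close>
  have Qr: "?Q \<phi> = (real q ^ degree \<phi>)\<^sup>2" for \<phi> by (simp add: power_mult[symmetric] mult.commute)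
  have lim: "c \<phi> \<longlonglongrightarrow> 0 \<and> (\<lambda>m. (-1) ^ m * c \<phi> m) sums s \<phi>" if \<phi>: "\<phi> \<in> ?P" for \<phi>
  proof (cases "self_conj \<phi>")
    case True
    have "c \<phi> = (\<lambda>m. (real q ^ degree \<phi>) ^ m\<^sup>2 / (\<Prod>i<m. ((real q ^ degree \<phi>)\<^sup>2) ^ Suc i - 1))"
      unfolding c_def Qr using True by (simp add: power_mult)
    thus ?thesis using euler_odd(1,2)[OF r1[OF \<phi>]] True by (simp only: s_def if_True)
  next
    case False
    have "c \<phi> = (\<lambda>m. 1 / (\<Prod>i<m. ?Q \<phi> ^ Suc i - 1))" unfolding c_def using False by simp
    thus ?thesis using euler_second(1,2)[OF Q1[OF \<phi>]] False by (simp only: s_def if_False)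
  qed
  have "(\<lambda>n. real (card {A \<in> C n. \<forall>\<phi>\<in>?P. real (card (kerp A \<phi>)) = 1}) / real (card (C n)))
      \<longlonglongrightarrow> (\<Prod>\<phi>\<in>?P. s \<phi>)"
  proof (rule sieve_limit[where Q = ?Q and c = c])
    show "finite ?P" by (rule finite_test_polys)
    show "?Q \<phi> > 1" if "\<phi> \<in> ?P" for \<phi> by (rule Q1[OF that])
    show "\<forall>\<^sub>F n in sequentially. finite (C n) \<and> C n \<noteq> {}"
    proof (rule eventually_sequentiallyI[of 1])
      fix n :: nat assume "n \<ge> 1"
      from CU[OF this] show "finite (C n) \<and> C n \<noteq> {}" using finite_special one_special by auto
    qed
    show "\<forall>\<^sub>F n in sequentially. \<forall>\<phi>\<in>?P. \<forall>A\<in>C n. \<exists>k. real (card (kerp A \<phi>)) = ?Q \<phi> ^ k"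
    proof (intro eventually_sequentiallyI[of 1] ballI)
      fix n :: nat and \<phi> A assume n: "n \<ge> 1" and \<phi>: "\<phi> \<in> ?P" and A: "A \<in> C n"
      obtain m where "card (kerp A \<phi>) = (CARD('a) ^ degree \<phi>) ^ m"
        using card_kerp_eq_power[OF unitary_carrier[OF Cu[OF n A]] test_polys_nonzero_irreducible[OF \<phi>]] by blast
      thus "\<exists>k. real (card (kerp A \<phi>)) = ?Q \<phi> ^ k" by (intro exI[of _ m]) (simp add: card_q power_mult)
    qed
    show "\<forall>\<^sub>F n in sequentially. (\<Sum>A\<in>C n. \<Prod>\<phi>\<in>?P. binom_moment (?Q \<phi>) (m \<phi>) (real (card (kerp A \<phi>))))
        = real (card (C n)) * (\<Prod>\<phi>\<in>?P. c \<phi> (m \<phi>))" for m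
    proof -
      obtain n0 where n0: "\<forall>n\<ge>n0. \<forall>C\<in>rcosets\<^bsub>GU q n\<^esub> (SU q n :: 'a mat set).
        (\<Sum>A\<in>C. \<Prod>\<phi>\<in>?P. \<Prod>i<m \<phi>. real (card (kerp A \<phi>)) - ?Q \<phi> ^ i)
         = real (card C) * (\<Prod>\<phi>\<in>?P. if self_conj \<phi> then real q ^ (degree \<phi> * (m \<phi>)\<^sup>2) else 1)"
      proof -
        have "\<exists>n0. \<forall>n\<ge>n0. \<forall>C\<in>rcosets\<^bsub>GU q n\<^esub> (SU q n :: 'a mat set).
          (\<Sum>A\<in>C. \<Prod>\<phi>\<in>?P. \<Prod>i<m \<phi>. real (card (kerp A \<phi>)) - ?Q \<phi> ^ i)
           = real (card C) * (\<Prod>\<phi>\<in>?P. if self_conj \<phi> then real q ^ (degree \<phi> * (m \<phi>)\<^sup>2) else 1)"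
        proof (rule joint_moments[OF finite_test_polys])
          show "nonzero_irreducible \<phi>" if "\<phi> \<in> ?P" for \<phi> by (rule test_polys_nonzero_irreducible[OF that])
          show "\<phi> = \<psi>" if "\<phi> \<in> ?P" "\<psi> \<in> ?P" "conj_poly q \<phi> = \<psi>" for \<phi> \<psi> by (rule test_polys_rep[OF that])
        qed
        thus ?thesis using that by blast
      qed
      show ?thesis
      proof (rule eventually_sequentiallyI[of "max n0 1"])
        fix n assume n: "max n0 1 \<le> n"
        have "(\<Sum>A\<in>C n. \<Prod>\<phi>\<in>?P. binom_moment (?Q \<phi>) (m \<phi>) (real (card (kerp A \<phi>))))
            = (\<Sum>A\<in>C n. \<Prod>\<phi>\<in>?P. \<Prod>i<m \<phi>. real (card (kerp A \<phi>)) - ?Q \<phi> ^ i) / (\<Prod>\<phi>\<in>?P. \<Prod>i<m \<phi>. ?Q \<phi> ^ Suc i - 1)"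
          by (simp add: binom_moment_def prod_dividef sum_divide_distrib del: power_Suc)
        also have "(\<Sum>A\<in>C n. \<Prod>\<phi>\<in>?P. \<Prod>i<m \<phi>. real (card (kerp A \<phi>)) - ?Q \<phi> ^ i)
            = real (card (C n)) * (\<Prod>\<phi>\<in>?P. if self_conj \<phi> then real q ^ (degree \<phi> * (m \<phi>)\<^sup>2) else 1)"
          by (rule n0[rule_format]) (use C[of n] n in simp_all)
        finally show "(\<Sum>A\<in>C n. \<Prod>\<phi>\<in>?P. binom_moment (?Q \<phi>) (m \<phi>) (real (card (kerp A \<phi>))))
            = real (card (C n)) * (\<Prod>\<phi>\<in>?P. c \<phi> (m \<phi>))"
          by (simp add: c_def prod_dividef del: power_Suc)
      qed
    qed
    show "c \<phi> \<longlonglongrightarrow> 0" "(\<lambda>m. (-1) ^ m * c \<phi> m) sums s \<phi>" if "\<phi> \<in> ?P" for \<phi> using lim[OF that] by simp_all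
    show "c \<phi> 0 = 1" for \<phi> by (simp add: c_def)
  qed
  moreover have "\<forall>\<^sub>F n in sequentially.
      real (card {A \<in> C n. \<forall>\<phi>\<in>?P. real (card (kerp A \<phi>)) = 1}) / real (card (C n))
      = real (card {A \<in> C n. no_factor_upto t (char_poly A)}) / real (card (C n))"
  proof (rule eventually_sequentiallyI[of 1])
    fix n :: nat assume n: "n \<ge> 1"
    have "{A \<in> C n. \<forall>\<phi>\<in>?P. real (card (kerp A \<phi>)) = 1} = {A \<in> C n. no_factor_upto t (char_poly A)}"
      using no_factor_upto_iff[OF Cu[OF n]] by auto
    thus "real (card {A \<in> C n. \<forall>\<phi>\<in>?P. real (card (kerp A \<phi>)) = 1}) / real (card (C n))
      = real (card {A \<in> C n. no_factor_upto t (char_poly A)}) / real (card (C n))" by simp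
  qed
  ultimately show ?thesis by (rule Lim_transform_eventually)
qed

lemma prod_test_polys:
  fixes s :: "'a poly \<Rightarrow> real"
  assumes "\<And>j \<phi>. j \<in> {1..t} \<Longrightarrow> \<phi> \<in> self_conjs j \<Longrightarrow> s \<phi> = a j"
    and "\<And>j \<phi>. j \<in> {1..t} \<Longrightarrow> \<phi> \<in> pair_reps j \<Longrightarrow> s \<phi> = b j"
  shows "(\<Prod>\<phi>\<in>test_polys t. s \<phi>)
    = (\<Prod>j=1..t. a j ^ N_tilde TYPE('a) q j * b j ^ M_tilde TYPE('a) q j)"
proof -
  have mi: "\<phi> \<in> monic_irreducibles j" if "\<phi> \<in> self_conjs j \<union> pair_reps j" "j > 0" for \<phi> j
    using that pair_reps_props(1) by (auto simp: self_conjs_def)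
  have "(\<Prod>\<phi>\<in>test_polys t. s \<phi>) = (\<Prod>j\<in>{1..t}. \<Prod>\<phi>\<in>self_conjs j \<union> pair_reps j. s \<phi>)"
    unfolding test_polys_def
  proof (rule prod.UNION_disjoint)
    show "\<forall>i\<in>{1..t}. finite (self_conjs i \<union> pair_reps i)" by (simp add: finite_self_conjs finite_pair_reps)
    show "\<forall>i\<in>{1..t}. \<forall>j\<in>{1..t}. i \<noteq> j \<longrightarrow> (self_conjs i \<union> pair_reps i) \<inter> (self_conjs j \<union> pair_reps j) = {}"
    proof (intro ballI impI equals0I)
      fix i j \<phi> assume "i \<in> {1..t}" "j \<in> {1..t}" "i \<noteq> j"
        and "\<phi> \<in> (self_conjs i \<union> pair_reps i) \<inter> (self_conjs j \<union> pair_reps j)"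
      hence "\<phi> \<in> monic_irreducibles i" "\<phi> \<in> monic_irreducibles j" using mi[of \<phi> i] mi[of \<phi> j] by auto
      with \<open>i \<noteq> j\<close> show False by (simp add: monic_irreducibles_def)
    qed
  qed simp
  also have "\<dots> = (\<Prod>j\<in>{1..t}. a j ^ N_tilde TYPE('a) q j * b j ^ M_tilde TYPE('a) q j)"
  proof (rule prod.cong[OF refl])
    fix j assume j: "j \<in> {1..t}"
    hence j0: "j > 0" by simp
    have "self_conjs j \<inter> pair_reps j = {}" using pair_reps_props(2)[OF _ j0] by (auto simp: self_conjs_def)
    hence "(\<Prod>\<phi>\<in>self_conjs j \<union> pair_reps j. s \<phi>) = (\<Prod>\<phi>\<in>self_conjs j. s \<phi>) * (\<Prod>\<phi>\<in>pair_reps j. s \<phi>)"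
      by (intro prod.union_disjoint finite_self_conjs finite_pair_reps[OF j0])
    also have "(\<Prod>\<phi>\<in>self_conjs j. s \<phi>) = a j ^ card (self_conjs j)" using assms(1)[OF j] by simp
    also have "(\<Prod>\<phi>\<in>pair_reps j. s \<phi>) = b j ^ card (pair_reps j)" using assms(2)[OF j] by simp
    finally show "(\<Prod>\<phi>\<in>self_conjs j \<union> pair_reps j. s \<phi>) = a j ^ N_tilde TYPE('a) q j * b j ^ M_tilde TYPE('a) q j"
      by (simp add: card_self_conjs card_pair_reps[OF j0])
  qed
  finally show ?thesis .
qed

end

theorem theorem2p6:
  fixes q t :: nat
    and C :: "nat \<Rightarrow> 'a::{field,finite} mat set"
  assumes "primepow q"
    and "CARD('a) = q ^ 2"
    and "t \<ge> 1"
    and "\<And>n. n \<ge> 1 \<Longrightarrow> C n \<in> rcosets\<^bsub>GU q n\<^esub> (SU q n)"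
  shows "(\<lambda>n. real (card {A \<in> C n. no_factor_upto t (char_poly A)}) / real (card (C n)))
    \<longlonglongrightarrow> (\<Prod>j=1..t.
            (\<Prod>i. (1 + 1 / (- real q) ^ (Suc i * j)) ^ N_tilde TYPE('a) q j) *
            (\<Prod>i. (1 - 1 / real q ^ (2 * Suc i * j)) ^ M_tilde TYPE('a) q j))"
proof -
  interpret herm q "TYPE('a)"
    by unfold_locales (rule assms(1,2))+
  define a where "a = (\<lambda>j. \<Prod>i. 1 + 1 / (- (real q ^ j)) ^ Suc i)"
  define b where "b = (\<lambda>j. \<Prod>i. 1 - 1 / real (q ^ (2 * j)) ^ Suc i)"
  have q1: "real q > 1" using q_ge_2 by simp
  note lim = char_limit[of C t, OF assms(4)]
  have "(\<Prod>\<phi>\<in>test_polys t. if self_conj \<phi> then (\<Prod>i. 1 + 1 / (- (real q ^ degree \<phi>)) ^ Suc i)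
      else (\<Prod>i. 1 - 1 / (real (q ^ (2 * degree \<phi>))) ^ Suc i))
    = (\<Prod>j=1..t. a j ^ N_tilde TYPE('a) q j * b j ^ M_tilde TYPE('a) q j)"
  proof (rule prod_test_polys)
    fix j and \<phi> :: "'a poly" assume "j \<in> {1..t}" "\<phi> \<in> self_conjs j"
    thus "(if self_conj \<phi> then (\<Prod>i. 1 + 1 / (- (real q ^ degree \<phi>)) ^ Suc i)
      else (\<Prod>i. 1 - 1 / (real (q ^ (2 * degree \<phi>))) ^ Suc i)) = a j"
      by (simp add: self_conjs_def monic_irreducibles_def a_def)
  next
    fix j and \<phi> :: "'a poly" assume j: "j \<in> {1..t}" and \<phi>: "\<phi> \<in> pair_reps j"
    hence "\<phi> \<in> monic_irreducibles j" "\<not> self_conj \<phi>" using pair_reps_props[OF \<phi>] by simp_all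
    thus "(if self_conj \<phi> then (\<Prod>i. 1 + 1 / (- (real q ^ degree \<phi>)) ^ Suc i)
      else (\<Prod>i. 1 - 1 / (real (q ^ (2 * degree \<phi>))) ^ Suc i)) = b j"
      by (simp add: monic_irreducibles_def b_def)
  qed
  also have "\<dots> = (\<Prod>j=1..t.
            (\<Prod>i. (1 + 1 / (- real q) ^ (Suc i * j)) ^ N_tilde TYPE('a) q j) *
            (\<Prod>i. (1 - 1 / real q ^ (2 * Suc i * j)) ^ M_tilde TYPE('a) q j))"
  proof (rule prod.cong[OF refl])
    fix j assume "j \<in> {1..t}"
    hence j: "j > 0" by simp
    have rj: "real q ^ j > 1" using one_less_power[OF q1 j] .
    have Qj: "real (q ^ (2 * j)) > 1" using one_less_power[OF q1, of "2 * j"] j by simp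
    have "(\<Prod>i. (1 - 1 / real q ^ (2 * Suc i * j)) ^ M_tilde TYPE('a) q j) = b j ^ M_tilde TYPE('a) q j"
    proof -
      have "real q ^ (2 * Suc i * j) = real (q ^ (2 * j)) ^ Suc i" for i
        by (simp only: of_nat_power power_mult[symmetric]) (simp add: mult_ac)
      thus ?thesis unfolding b_def by (simp only: prodinf_power[OF euler_second(3)[OF Qj]])
    qed
    moreover have "(\<Prod>i. (1 + 1 / (- real q) ^ (Suc i * j)) ^ N_tilde TYPE('a) q j) = a j ^ N_tilde TYPE('a) q j"
    \<comment> \<open>For odd \<open>j\<close> the j-th power of -q is the negative of q^j, as in
      \<open>a j\<close>. For even \<open>j\<close> the two differ in sign, but then no polynomial
      of degree \<open>j\<close> is self-conjugate and the exponent is 0.\<close>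
    proof (cases "odd j")
      case True
      have "(- real q) ^ (Suc i * j) = (- (real q ^ j)) ^ Suc i" for i
      proof -
        have "(- real q) ^ (Suc i * j) = ((- real q) ^ j) ^ Suc i"
          by (simp only: power_mult[symmetric] mult.commute)
        thus ?thesis by (simp only: power_minus_odd[OF True])
      qed
      thus ?thesis unfolding a_def by (simp only: prodinf_power[OF euler_odd(3)[OF rj]])
    next
      case False
      have "self_conjs j = {}"
      proof (rule equals0I)
        fix \<phi> :: "'a poly" assume "\<phi> \<in> self_conjs j"
        hence "nonzero_irreducible \<phi>" "self_conj \<phi>" "degree \<phi> = j"
          using monic_irreducibles_iff[OF j] by (simp_all add: self_conjs_def)
        with odd_degree_self_conj False show False by blast
      qed
      hence "N_tilde TYPE('a) q j = 0" using card_self_conjs[of j] by simp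
      thus ?thesis by simp
    qed
    ultimately show "a j ^ N_tilde TYPE('a) q j * b j ^ M_tilde TYPE('a) q j =
            (\<Prod>i. (1 + 1 / (- real q) ^ (Suc i * j)) ^ N_tilde TYPE('a) q j) *
            (\<Prod>i. (1 - 1 / real q ^ (2 * Suc i * j)) ^ M_tilde TYPE('a) q j)" by (simp only:)
  qed
  finally show ?thesis using lim by (simp only:)
qed

end
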